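(* Let $n\ge 1$ and $m\ge 2$ be integers, and let $\mathcal{K}$ be a multilinear Littlewood--Paley kernel of convolution type on $(\mathbb R^n)^m$ (as defined in the context) such that the associated multilinear Lusin area integral satisfies the standing boundedness assumption of the context. Then for every $\vec f=(f_1,\dots,f_m)$ with each $f_i\in \mathrm{BMO}(\mathbb R^n)$, the function $S(\vec f)$ is either infinite everywhere or finite almost everywhere on $\mathbb R^n$, and in the latter case there is a constant $C>0$ independent of $\vec f$ such that $$\big\|[S(\vec f)]^2\big\|_{\mathrm{BLO}}\le C\prod_{i=1}^m\|f_i\|_{\mathrm{BMO}}^2.$$
   Context: A function $\mathcal{K}$ on $(\mathbb R^n)^m$ is a multilinear Littlewood--Paley kernel (of convolution type) if: (1) for each $i$, $\int_{\mathbb R^n}\mathcal{K}(y_1,\dots,y_i,\dots,y_m)\,dy_i=0$; (2) there are $C,\delta>0$ with $|\mathcal{K}(y_1,\dots,y_m)|\le C(1+\sum_{j=1}^m|y_j|)^{-(mn+\delta)}$; (3) there are $C,\gamma>0$ with $|\mathcal{K}(y_1,\dots,y_i,\dots,y_m)-\mathcal{K}(y_1,\dots,y_i',\dots,y_m)|\le C|y_i-y_i'|^{\gamma}(1+\sum_{j=1}^m|y_j|)^{-(mn+\delta+\gamma)}$ whenever $2|y_i-y_i'|\le\max_{j}|y_j|$, for all $1\le i\le m$. For $t>0$, $\mathcal{K}_t(y_1,\dots,y_m)=t^{-mn}\mathcal{K}(y_1/t,\dots,y_m/t)$ and $\mathcal{G}_t(\vec f)(x)=\int_{(\mathbb R^n)^m}\mathcal{K}_t(x-y_1,\dots,x-y_m)\prod_{i=1}^m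 f_i(y_i)\,dy_i$. The multilinear Lusin area integral is $S(\vec f)(x)=\big(\iint_{\Gamma(x)}|\mathcal{G}_t(\vec f)(z)|^2\frac{dz\,dt}{t^{n+1}}\big)^{1/2}$, where $\Gamma(x)=\{(z,t)\in\mathbb R^n\times(0,\infty):|z-x|<t\}$. Standing assumption: $S$ extends to a bounded multilinear operator $L^{q_1}\times\cdots\times L^{q_m}\to L^q(\mathbb R^n)$ for some $1\le q_i<\infty$, $0<q<\infty$, $1/q=\sum_i1/q_i$. $\|f\|_{\mathrm{BMO}}=\sup_B\frac{1}{|B|}\int_B|f-f_B|$ over balls $B$. $\mathrm{BLO}(\mathbb R^n)$ consists of locally integrable $F$ for which there is $C$ with $\frac{1}{|B|}\int_B[F(x)-\operatorname{ess\,inf}_{y\in B}F(y)]dx\le C$ for all balls $B$; the least such $C$ is $\|F\|_{\mathrm{BLO}}$. *)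

theory Defs
  imports "HOL-Analysis.Analysis"
begin

text \<open>Vectors \<open>(y_1,...,y_m)\<close> in \<open>(R^n)^m\<close> are encoded as functions \<open>nat \<Rightarrow> 'a\<close>;
  only the coordinates \<open>j < m\<close> matter.  The space \<open>R^n\<close> is an arbitrary Euclidean
  space \<open>'a\<close> with \<open>n = DIM('a)\<close>.\<close>

definition ssum_norm :: "nat \<Rightarrow> (nat \<Rightarrow> 'a::euclidean_space) \<Rightarrow> real" where
  "ssum_norm m y = (\<Sum>j<m. norm (y j))"

definition smax_norm :: "nat \<Rightarrow> (nat \<Rightarrow> 'a::euclidean_space) \<Rightarrow> real" where
  "smax_norm m y = Max ((\<lambda>j. norm (y j)) ` {..<m})"

definition LP_kernel :: "nat \<Rightarrow> ((nat \<Rightarrow> 'a::euclidean_space) \<Rightarrow> real) \<Rightarrow> bool" where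
  "LP_kernel m K \<longleftrightarrow>
     K \<in> borel_measurable (PiM {..<m} (\<lambda>_. lborel)) \<and>
     (\<forall>i<m. \<forall>y. (LINT z|lborel. K (y(i := z))) = 0) \<and>
     (\<exists>C \<delta>. C > 0 \<and> \<delta> > 0 \<and>
        (\<forall>y. \<bar>K y\<bar> \<le> C * (1 + ssum_norm m y) powr (- (real m * real DIM('a) + \<delta>)))) \<and>
     (\<exists>C \<delta> \<gamma>. C > 0 \<and> \<delta> > 0 \<and> \<gamma> > 0 \<and>
        (\<forall>i<m. \<forall>y y'. 2 * norm (y i - y') \<le> smax_norm m y \<longrightarrow>
           \<bar>K y - K (y(i := y'))\<bar> \<le>
             C * norm (y i - y') powr \<gamma> *
               (1 + ssum_norm m y) powr (- (real m * real DIM('a) + \<delta> + \<gamma>))))"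

definition LP_G :: "nat \<Rightarrow> ((nat \<Rightarrow> 'a::euclidean_space) \<Rightarrow> real) \<Rightarrow> (nat \<Rightarrow> 'a \<Rightarrow> real)
                    \<Rightarrow> real \<Rightarrow> 'a \<Rightarrow> real" where
  "LP_G m K f t x =
     (LINT y|PiM {..<m} (\<lambda>_. lborel).
        t powr (- (real m * real DIM('a))) * K (\<lambda>j\<in>{..<m}. (1 / t) *\<^sub>R (x - y j)) *
        (\<Prod>j<m. f j (y j)))"

definition lusin_sq :: "nat \<Rightarrow> ((nat \<Rightarrow> 'a::euclidean_space) \<Rightarrow> real) \<Rightarrow> (nat \<Rightarrow> 'a \<Rightarrow> real)
                    \<Rightarrow> 'a \<Rightarrow> ennreal" where
  "lusin_sq m K f x =
     (\<integral>\<^sup>+ p. indicator {(z, t). 0 < t \<and> dist z x < t} p *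
              ennreal ((LP_G m K f (snd p) (fst p))\<^sup>2 / snd p ^ (DIM('a) + 1))
        \<partial>(lborel \<Otimes>\<^sub>M lborel))"

definition lusin :: "nat \<Rightarrow> ((nat \<Rightarrow> 'a::euclidean_space) \<Rightarrow> real) \<Rightarrow> (nat \<Rightarrow> 'a \<Rightarrow> real)
                    \<Rightarrow> 'a \<Rightarrow> ennreal" where
  "lusin m K f x =
     (if lusin_sq m K f x = \<infinity> then \<infinity> else ennreal (sqrt (enn2real (lusin_sq m K f x))))"

definition enn_powr :: "ennreal \<Rightarrow> real \<Rightarrow> ennreal" where
  "enn_powr u q = (if u = \<infinity> then \<infinity> else ennreal (enn2real u powr q))"

definition lusin_bounded :: "nat \<Rightarrow> ((nat \<Rightarrow> 'a::euclidean_space) \<Rightarrow> real) \<Rightarrow> bool" where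
  "lusin_bounded m K \<longleftrightarrow>
     (\<exists>qs q A. (\<forall>i<m. 1 \<le> qs i) \<and> 0 < q \<and> 1 / q = (\<Sum>i<m. 1 / qs i) \<and> 0 \<le> A \<and>
        (\<forall>f. (\<forall>i<m. f i \<in> borel_measurable lborel \<and>
                     integrable lborel (\<lambda>x. \<bar>f i x\<bar> powr qs i)) \<longrightarrow>
             (\<integral>\<^sup>+ x. enn_powr (lusin m K f x) q \<partial>lborel)
               \<le> ennreal ((A * (\<Prod>i<m. (LINT x|lborel. \<bar>f i x\<bar> powr qs i) powr (1 / qs i))) powr q)))"

definition loc_int :: "('a::euclidean_space \<Rightarrow> real) \<Rightarrow> bool" where
  "loc_int f \<longleftrightarrow> f \<in> borel_measurable lborel \<and> (\<forall>x r. set_integrable lborel (ball x r) f)"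

definition avg_ball :: "('a::euclidean_space \<Rightarrow> real) \<Rightarrow> 'a \<Rightarrow> real \<Rightarrow> real" where
  "avg_ball f x r = (LINT y:ball x r|lborel. f y) / measure lborel (ball x r)"

definition bmo_osc :: "('a::euclidean_space \<Rightarrow> real) \<Rightarrow> 'a \<Rightarrow> real \<Rightarrow> real" where
  "bmo_osc f x r = avg_ball (\<lambda>y. \<bar>f y - avg_ball f x r\<bar>) x r"

definition BMO :: "('a::euclidean_space \<Rightarrow> real) \<Rightarrow> bool" where
  "BMO f \<longleftrightarrow> loc_int f \<and> bdd_above {bmo_osc f x r | x r. 0 < r}"

definition bmo_norm :: "('a::euclidean_space \<Rightarrow> real) \<Rightarrow> real" where
  "bmo_norm f = Sup {bmo_osc f x r | x r. 0 < r}"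

definition ess_inf_ball :: "('a::euclidean_space \<Rightarrow> real) \<Rightarrow> 'a \<Rightarrow> real \<Rightarrow> ereal" where
  "ess_inf_ball F x r = Sup {ereal c | c. AE y in lborel. y \<in> ball x r \<longrightarrow> c \<le> F y}"

definition blo_osc :: "('a::euclidean_space \<Rightarrow> real) \<Rightarrow> 'a \<Rightarrow> real \<Rightarrow> real" where
  "blo_osc F x r = avg_ball (\<lambda>y. F y - real_of_ereal (ess_inf_ball F x r)) x r"

definition BLO :: "('a::euclidean_space \<Rightarrow> real) \<Rightarrow> bool" where
  "BLO F \<longleftrightarrow> loc_int F \<and>
     (\<exists>C. \<forall>x r. 0 < r \<longrightarrow> ess_inf_ball F x r \<noteq> - \<infinity> \<and> blo_osc F x r \<le> C)"

definition blo_norm :: "('a::euclidean_space \<Rightarrow> real) \<Rightarrow> real" where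
  "blo_norm F = Sup {blo_osc F x r | x r. 0 < r}"

end

theory Submission
  imports Defs
begin

text \<open>The vanishing of the kernel integral in each slot lets every \<open>f\<^sub>j\<close> be replaced by
  \<open>f\<^sub>j\<close> minus its mean over \<open>B(z, t)\<close>; the kernel is dominated by a product of integrable weights,
  so \<open>G\<^sub>t f(z)\<close> is bounded by the product of the BMO norms, uniformly in \<open>(z, t)\<close>.  For two points of a
  ball of radius \<open>r\<close> the parts of the cones above height \<open>r\<close> differ by little, so these parts of the
  area integrals differ by a bounded amount, which is the BLO cancellation.  The parts below height \<open>r\<close>
  are controlled by the Carleson measure estimate for \<open>\<bar>G\<^sub>t f(z)\<bar>\<^sup>2 dz dt / t\<close>.

  For this estimate all slots but the first are frozen with their means over \<open>B(z, t)\<close> subtracted, which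
  leaves a linear square function whose kernel has size and regularity bounds and mean zero in \<open>y\<close>.  If
  \<open>T\<close> denotes that linear map, \<open>T T\<^sup>*\<close> passes Schur's test because the pairing of the kernels
  at the scales \<open>s\<close> and \<open>t\<close> decays like a power of \<open>min (s / t) (t / s)\<close>; \<open>T\<^sup>*\<close> is then tested against
  BMO by a dyadic John--Nirenberg inequality in \<open>L\<^sup>2\<close>.\<close>

subsection \<open>Integrable weights\<close>

text \<open>There the size bound is read as a Hoelder bound with a factor singular at
  \<open>z\<close>; the Schur test sees only integrals, and the singularity is integrable because
  its order \<open>e\<close> is below 1, hence below the dimension.

  Membership in BMO gives only integrable oscillation, and square integrability of \<open>f\<close>
  is never established. The test function produced by the adjoint is Hoelder continuous, so only the
  means of \<open>f\<close> over small dyadic cubes matter, and their variance is bounded by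
  induction on the generation.

  The Carleson integral occurs on both sides of its own estimate and is absorbed, which requires it
  to be finite beforehand. Scales below some \<eta> are therefore cut off; \<eta> enters the
  qualitative bounds but not the final constant.\<close>

definition wt :: "real \<Rightarrow> real \<Rightarrow> 'a::euclidean_space \<Rightarrow> real" where
  "wt a t v = (1 + norm v / t) powr (- (real DIM('a) + a)) / t ^ DIM('a)"

text \<open>The factor of order \<open>- e\<close> at the origin pays for a Hoelder estimate where
  only size is known: if \<open>v\<close> has norm at most a multiple of the displacement
  \<open>h\<close>, then \<open>h powr e\<close> times this factor is bounded below.\<close>

definition sing_wt :: "real \<Rightarrow> real \<Rightarrow> real \<Rightarrow> 'a::euclidean_space \<Rightarrow> real" where
  "sing_wt e a t v = (1 + (norm v / t) powr (- e)) * wt a t v"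

text \<open>The numerator is the loss in comparing the weight with dyadic balls; the rest is the sum
  of \<open>(k + 1) * 2 powr (- a * k)\<close>. The factor \<open>k + 1\<close> leaves room for the
  means of a BMO function, which drift linearly over \<open>k\<close> doublings of a ball.\<close>

definition wt_const :: "nat \<Rightarrow> real \<Rightarrow> real" where
  "wt_const n a = 2 powr (real n + a) / (1 - 2 powr (- a))\<^sup>2"

lemma wt_nonneg [simp]: "0 < t \<Longrightarrow> 0 \<le> wt a t v"
  by (simp add: wt_def)

lemma sing_wt_nonneg [simp]: "0 < t \<Longrightarrow> 0 \<le> sing_wt e a t v"
  by (simp add: sing_wt_def)

lemma wt_commute: "wt a t (x - y) = wt a t (y - x)"
  by (simp add: wt_def norm_minus_commute)

lemma sing_wt_commute: "sing_wt e a t (x - y) = sing_wt e a t (y - x)"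
  by (simp add: sing_wt_def wt_def norm_minus_commute)

lemma wt_le: "0 < t \<Longrightarrow> 0 \<le> a \<Longrightarrow> wt a t (v::'a::euclidean_space) \<le> 1 / t ^ DIM('a)"
proof -
  assume t: "0 < t" "0 \<le> a"
  have "(1 + norm v / t) powr (- (real DIM('a) + a)) \<le> (1 + norm v / t) powr 0"
    using t by (intro powr_mono) auto
  also have "\<dots> = 1"
  proof -
    have "1 + norm v / t > 0" using t by (intro add_pos_nonneg) auto
    then show ?thesis by simp
  qed
  finally show ?thesis using t by (simp add: wt_def divide_right_mono)
qed

lemma wt_measurable [measurable]:
  assumes [measurable]: "f \<in> borel_measurable M" "g \<in> borel_measurable M"
  shows "(\<lambda>x. wt a (f x) (g x :: 'a::euclidean_space)) \<in> borel_measurable M"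
  unfolding wt_def by measurable

lemma sing_wt_measurable [measurable]:
  assumes [measurable]: "f \<in> borel_measurable M" "g \<in> borel_measurable M"
  shows "(\<lambda>x. sing_wt e a (f x) (g x :: 'a::euclidean_space)) \<in> borel_measurable M"
  unfolding sing_wt_def by measurable

lemma wt_const_pos: "0 < a \<Longrightarrow> 0 < wt_const n a"
proof -
  assume "0 < a"
  then have "2 powr (-a) < (2::real) powr 0" by (intro powr_less_mono) auto
  then have "1 - 2 powr (- a) > (0::real)" by (simp only: powr_zero_eq_one) simp
  then show "0 < wt_const n a"
    unfolding wt_const_def by (intro divide_pos_pos) auto
qed

lemma indicator_ball_shift: "indicator (ball 0 r) (z - y) = indicator (ball z r) (y::'a::real_normed_vector)"
  by (simp add: indicator_def dist_norm[of z y])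

lemma ball_measurable [measurable]: "ball z r \<in> sets (borel :: 'a::euclidean_space measure)"
  by simp

lemma ennreal_term_le_suminf: "f k \<le> (\<Sum>k. f k)" for f :: "nat \<Rightarrow> ennreal"
  using sum_le_suminf[of f "{k}"] by simp

text \<open>A single term suffices: for the least \<open>k\<close> with
  \<open>norm v < 2 ^ k * t\<close> the previous ball misses \<open>v\<close>, so
  \<open>1 + norm v / t\<close> is at least \<open>2 ^ k / 2\<close>. The full series stands on the
  right because it can be integrated term by term.\<close>

lemma wt_layers:
  fixes v :: "'a::euclidean_space"
  assumes t: "0 < t" and a: "0 < a"
  shows "ennreal (wt a t v) \<le>
    (\<Sum>k. ennreal (2 powr (real DIM('a) + a) * (2 powr (- a)) ^ k / (2 ^ k * t) ^ DIM('a))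
          * indicator (ball 0 (2 ^ k * t)) v)"
proof -
  define p where "p = real DIM('a) + a"
  have p: "p > 0" using a by (simp add: p_def add_nonneg_pos)
  define P where "P k \<longleftrightarrow> norm v < 2 ^ k * t" for k :: nat
  have "\<exists>k. P k"
  proof -
    obtain k :: nat where "norm v / t < 2 ^ k" using real_arch_pow[of 2 "norm v / t"] by auto
    then show ?thesis using t by (auto simp: P_def field_simps)
  qed
  then have Pk: "P (LEAST k. P k)" by (rule LeastI_ex)
  define k where "k = (LEAST k. P k)"
  have low: "2 ^ k / 2 \<le> 1 + norm v / t"
  proof (cases k)
    case 0 then show ?thesis using t by simp
  next
    case (Suc j)
    then have "\<not> P j" unfolding k_def using not_less_Least[of j P] by simp
    then have "2 ^ j \<le> norm v / t" using t by (simp add: P_def field_simps)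
    then show ?thesis by (simp add: Suc)
  qed
  have "(1 + norm v / t) powr (-p) \<le> (2 ^ k / 2) powr (-p)"
    using low p by (intro powr_mono2') auto
  also have "\<dots> = 2 powr p * ((2::real) ^ k) powr (-p)"
    by (simp add: powr_divide powr_minus field_simps)
  also have "((2::real) ^ k) powr (-p) = (2 powr (- a)) ^ k / (2 ^ k) ^ DIM('a)"
  proof -
    have "((2::real) ^ k) powr (-p) = 2 powr (- (real k * p))"
      by (simp add: powr_realpow[symmetric] powr_powr)
    also have "\<dots> = 2 powr (- a * real k) * 2 powr (- (real k * real DIM('a)))"
      by (simp add: p_def algebra_simps flip: powr_add)
    also have "2 powr (- a * real k) = ((2::real) powr (- a)) ^ k"
      by (simp add: powr_powr powr_realpow[symmetric])
    also have "2 powr (- (real k * real DIM('a))) = 1 / ((2::real) ^ k) ^ DIM('a)"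
      by (simp add: powr_minus powr_realpow[symmetric] powr_powr divide_inverse)
    finally show ?thesis by simp
  qed
  finally have le: "wt a t v \<le> 2 powr p * (2 powr (- a)) ^ k / (2 ^ k * t) ^ DIM('a)"
    using t unfolding wt_def p_def by (simp add: divide_simps power_mult_distrib)
  have "ennreal (wt a t v) \<le> ennreal (2 powr p * (2 powr (- a)) ^ k / (2 ^ k * t) ^ DIM('a))
          * indicator (ball 0 (2 ^ k * t)) v"
    using Pk[folded k_def] le by (simp add: P_def ennreal_leI)
  also have "\<dots> \<le> (\<Sum>k. ennreal (2 powr p * (2 powr (- a)) ^ k / (2 ^ k * t) ^ DIM('a))
          * indicator (ball 0 (2 ^ k * t)) v)"
    by (rule ennreal_term_le_suminf)
  finally show ?thesis by (simp add: p_def)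
qed

text \<open>Integrating the layers one by one reduces a weighted integral to plain integrals over
  dyadic balls. The permitted growth \<open>Suc k\<close> covers the oscillation of BMO functions as
  well as \<open>g = 1\<close>.\<close>

lemma wt_nn_integral_le:
  fixes z :: "'a::euclidean_space" and g :: "'a \<Rightarrow> ennreal"
  assumes t: "0 < t" and a: "0 < a" and B: "0 \<le> B" and [measurable]: "g \<in> borel_measurable borel"
    and g: "\<And>k. (\<integral>\<^sup>+y. g y * indicator (ball z (2 ^ k * t)) y \<partial>lborel)
                  \<le> ennreal (B * real (Suc k) * (2 ^ k * t) ^ DIM('a))"
  shows "(\<integral>\<^sup>+y. ennreal (wt a t (z - y)) * g y \<partial>lborel) \<le> ennreal (wt_const DIM('a) a * B)"
proof -
  define c where "c k = 2 powr (real DIM('a) + a) * (2 powr (- a)) ^ k / (2 ^ k * t) ^ DIM('a)" for k :: nat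
  have c: "0 \<le> c k" for k using t by (simp add: c_def)
  have "(\<integral>\<^sup>+y. ennreal (wt a t (z - y)) * g y \<partial>lborel)
     \<le> (\<integral>\<^sup>+y. (\<Sum>k. ennreal (c k) * (g y * indicator (ball z (2 ^ k * t)) y)) \<partial>lborel)"
  proof (rule nn_integral_mono)
    fix y
    have "ennreal (wt a t (z - y)) * g y \<le> (\<Sum>k. ennreal (c k) * indicator (ball 0 (2 ^ k * t)) (z - y)) * g y"
      unfolding c_def by (intro mult_right_mono wt_layers t a) auto
    also have "\<dots> = (\<Sum>k. ennreal (c k) * (g y * indicator (ball z (2 ^ k * t)) y))"
      by (subst ennreal_suminf_multc[symmetric], rule arg_cong[where f=suminf])
        (auto simp: fun_eq_iff indicator_ball_shift mult_ac)
    finally show "ennreal (wt a t (z - y)) * g y \<le> \<dots>" .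
  qed
  also have "\<dots> = (\<Sum>k. ennreal (c k) * (\<integral>\<^sup>+y. g y * indicator (ball z (2 ^ k * t)) y \<partial>lborel))"
    by (subst nn_integral_suminf) (measurable, simp add: nn_integral_cmult)
  also have "\<dots> \<le> (\<Sum>k. ennreal (2 powr (real DIM('a) + a) * B * (real (Suc k) * (2 powr (- a)) ^ k)))"
  proof (intro suminf_le summableI)
    fix k
    have "ennreal (c k) * (\<integral>\<^sup>+y. g y * indicator (ball z (2 ^ k * t)) y \<partial>lborel)
      \<le> ennreal (c k) * ennreal (B * real (Suc k) * (2 ^ k * t) ^ DIM('a))"
      by (intro mult_left_mono g) auto
    also have "\<dots> = ennreal (c k * (B * real (Suc k) * (2 ^ k * t) ^ DIM('a)))"
      using c B t by (subst ennreal_mult) auto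
    also have "c k * (B * real (Suc k) * (2 ^ k * t) ^ DIM('a))
       = 2 powr (real DIM('a) + a) * B * (real (Suc k) * (2 powr (- a)) ^ k)"
      using t by (simp add: c_def)
    finally show "ennreal (c k) * (\<integral>\<^sup>+y. g y * indicator (ball z (2 ^ k * t)) y \<partial>lborel) \<le> \<dots>" .
  qed
  also have "\<dots> = ennreal (wt_const DIM('a) a * B)"
  proof -
    have "2 powr (-a) < (2::real) powr 0" using a by (intro powr_less_mono) auto
    then have "(\<lambda>k. real (Suc k) * (2 powr (- a)) ^ k) sums (1 / (1 - 2 powr (- a))\<^sup>2)"
      by (intro geometric_deriv_sums) auto
    then have "(\<lambda>k. 2 powr (real DIM('a) + a) * B * (real (Suc k) * (2 powr (- a)) ^ k)) sums
       (2 powr (real DIM('a) + a) * B * (1 / (1 - 2 powr (- a))\<^sup>2))"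
      by (rule sums_mult)
    then show ?thesis
      using B by (intro suminf_ennreal_eq) (auto simp: wt_const_def mult_ac)
  qed
  finally show ?thesis .
qed

abbreviation "ubv \<equiv> \<lambda>n::nat. unit_ball_vol (real n)"

lemma nn_integral_wt_le:
  fixes z :: "'a::euclidean_space"
  assumes t: "0 < t" and a: "0 < a"
  shows "(\<integral>\<^sup>+y. ennreal (wt a t (z - y)) \<partial>lborel) \<le> ennreal (wt_const DIM('a) a * ubv DIM('a))"
proof -
  have "(\<integral>\<^sup>+y. ennreal (wt a t (z - y)) * 1 \<partial>lborel) \<le> ennreal (wt_const DIM('a) a * ubv DIM('a))"
  proof (rule wt_nn_integral_le[OF t a])
    fix k :: nat
    have "(\<integral>\<^sup>+y. 1 * indicator (ball z (2 ^ k * t)) y \<partial>lborel) = ennreal (ubv DIM('a) * (2 ^ k * t) ^ DIM('a))"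
      using t by (simp add: emeasure_ball)
    also have "\<dots> \<le> ennreal (ubv DIM('a) * real (Suc k) * (2 ^ k * t) ^ DIM('a))"
      using t by (intro ennreal_leI mult_right_mono) auto
    finally show "(\<integral>\<^sup>+y. 1 * indicator (ball z (2 ^ k * t)) y \<partial>lborel) \<le> \<dots>" .
  qed auto
  then show ?thesis by simp
qed

text \<open>Here the dyadic balls shrink to the origin. The summand 1 covers
  \<open>norm v \<ge> t\<close>, and also \<open>v = 0\<close>, where \<open>0 powr _ = 0\<close>.
  Otherwise the least \<open>k\<close> with \<open>t / 2 ^ k \<le> norm v\<close> is positive, and
  the ball just before it contains \<open>v\<close>.\<close>

lemma norm_powr_layers:
  fixes v :: "'a::euclidean_space"
  assumes t: "0 < t" and e: "0 < e"
  shows "ennreal ((norm v / t) powr (- e)) \<le> 1 +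
    (\<Sum>k. ennreal (2 powr e * (2 powr e) ^ k) * indicator (ball 0 (t / 2 ^ k)) v)"
proof (cases "v = 0 \<or> norm v \<ge> t")
  case True
  then have "(norm v / t) powr (- e) \<le> 1"
  proof
    assume "norm v \<ge> t"
    then have "(norm v / t) powr (- e) \<le> 1 powr (-e)" using t e by (intro powr_mono2') auto
    then show ?thesis by simp
  qed simp
  then have "ennreal ((norm v / t) powr (- e)) \<le> 1" by (simp add: ennreal_le_1)
  then show ?thesis by (rule order_trans) simp
next
  case False
  then have v: "v \<noteq> 0" "norm v < t" by auto
  define P where "P k \<longleftrightarrow> t / 2 ^ k \<le> norm v" for k :: nat
  have "\<exists>k. P k"
  proof -
    obtain k :: nat where "t / norm v < 2 ^ k" using real_arch_pow[of 2 "t / norm v"] by auto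
    then show ?thesis using t v by (auto simp: P_def field_simps intro!: exI[of _ k])
  qed
  then have Pk: "P (LEAST k. P k)" by (rule LeastI_ex)
  then obtain j where j: "(LEAST k. P k) = Suc j" using v by (cases "LEAST k. P k") (auto simp: P_def)
  then have nj: "\<not> P j" using not_less_Least[of j P] by simp
  have "P (Suc j)" using Pk by (simp only: j)
  then have "1 / (2 * 2 ^ j) \<le> norm v / t" using t by (simp add: P_def field_simps)
  then have "(norm v / t) powr (-e) \<le> (1 / (2 * 2 ^ j)) powr (-e)"
    using e by (intro powr_mono2') auto
  also have "\<dots> = 2 powr e * (2 powr e) ^ j"
    by (simp add: powr_minus powr_divide powr_mult powr_realpow[symmetric] powr_powr mult.commute)
  finally have "ennreal ((norm v / t) powr (- e)) \<le> ennreal (2 powr e * (2 powr e) ^ j) * indicator (ball 0 (t / 2 ^ j)) v"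
    using nj by (simp add: P_def ennreal_leI)
  also have "\<dots> \<le> (\<Sum>k. ennreal (2 powr e * (2 powr e) ^ k) * indicator (ball 0 (t / 2 ^ k)) v)"
    by (rule ennreal_term_le_suminf)
  also have "\<dots> \<le> 1 + \<dots>" by simp
  finally show ?thesis .
qed

text \<open>Passing from one small ball to the next multiplies the singular factor by
  \<open>2 powr e\<close> and the volume by \<open>1 / 2 ^ DIM('a)\<close>. The resulting geometric
  series has ratio at most \<open>2 powr (e - 1)\<close>, and converges since
  \<open>e < 1\<close>.\<close>

lemma nn_integral_sing_wt_le:
  assumes a: "0 < a" and e: "0 < e" "e < 1"
  shows "\<exists>C>0. \<forall>t>0. \<forall>z::'a::euclidean_space. (\<integral>\<^sup>+y. ennreal (sing_wt e a t (z - y)) \<partial>lborel) \<le> ennreal C"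
proof -
  define W where "W = wt_const DIM('a) a * ubv DIM('a)"
  have W: "W > 0" using wt_const_pos[OF a] by (simp add: W_def)
  define q where "q = (2::real) powr (e - 1)"
  have q: "0 < q" "q < 1"
  proof -
    have "2 powr (e - 1) < (2::real) powr 0" using e by (intro powr_less_mono) auto
    then show "q < 1" by (simp add: q_def)
  qed (simp add: q_def)
  define D where "D = 2 powr e * ubv DIM('a) * (1 / (1 - q))"
  have D: "D > 0" using q by (simp add: D_def)
  have main: "(\<integral>\<^sup>+y. ennreal (sing_wt e a t (z - y)) \<partial>lborel) \<le> ennreal (2 * W + D)" if t: "t > 0" for t and z :: 'a
  proof -
    let ?S = "\<lambda>y. \<Sum>k. ennreal (2 powr e * (2 powr e) ^ k / t ^ DIM('a)) * indicator (ball z (t / 2 ^ k)) y"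
    have "(\<integral>\<^sup>+y. ennreal (sing_wt e a t (z - y)) \<partial>lborel) \<le>
       (\<integral>\<^sup>+y. 2 * ennreal (wt a t (z - y)) + ?S y \<partial>lborel)"
    proof (rule nn_integral_mono)
      fix y
      define w where "w = wt a t (z - y)"
      have w: "0 \<le> w" "w \<le> 1 / t ^ DIM('a)" using t a by (auto simp: w_def wt_le)
      have "ennreal (sing_wt e a t (z - y)) = ennreal w + ennreal ((norm (z - y) / t) powr (- e)) * ennreal w"
        using w by (simp add: sing_wt_def w_def[symmetric] algebra_simps ennreal_mult)
      also have "\<dots> \<le> ennreal w + (1 + (\<Sum>k. ennreal (2 powr e * (2 powr e) ^ k) * indicator (ball 0 (t / 2 ^ k)) (z - y))) * ennreal w"
        by (intro add_left_mono mult_right_mono norm_powr_layers t e) auto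
      also have "\<dots> = 2 * ennreal w + (\<Sum>k. ennreal (2 powr e * (2 powr e) ^ k) * indicator (ball 0 (t / 2 ^ k)) (z - y)) * ennreal w"
        by (simp add: distrib_right add.assoc[symmetric] mult_2)
      \<comment> \<open>On the small balls the weight is replaced by its upper bound
        \<open>1 / t ^ DIM('a)\<close>.\<close>
      also have "\<dots> \<le> 2 * ennreal w + (\<Sum>k. ennreal (2 powr e * (2 powr e) ^ k) * indicator (ball 0 (t / 2 ^ k)) (z - y)) * ennreal (1 / t ^ DIM('a))"
        using w by (intro add_left_mono mult_left_mono ennreal_leI) auto
      also have "\<dots> = 2 * ennreal w + ?S y"
      proof -
        have "ennreal (2 powr e * (2 powr e) ^ k) * indicator (ball 0 (t / 2 ^ k)) (z - y) * ennreal (1 / t ^ DIM('a))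
          = ennreal (2 powr e * (2 powr e) ^ k / t ^ DIM('a)) * indicator (ball z (t / 2 ^ k)) y" for k
          unfolding indicator_ball_shift using t
          by (simp add: ennreal_mult[symmetric] mult.assoc mult.commute[of "indicator _ _"] flip: ennreal_mult' split: split_indicator)
        then show ?thesis by (subst ennreal_suminf_multc[symmetric]) simp
      qed
      finally show "ennreal (sing_wt e a t (z - y)) \<le> 2 * ennreal (wt a t (z - y)) + ?S y" by (simp add: w_def)
    qed
    also have "\<dots> = 2 * (\<integral>\<^sup>+y. ennreal (wt a t (z - y)) \<partial>lborel) + (\<integral>\<^sup>+y. ?S y \<partial>lborel)"
      by (simp add: nn_integral_add nn_integral_cmult)
    also have "\<dots> \<le> 2 * ennreal W + (\<integral>\<^sup>+y. ?S y \<partial>lborel)"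
      unfolding W_def by (intro add_right_mono mult_left_mono nn_integral_wt_le t a) auto
    also have "(\<integral>\<^sup>+y. ?S y \<partial>lborel) = (\<Sum>k. ennreal (2 powr e * (2 powr e) ^ k / t ^ DIM('a)) * emeasure lborel (ball z (t / 2 ^ k)))"
      by (subst nn_integral_suminf) (auto simp: nn_integral_cmult)
    also have "\<dots> \<le> (\<Sum>k. ennreal (2 powr e * ubv DIM('a) * q ^ k))"
    proof (intro suminf_le summableI)
      fix k
      have "ennreal (2 powr e * (2 powr e) ^ k / t ^ DIM('a)) * emeasure lborel (ball z (t / 2 ^ k))
        = ennreal (2 powr e * (2 powr e) ^ k / t ^ DIM('a) * (ubv DIM('a) * (t / 2 ^ k) ^ DIM('a)))"
        using t by (subst emeasure_ball) (auto simp: ennreal_mult[symmetric])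
      also have "2 powr e * (2 powr e) ^ k / t ^ DIM('a) * (ubv DIM('a) * (t / 2 ^ k) ^ DIM('a))
          = 2 powr e * ubv DIM('a) * (2 powr e / 2 ^ DIM('a)) ^ k"
        using t by (simp add: power_divide power_mult[symmetric] mult.commute)
      also have "\<dots> \<le> 2 powr e * ubv DIM('a) * q ^ k"
      proof -
        have "(2::real) ^ 1 \<le> 2 ^ DIM('a)" using DIM_positive[where 'a='a] by (intro power_increasing) auto
        then have "2 powr e / 2 ^ DIM('a) \<le> 2 powr e / 2" by (intro divide_left_mono) auto
        then have "2 powr e / 2 ^ DIM('a) \<le> q" by (simp add: q_def powr_diff)
        then show ?thesis by (intro mult_left_mono power_mono) auto
      qed
      finally show "ennreal (2 powr e * (2 powr e) ^ k / t ^ DIM('a)) * emeasure lborel (ball z (t / 2 ^ k))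
         \<le> ennreal (2 powr e * ubv DIM('a) * q ^ k)" by (simp add: ennreal_leI)
    qed
    also have "\<dots> = ennreal D"
      unfolding D_def using q by (intro suminf_ennreal_eq sums_mult geometric_sums) auto
    also have "2 * ennreal W + ennreal D = ennreal (2 * W + D)"
      using W D by (simp add: ennreal_mult)
    finally show ?thesis by (simp add: add_left_mono)
  qed
  show ?thesis
    using main W D by (intro exI[of _ "2 * W + D"]) auto
qed

subsection \<open>Weighted integrals of BMO functions\<close>

text \<open>An upper bound in place of the supremum \<open>bmo_norm\<close>: a strictly positive
  \<open>b\<close> can be chosen even when the seminorm vanishes.\<close>

definition bmo_le :: "('a::euclidean_space \<Rightarrow> real) \<Rightarrow> real \<Rightarrow> bool" where
  "bmo_le f b \<longleftrightarrow> loc_int f \<and> (\<forall>x r. 0 < r \<longrightarrow> bmo_osc f x r \<le> b)"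

lemma BMO_imp_bmo_le:
  assumes "BMO f" "bmo_norm f \<le> b"
  shows "bmo_le f b"
  unfolding bmo_le_def
proof (intro conjI allI impI)
  fix x r assume "0 < (r::real)"
  then have "bmo_osc f x r \<le> bmo_norm f"
    unfolding bmo_norm_def using assms(1) by (intro cSup_upper) (auto simp: BMO_def)
  then show "bmo_osc f x r \<le> b" using assms(2) by simp
qed (use assms in \<open>simp add: BMO_def\<close>)

lemma loc_int_measurable: "loc_int f \<Longrightarrow> f \<in> borel_measurable borel"
  by (simp add: loc_int_def)

lemma set_integrable_ball_const: "set_integrable lborel (ball x r :: 'a::euclidean_space set) (\<lambda>_. c::real)"
  unfolding set_integrable_def
  using emeasure_lborel_ball_finite[of x r] by (intro integrable_scaleR_left) simp

lemma loc_int_diff_const: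
  assumes "loc_int f" shows "set_integrable lborel (ball x r) (\<lambda>y. f y - c)"
  using assms set_integrable_ball_const unfolding loc_int_def by (intro set_integral_diff) auto

lemma loc_int_diff_const_subset:
  assumes "loc_int f" "S \<subseteq> ball x r" "S \<in> sets borel"
  shows "set_integrable lborel S (\<lambda>y. f y - c)"
  using set_integrable_subset[OF loc_int_diff_const[OF assms(1)], of S x r c] assms by simp

lemma unit_ball_vol_nonzero [simp]: "unit_ball_vol (real n) \<noteq> 0"
  using unit_ball_vol_pos[of "real n"] by linarith

lemma measure_lborel_ball: "0 \<le> r \<Longrightarrow> measure lborel (ball (x::'a::euclidean_space) r) = ubv DIM('a) * r ^ DIM('a)"
  by (rule content_ball)

lemma set_integral_ball_const: "0 \<le> r \<Longrightarrow> (LINT y:ball x r|lborel. (c::real)) = c * (ubv DIM('a) * r ^ DIM('a))"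
  for x :: "'a::euclidean_space"
  unfolding set_lebesgue_integral_def
  using emeasure_lborel_ball_finite[of x r] by (simp add: measure_lborel_ball)

lemma bmo_le_nonneg:
  assumes "bmo_le f b" shows "0 \<le> b"
proof -
  have "0 \<le> bmo_osc f 0 1"
    unfolding bmo_osc_def avg_ball_def[of "\<lambda>y. \<bar>_ y\<bar>"]
    by (auto intro!: divide_nonneg_nonneg integral_nonneg_AE simp: avg_ball_def set_lebesgue_integral_def)
  also have "\<dots> \<le> b" using assms by (simp add: bmo_le_def)
  finally show ?thesis .
qed

lemma bmo_le_osc:
  fixes x :: "'a::euclidean_space"
  assumes "bmo_le f b" "0 < r"
  shows "(LINT y:ball x r|lborel. \<bar>f y - avg_ball f x r\<bar>) \<le> b * (ubv DIM('a) * r ^ DIM('a))"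
proof -
  have "bmo_osc f x r \<le> b" using assms by (simp add: bmo_le_def)
  moreover have "0 < measure lborel (ball x r)" using assms by (simp add: measure_lborel_ball)
  ultimately show ?thesis
    using assms(2) unfolding bmo_osc_def avg_ball_def[of "\<lambda>y. \<bar>_ y\<bar>"]
    by (simp add: pos_divide_le_eq measure_lborel_ball)
qed

lemma avg_ball_diff_le:
  fixes x :: "'a::euclidean_space"
  assumes "loc_int f" "0 < r"
  shows "\<bar>avg_ball f x r - c\<bar> * (ubv DIM('a) * r ^ DIM('a)) \<le> (LINT y:ball x r|lborel. \<bar>f y - c\<bar>)"
proof -
  have m: "0 < ubv DIM('a) * r ^ DIM('a)" using assms by simp
  have "(avg_ball f x r - c) * (ubv DIM('a) * r ^ DIM('a)) = (LINT y:ball x r|lborel. f y - c)"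
    using assms m set_integrable_ball_const
    by (subst set_integral_diff) (auto simp: loc_int_def avg_ball_def measure_lborel_ball set_integral_ball_const left_diff_distrib)
  then have "\<bar>avg_ball f x r - c\<bar> * (ubv DIM('a) * r ^ DIM('a)) = \<bar>LINT y:ball x r|lborel. f y - c\<bar>"
    using m by (metis abs_mult abs_of_pos)
  also have "\<dots> \<le> (LINT y:ball x r|lborel. \<bar>f y - c\<bar>)"
    using set_integral_norm_bound[OF loc_int_diff_const[OF assms(1)], of x r c] by simp
  finally show ?thesis .
qed

lemma set_integral_abs_mono_set:
  fixes g :: "'a::euclidean_space \<Rightarrow> real"
  assumes "set_integrable lborel B g" "S \<subseteq> B" "S \<in> sets borel"
  shows "(LINT y:S|lborel. \<bar>g y\<bar>) \<le> (LINT y:B|lborel. \<bar>g y\<bar>)"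
proof -
  have B: "set_integrable lborel B (\<lambda>y. \<bar>g y\<bar>)" using assms by (rule_tac set_integrable_abs)
  have S: "set_integrable lborel S (\<lambda>y. \<bar>g y\<bar>)" using set_integrable_subset[OF B] assms by simp
  show ?thesis
    using assms B S unfolding set_lebesgue_integral_def set_integrable_def
    by (intro integral_mono) (auto simp: indicator_def)
qed

lemma bmo_le_osc_subset:
  fixes x :: "'a::euclidean_space"
  assumes "bmo_le f b" "0 < r" "S \<subseteq> ball x r" "S \<in> sets borel"
  shows "(LINT y:S|lborel. \<bar>f y - avg_ball f x r\<bar>) \<le> b * (ubv DIM('a) * r ^ DIM('a))"
  using set_integral_abs_mono_set[OF loc_int_diff_const assms(3,4), of f "avg_ball f x r"] bmo_le_osc[OF assms(1,2), of x] assms(1)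
  by (simp add: bmo_le_def)

text \<open>With \<open>c\<close> the mean over the large ball, the integral of
  \<open>|f - c|\<close> over the small ball is at most the one over the large ball; dividing by the
  volume of the small ball costs the ratio of the volumes.\<close>

lemma avg_ball_nested:
  fixes x z :: "'a::euclidean_space"
  assumes "bmo_le f b" "0 < r" "0 < R" "ball z r \<subseteq> ball x R"
  shows "\<bar>avg_ball f z r - avg_ball f x R\<bar> \<le> b * (R / r) ^ DIM('a)"
proof -
  have "\<bar>avg_ball f z r - avg_ball f x R\<bar> * (ubv DIM('a) * r ^ DIM('a)) \<le> b * (ubv DIM('a) * R ^ DIM('a))"
    using assms by (intro order_trans[OF avg_ball_diff_le bmo_le_osc_subset]) (auto simp: bmo_le_def)
  then have "ubv DIM('a) * (\<bar>avg_ball f z r - avg_ball f x R\<bar> * r ^ DIM('a)) \<le> ubv DIM('a) * (b * R ^ DIM('a))"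
    by (simp add: mult_ac)
  then have "\<bar>avg_ball f z r - avg_ball f x R\<bar> * r ^ DIM('a) \<le> b * R ^ DIM('a)"
    by (subst (asm) mult_le_cancel_left_pos) auto
  then show ?thesis using assms by (simp add: power_divide pos_le_divide_eq)
qed

lemma nn_set_integral_abs:
  fixes g :: "'a::euclidean_space \<Rightarrow> real"
  assumes "set_integrable lborel S g"
  shows "(\<integral>\<^sup>+y. ennreal \<bar>g y\<bar> * indicator S y \<partial>lborel) = ennreal (LINT y:S|lborel. \<bar>g y\<bar>)"
proof -
  have "integrable lborel (\<lambda>y. indicator S y *\<^sub>R \<bar>g y\<bar>)"
    using set_integrable_abs[OF assms] by (simp add: set_integrable_def)
  then have "(\<integral>\<^sup>+y. ennreal (indicator S y *\<^sub>R \<bar>g y\<bar>) \<partial>lborel) = ennreal (LINT y:S|lborel. \<bar>g y\<bar>)"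
    unfolding set_lebesgue_integral_def by (intro nn_integral_eq_integral) auto
  then show ?thesis by (simp add: ennreal_mult' ennreal_indicator mult.commute)
qed

text \<open>Consecutive means over \<open>ball z (2 ^ k * t)\<close> differ by at most
  \<open>2 ^ DIM('a) * b\<close>. The mean therefore drifts at most linearly in \<open>k\<close>,
  which is the growth allowed in \<open>wt_nn_integral_le\<close>.\<close>

lemma bmo_wt_integral:
  fixes z :: "'a::euclidean_space"
  assumes b: "bmo_le f b" and t: "0 < t" and a: "0 < a"
  shows "(\<integral>\<^sup>+y. ennreal (wt a t (z - y)) * ennreal \<bar>f y - avg_ball f z t\<bar> \<partial>lborel)
    \<le> ennreal (wt_const DIM('a) a * (2 ^ DIM('a) * ubv DIM('a) * b))"
proof (rule wt_nn_integral_le[OF t a])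
  note b0 = bmo_le_nonneg[OF b]
  have loc: "loc_int f" using b by (simp add: bmo_le_def)
  show "0 \<le> 2 ^ DIM('a) * ubv DIM('a) * b" using b0 by simp
  show "(\<lambda>y. ennreal \<bar>f y - avg_ball f z t\<bar>) \<in> borel_measurable borel"
    using loc_int_measurable[OF loc] by measurable
  fix k :: nat
  define A where "A k = avg_ball f z (2 ^ k * t)" for k :: nat
  define v where "v = ubv DIM('a) * (2 ^ k * t) ^ DIM('a)"
  have v: "0 < v" using t by (simp add: v_def)
  have tel: "\<bar>A k - A 0\<bar> \<le> real k * (2 ^ DIM('a) * b)" for k
  proof (induction k)
    case (Suc k)
    have "\<bar>A k - A (Suc k)\<bar> \<le> b * ((2 ^ Suc k * t) / (2 ^ k * t)) ^ DIM('a)"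
      unfolding A_def using t by (intro avg_ball_nested[OF b] subset_ball) auto
    also have "(2 ^ Suc k * t) / (2 ^ k * t) = 2" using t by simp
    finally show ?case using Suc by (simp add: algebra_simps)
  qed simp
  have int: "set_integrable lborel (ball z (2 ^ k * t)) (\<lambda>y. f y - c)" for c
    by (rule loc_int_diff_const[OF loc])
  have "(LINT y:ball z (2 ^ k * t)|lborel. \<bar>f y - A 0\<bar>)
      \<le> (LINT y:ball z (2 ^ k * t)|lborel. \<bar>f y - A k\<bar> + \<bar>A k - A 0\<bar>)"
    by (intro set_integral_mono set_integral_add set_integrable_abs int set_integrable_ball_const) auto
  also have "\<dots> = (LINT y:ball z (2 ^ k * t)|lborel. \<bar>f y - A k\<bar>) + \<bar>A k - A 0\<bar> * v"
    using t by (subst set_integral_add) (auto intro: set_integrable_abs int set_integrable_ball_const simp: set_integral_ball_const v_def)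
  also have "\<dots> \<le> b * v + real k * (2 ^ DIM('a) * b) * v"
    using bmo_le_osc[OF b, of "2 ^ k * t" z] t tel[of k] v
    by (intro add_mono mult_right_mono) (auto simp: A_def v_def)
  \<comment> \<open>Spending \<open>1 \<le> 2 ^ DIM('a)\<close> combines both terms into one
    multiple of \<open>Suc k\<close>.\<close>
  also have "\<dots> \<le> 2 ^ DIM('a) * b * v + real k * (2 ^ DIM('a) * b) * v"
    using b0 v by (intro add_right_mono mult_right_mono) (auto simp: mult_le_cancel_right1)
  also have "\<dots> = 2 ^ DIM('a) * ubv DIM('a) * b * real (Suc k) * (2 ^ k * t) ^ DIM('a)"
    by (simp add: v_def algebra_simps)
  finally show "(\<integral>\<^sup>+y. ennreal \<bar>f y - avg_ball f z t\<bar> * indicator (ball z (2 ^ k * t)) y \<partial>lborel)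
     \<le> ennreal (2 ^ DIM('a) * ubv DIM('a) * b * real (Suc k) * (2 ^ k * t) ^ DIM('a))"
    by (subst nn_set_integral_abs[OF int]) (auto intro!: ennreal_leI simp: A_def)
qed

lemma bmo_wt_integral_const:
  fixes z :: "'a::euclidean_space"
  assumes b: "bmo_le f b" and t: "0 < t" and a: "0 < a"
  shows "(\<integral>\<^sup>+y. ennreal (wt a t (z - y)) * ennreal \<bar>f y - c\<bar> \<partial>lborel)
    \<le> ennreal (wt_const DIM('a) a * ubv DIM('a) * (2 ^ DIM('a) * b + \<bar>avg_ball f z t - c\<bar>))"
proof -
  define d where "d = \<bar>avg_ball f z t - c\<bar>"
  have d: "0 \<le> d" by (simp add: d_def)
  note b0 = bmo_le_nonneg[OF b]
  note wc = wt_const_pos[OF a, of "DIM('a)"]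
  have [measurable]: "f \<in> borel_measurable borel"
    using b by (simp add: bmo_le_def loc_int_measurable)
  have "(\<integral>\<^sup>+y. ennreal (wt a t (z - y)) * ennreal \<bar>f y - c\<bar> \<partial>lborel)
    \<le> (\<integral>\<^sup>+y. ennreal (wt a t (z - y)) * ennreal \<bar>f y - avg_ball f z t\<bar> + ennreal d * ennreal (wt a t (z - y)) \<partial>lborel)"
  proof (rule nn_integral_mono)
    fix y
    have "ennreal \<bar>f y - c\<bar> \<le> ennreal \<bar>f y - avg_ball f z t\<bar> + ennreal d"
    proof -
      have "ennreal \<bar>f y - c\<bar> \<le> ennreal (\<bar>f y - avg_ball f z t\<bar> + d)"
        by (intro ennreal_leI) (simp add: d_def)
      then show ?thesis using d by simp
    qed
    then have "ennreal (wt a t (z - y)) * ennreal \<bar>f y - c\<bar> \<le> ennreal (wt a t (z - y)) * (ennreal \<bar>f y - avg_ball f z t\<bar> + ennreal d)"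
      by (rule mult_left_mono) simp
    then show "ennreal (wt a t (z - y)) * ennreal \<bar>f y - c\<bar> \<le> ennreal (wt a t (z - y)) * ennreal \<bar>f y - avg_ball f z t\<bar> + ennreal d * ennreal (wt a t (z - y))"
      by (simp add: distrib_left mult.commute)
  qed
  also have "\<dots> = (\<integral>\<^sup>+y. ennreal (wt a t (z - y)) * ennreal \<bar>f y - avg_ball f z t\<bar> \<partial>lborel)
     + ennreal d * (\<integral>\<^sup>+y. ennreal (wt a t (z - y)) \<partial>lborel)"
    by (subst nn_integral_add) (auto simp: nn_integral_cmult)
  also have "\<dots> \<le> ennreal (wt_const DIM('a) a * (2 ^ DIM('a) * ubv DIM('a) * b)) + ennreal d * ennreal (wt_const DIM('a) a * ubv DIM('a))"
    by (intro add_mono mult_left_mono bmo_wt_integral nn_integral_wt_le assms) auto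
  also have "\<dots> = ennreal (wt_const DIM('a) a * ubv DIM('a) * (2 ^ DIM('a) * b + d))"
    using d b0 wc by (simp add: ennreal_mult[symmetric] ennreal_plus[symmetric] algebra_simps del: ennreal_plus)
  finally show ?thesis by (simp add: d_def)
qed

text \<open>Outside the ball of radius \<open>r\<close> the 1 in either weight is harmless:
  \<open>1 + norm v / t\<close> exceeds \<open>norm v / t\<close>, and \<open>1 + norm v / r\<close>
  is at most twice \<open>norm v / r\<close>. What remains is a pure power of \<open>norm v\<close>,
  and comparing the two scales leaves \<open>(t / r) powr a\<close>.\<close>

lemma wt_far:
  fixes v :: "'a::euclidean_space"
  assumes t: "0 < t" "t \<le> r" "r \<le> norm v" and a: "0 < a"
  shows "wt a t v \<le> 2 powr (real DIM('a) + a) * (t / r) powr a * wt a r v"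
proof -
  define p where "p = real DIM('a) + a"
  have p: "p > 0" using a by (simp add: p_def add_nonneg_pos)
  define N where "N = norm v"
  have N: "N > 0" "r > 0" "r \<le> N" using t by (auto simp: N_def)
  have 1: "(1 + N / t) powr (-p) \<le> (N / t) powr (-p)"
    using N t p by (intro powr_mono2') auto
  have 2: "(2 * N / r) powr (-p) \<le> (1 + N / r) powr (-p)"
    using N p by (intro powr_mono2') (auto simp: field_simps add_pos_pos)
  have tp: "s powr p = s ^ DIM('a) * s powr a" if "s > 0" for s :: real
    using that by (simp add: p_def powr_add powr_realpow)
  have "(N / t) powr (-p) / t ^ DIM('a) = N powr (-p) * t powr a"
    using t N by (simp add: powr_divide powr_minus tp field_simps)
  also have "\<dots> = 2 powr p * (t / r) powr a * ((2 * N / r) powr (-p) / r ^ DIM('a))"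
    using N t by (simp add: powr_divide powr_minus powr_mult tp field_simps)
  also have "\<dots> \<le> 2 powr p * (t / r) powr a * ((1 + N / r) powr (-p) / r ^ DIM('a))"
    using 2 N by (intro mult_left_mono divide_right_mono) auto
  finally show ?thesis using divide_right_mono[OF 1, of "t ^ DIM('a)"] t by (simp add: wt_def p_def N_def)
qed

text \<open>The weight is moved from scale \<open>t\<close> to scale \<open>r\<close>, and there the
  mean over \<open>ball z r\<close> is exchanged for the one over \<open>ball x R\<close>. The gain
  \<open>(t / r) powr a\<close> later makes the far part square integrable for \<open>dt / t\<close>
  near 0.\<close>

lemma bmo_far:
  fixes z x :: "'a::euclidean_space"
  assumes b: "bmo_le f b" and t: "0 < t" "t \<le> r" and a: "0 < a" and R: "0 < R" "ball z r \<subseteq> ball x R"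
    and S: "S \<in> sets borel" "\<And>y. y \<in> S \<Longrightarrow> r \<le> norm (z - y)"
  shows "(\<integral>\<^sup>+y. ennreal (wt a t (z - y)) * ennreal \<bar>f y - avg_ball f x R\<bar> * indicator S y \<partial>lborel)
    \<le> ennreal (2 powr (real DIM('a) + a) * wt_const DIM('a) a * ubv DIM('a) * (2 ^ DIM('a) + (R / r) ^ DIM('a)) * b * (t / r) powr a)"
proof -
  let ?c = "avg_ball f x R"
  have r: "0 < r" using t by simp
  note b0 = bmo_le_nonneg[OF b]
  note wc = wt_const_pos[OF a, of "DIM('a)"]
  define C where "C = 2 powr (real DIM('a) + a) * (t / r) powr a"
  have C: "0 \<le> C" by (simp add: C_def)
  have [measurable]: "f \<in> borel_measurable borel"
    using b by (simp add: bmo_le_def loc_int_measurable)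
  have "(\<integral>\<^sup>+y. ennreal (wt a t (z - y)) * ennreal \<bar>f y - ?c\<bar> * indicator S y \<partial>lborel)
    \<le> (\<integral>\<^sup>+y. ennreal C * (ennreal (wt a r (z - y)) * ennreal \<bar>f y - ?c\<bar>) \<partial>lborel)"
  proof (rule nn_integral_mono)
    fix y
    show "ennreal (wt a t (z - y)) * ennreal \<bar>f y - ?c\<bar> * indicator S y \<le> ennreal C * (ennreal (wt a r (z - y)) * ennreal \<bar>f y - ?c\<bar>)"
    proof (cases "y \<in> S")
      case True
      have "ennreal (wt a t (z - y)) \<le> ennreal (C * wt a r (z - y))"
        unfolding C_def using wt_far[OF t S(2)[OF True] a] by (intro ennreal_leI)
      also have "\<dots> = ennreal C * ennreal (wt a r (z - y))" using C r by (simp add: ennreal_mult)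
      finally have "ennreal (wt a t (z - y)) * ennreal \<bar>f y - ?c\<bar> \<le> ennreal C * ennreal (wt a r (z - y)) * ennreal \<bar>f y - ?c\<bar>"
        by (rule mult_right_mono) simp
      then show ?thesis using True by (simp add: mult.assoc)
    qed simp
  qed
  also have "\<dots> = ennreal C * (\<integral>\<^sup>+y. ennreal (wt a r (z - y)) * ennreal \<bar>f y - ?c\<bar> \<partial>lborel)"
    by (simp add: nn_integral_cmult)
  also have "\<dots> \<le> ennreal C * ennreal (wt_const DIM('a) a * ubv DIM('a) * (2 ^ DIM('a) * b + b * (R / r) ^ DIM('a)))"
  proof (rule mult_left_mono)
    have "\<bar>avg_ball f z r - ?c\<bar> \<le> b * (R / r) ^ DIM('a)"
      by (rule avg_ball_nested[OF b r R])
    then have "ennreal (wt_const DIM('a) a * ubv DIM('a) * (2 ^ DIM('a) * b + \<bar>avg_ball f z r - ?c\<bar>))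
       \<le> ennreal (wt_const DIM('a) a * ubv DIM('a) * (2 ^ DIM('a) * b + b * (R / r) ^ DIM('a)))"
      using wc by (intro ennreal_leI mult_left_mono) auto
    with bmo_wt_integral_const[OF b r a, of z ?c]
    show "(\<integral>\<^sup>+y. ennreal (wt a r (z - y)) * ennreal \<bar>f y - ?c\<bar> \<partial>lborel)
       \<le> ennreal (wt_const DIM('a) a * ubv DIM('a) * (2 ^ DIM('a) * b + b * (R / r) ^ DIM('a)))" by (rule order_trans)
  qed simp
  also have "\<dots> = ennreal (2 powr (real DIM('a) + a) * wt_const DIM('a) a * ubv DIM('a) * (2 ^ DIM('a) + (R / r) ^ DIM('a)) * b * (t / r) powr a)"
    using C b0 wc r R by (simp add: ennreal_mult[symmetric] C_def algebra_simps)
  finally show ?thesis .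
qed

subsection \<open>Dyadic John--Nirenberg inequality\<close>

text \<open>Half-open, so that the children partition the parent exactly and integrals split without
  boundary terms.\<close>

definition hcube :: "'a::euclidean_space \<Rightarrow> real \<Rightarrow> 'a set" where
  "hcube a L = {y. \<forall>b\<in>Basis. a \<bullet> b \<le> y \<bullet> b \<and> y \<bullet> b < a \<bullet> b + L}"

text \<open>The lower corner of the child that takes the upper half in the coordinates of
  \<open>S\<close> and the lower half in the others; the \<open>2 ^ DIM('a)\<close> children are
  thus indexed by \<open>Pow Basis\<close>.\<close>

definition subcube :: "'a::euclidean_space \<Rightarrow> real \<Rightarrow> 'a set \<Rightarrow> 'a" where
  "subcube a L S = a + (L / 2) *\<^sub>R \<Sum>S"

lemma inner_sum_subset_Basis:
  assumes "S \<subseteq> Basis" "b \<in> Basis"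
  shows "\<Sum>S \<bullet> b = (if b \<in> S then 1 else (0::real))"
proof -
  have "\<Sum>S \<bullet> b = (\<Sum>i\<in>S. if i = b then 1 else 0)"
    unfolding inner_sum_left using assms by (intro sum.cong refl) (auto simp: inner_Basis)
  also have "\<dots> = (if b \<in> S then 1 else 0)"
    using assms finite_subset[OF assms(1) finite_Basis] by simp
  finally show ?thesis .
qed

lemma inner_subcube:
  assumes "S \<subseteq> Basis" "b \<in> Basis"
  shows "subcube a L S \<bullet> b = a \<bullet> b + (if b \<in> S then L / 2 else 0)"
  using inner_sum_subset_Basis[OF assms] by (simp add: subcube_def inner_add_left)

lemma hcube_measurable [measurable]: "hcube a L \<in> sets borel"
  unfolding hcube_def by measurable

lemma hcube_split:
  assumes "0 < L"
  shows "hcube a L = (\<Union>S\<in>Pow Basis. hcube (subcube a L S) (L / 2))"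
proof (intro equalityI subsetI)
  fix y assume y: "y \<in> hcube a L"
  let ?S = "{b\<in>Basis. a \<bullet> b + L / 2 \<le> y \<bullet> b}"
  have "y \<in> hcube (subcube a L ?S) (L / 2)"
    unfolding hcube_def using y by (auto simp: inner_subcube hcube_def)
  then show "y \<in> (\<Union>S\<in>Pow Basis. hcube (subcube a L S) (L / 2))"
    by (intro UN_I[of ?S]) auto
next
  fix y assume "y \<in> (\<Union>S\<in>Pow Basis. hcube (subcube a L S) (L / 2))"
  then obtain S where S: "S \<subseteq> Basis" "y \<in> hcube (subcube a L S) (L / 2)" by blast
  then show "y \<in> hcube a L"
    using assms by (fastforce simp: hcube_def inner_subcube split: if_splits)
qed

lemma hcube_disjoint: "disjoint_family_on (\<lambda>S. hcube (subcube a L S) (L / 2)) (Pow Basis)"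
  unfolding disjoint_family_on_def
proof (intro ballI impI)
  fix S T :: "'a set" assume ST: "S \<in> Pow Basis" "T \<in> Pow Basis" "S \<noteq> T"
  then obtain b where b: "b \<in> Basis" "b \<in> S \<longleftrightarrow> b \<notin> T" by blast
  have False if "y \<in> hcube (subcube a L S) (L / 2)" "y \<in> hcube (subcube a L T) (L / 2)" for y
  proof -
    have "subcube a L S \<bullet> b \<le> y \<bullet> b" "y \<bullet> b < subcube a L S \<bullet> b + L / 2"
      "subcube a L T \<bullet> b \<le> y \<bullet> b" "y \<bullet> b < subcube a L T \<bullet> b + L / 2"
      using that b(1) by (auto simp: hcube_def)
    then show False using b ST by (auto simp: inner_subcube split: if_splits)
  qed
  then show "hcube (subcube a L S) (L / 2) \<inter> hcube (subcube a L T) (L / 2) = {}" by blast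
qed

lemma emeasure_hcube:
  fixes a :: "'a::euclidean_space"
  assumes "0 \<le> L" shows "emeasure lborel (hcube a L) = ennreal (L ^ DIM('a))"
proof (rule antisym)
  have 1: "emeasure lborel (cbox a (a + L *\<^sub>R One)) = ennreal (L ^ DIM('a))"
    using assms by (subst emeasure_lborel_cbox) (auto simp: inner_add_left)
  have 2: "emeasure lborel (box a (a + L *\<^sub>R One)) = ennreal (L ^ DIM('a))"
    using assms by (subst emeasure_lborel_box) (auto simp: inner_add_left)
  have "hcube a L \<subseteq> cbox a (a + L *\<^sub>R One)"
    by (fastforce simp: hcube_def mem_box inner_add_left intro: less_imp_le)
  then show "emeasure lborel (hcube a L) \<le> ennreal (L ^ DIM('a))"
    unfolding 1[symmetric] by (intro emeasure_mono) auto
  have "box a (a + L *\<^sub>R One) \<subseteq> hcube a L"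
    by (auto simp: hcube_def mem_box inner_add_left intro: less_imp_le)
  then show "ennreal (L ^ DIM('a)) \<le> emeasure lborel (hcube a L)"
    unfolding 2[symmetric] by (intro emeasure_mono) auto
qed

lemma measure_hcube: "0 \<le> L \<Longrightarrow> measure lborel (hcube (a::'a::euclidean_space) L) = L ^ DIM('a)"
  by (simp add: measure_def emeasure_hcube)

text \<open>The ball is centred at the corner \<open>a\<close>. The sum norm bounds the distance by
  \<open>DIM('a) * L\<close>; one further \<open>L\<close> accommodates the open ball.\<close>

lemma hcube_subset_ball:
  fixes a :: "'a::euclidean_space"
  assumes "0 < L" shows "hcube a L \<subseteq> ball a (real (DIM('a) + 1) * L)"
proof
  fix y assume y: "y \<in> hcube a L"
  have "norm (y - a) \<le> (\<Sum>b\<in>Basis. \<bar>(y - a) \<bullet> b\<bar>)" by (rule norm_le_l1)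
  also have "\<dots> \<le> (\<Sum>b\<in>(Basis::'a set). L)"
    using y by (intro sum_mono) (auto simp: hcube_def inner_diff_left abs_le_iff less_imp_le add.commute)
  also have "\<dots> < real (DIM('a) + 1) * L" using assms by (simp add: algebra_simps)
  finally show "y \<in> ball a (real (DIM('a) + 1) * L)" by (simp add: dist_norm norm_minus_commute)
qed

lemma set_integrable_hcube_const: "0 \<le> L \<Longrightarrow> set_integrable lborel (hcube a L) (\<lambda>_. c::real)"
  unfolding set_integrable_def by (intro integrable_scaleR_left) (simp add: emeasure_hcube)

lemma set_integral_hcube_const: "0 \<le> L \<Longrightarrow> (LINT y:hcube a L|lborel. (c::real)) = c * L ^ DIM('a)"
  for a :: "'a::euclidean_space"
  unfolding set_lebesgue_integral_def by (simp add: emeasure_hcube measure_hcube)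

lemma set_integrable_subcube:
  fixes g :: "'a::euclidean_space \<Rightarrow> real"
  assumes "0 < L" "set_integrable lborel (hcube a L) g" "S \<in> Pow Basis"
  shows "set_integrable lborel (hcube (subcube a L S) (L / 2)) g"
  using assms(2) by (rule set_integrable_subset) (use assms hcube_split[OF assms(1), of a] in auto)

lemma set_integral_hcube_split:
  fixes g :: "'a::euclidean_space \<Rightarrow> real"
  assumes "0 < L" "set_integrable lborel (hcube a L) g"
  shows "(LINT y:hcube a L|lborel. g y) = (\<Sum>S\<in>Pow Basis. LINT y:hcube (subcube a L S) (L / 2)|lborel. g y)"
  unfolding hcube_split[OF assms(1), of a]
  by (rule set_integral_finite_Union)
    (use set_integrable_subcube[OF assms] hcube_disjoint[of a L] in auto)

text \<open>The squared \<open>L\<^sup>2\<close> distance from \<open>c\<close> of the dyadic averages of \<open>f\<close> at depth \<open>N\<close> below the cube.\<close>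

primrec dyadic_var :: "('a::euclidean_space \<Rightarrow> real) \<Rightarrow> nat \<Rightarrow> 'a \<Rightarrow> real \<Rightarrow> real \<Rightarrow> real" where
  "dyadic_var f 0 a L c = (LINT y:hcube a L|lborel. f y - c)\<^sup>2 / L ^ DIM('a)"
| "dyadic_var f (Suc N) a L c = (\<Sum>S\<in>Pow Basis. dyadic_var f N (subcube a L S) (L / 2) c)"

lemma dyadic_var_nonneg: "0 \<le> L \<Longrightarrow> 0 \<le> dyadic_var f N a L c"
  by (induction N arbitrary: a L) (auto intro!: sum_nonneg)

lemma sum_subcubes_volume:
  "(\<Sum>S\<in>Pow (Basis::'a::euclidean_space set). (L / 2) ^ DIM('a)) = (L::real) ^ DIM('a)"
  by (simp add: card_Pow power_divide)

lemma loc_int_hcube: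
  fixes a :: "'a::euclidean_space"
  assumes "loc_int f" "0 < L"
  shows "set_integrable lborel (hcube a L) (\<lambda>y. f y - c)"
  by (rule loc_int_diff_const_subset[OF assms(1) hcube_subset_ball[OF assms(2)]]) simp

text \<open>On each cube of the last generation this is
  \<open>(x - y)^2 \<le> 2 * x^2 + 2 * y^2\<close>. The volumes of the children add up to that of
  the parent, so the constants do not deteriorate with the depth.\<close>

lemma dyadic_var_change_const:
  assumes "loc_int f" "0 < L"
  shows "dyadic_var f N (a::'a::euclidean_space) L c \<le> 2 * dyadic_var f N a L c' + 2 * (c - c')\<^sup>2 * L ^ DIM('a)"
  using assms(2)
proof (induction N arbitrary: a L)
  case 0
  define v where "v = L ^ DIM('a)"
  have v: "v > 0" using 0 by (simp add: v_def)
  define I where "I = (LINT y:hcube a L|lborel. f y - c')"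
  have "(LINT y:hcube a L|lborel. (f y - c') - (c - c')) = I - (c - c') * v"
    unfolding I_def v_def using 0
    by (subst set_integral_diff) (auto intro: loc_int_hcube[OF assms(1)] set_integrable_hcube_const simp: set_integral_hcube_const)
  then have eq: "(LINT y:hcube a L|lborel. f y - c) = I - (c - c') * v" by simp
  have "(I - (c - c') * v)\<^sup>2 \<le> 2 * I\<^sup>2 + 2 * ((c - c') * v)\<^sup>2"
    using zero_le_power2[of "I + (c - c') * v"] by (simp add: power2_diff power2_sum)
  also have "\<dots> = (2 * (I\<^sup>2 / v) + 2 * (c - c')\<^sup>2 * v) * v"
    using v by (simp add: field_simps power2_eq_square)
  finally have "(I - (c - c') * v)\<^sup>2 / v \<le> 2 * (I\<^sup>2 / v) + 2 * (c - c')\<^sup>2 * v"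
    using v by (simp add: pos_divide_le_eq)
  then show ?case by (simp add: eq v_def I_def)
next
  case (Suc N)
  have "dyadic_var f (Suc N) a L c \<le> (\<Sum>S\<in>Pow Basis. 2 * dyadic_var f N (subcube a L S) (L / 2) c' + 2 * (c - c')\<^sup>2 * (L / 2) ^ DIM('a))"
    using Suc by (simp add: sum_mono)
  also have "\<dots> = 2 * dyadic_var f (Suc N) a L c' + 2 * (c - c')\<^sup>2 * (\<Sum>S\<in>Pow (Basis::'a set). (L / 2) ^ DIM('a))"
    by (simp only: sum.distrib sum_distrib_left dyadic_var.simps)
  finally show ?case unfolding sum_subcubes_volume .
qed

text \<open>John--Nirenberg in \<open>L\<^sup>2\<close>, by induction on the depth: a child on which the mean of \<open>\<bar>f - c\<bar>\<close>
  exceeds the threshold \<open>4 * b\<close> is treated by restarting with its own constant.\<close>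

lemma dyadic_var_le:
  fixes f :: "'a::euclidean_space \<Rightarrow> real"
  assumes f: "loc_int f" and b: "0 < b"
    and cc: "\<And>a L. 0 < L \<Longrightarrow> (LINT y:hcube a L|lborel. \<bar>f y - cc a L\<bar>) \<le> b * L ^ DIM('a)"
  shows "0 < L \<Longrightarrow> (LINT y:hcube a L|lborel. \<bar>f y - c\<bar>) \<le> 4 * b * L ^ DIM('a) \<Longrightarrow>
    dyadic_var f N a L c \<le> 64 * 2 ^ DIM('a) * b * (LINT y:hcube a L|lborel. \<bar>f y - c\<bar>)"
proof (induction N arbitrary: a L c)
  case 0
  define v where "v = L ^ DIM('a)"
  have v: "v > 0" using 0 by (simp add: v_def)
  define I where "I = (LINT y:hcube a L|lborel. \<bar>f y - c\<bar>)"
  have "\<bar>LINT y:hcube a L|lborel. f y - c\<bar> \<le> I"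
    unfolding I_def using set_integral_norm_bound[OF loc_int_hcube[OF f 0(1)], of a c] by simp
  then have I: "(LINT y:hcube a L|lborel. f y - c)\<^sup>2 \<le> I\<^sup>2" "0 \<le> I"
    by (auto intro: power2_le_iff_abs_le[THEN iffD2])
  then have "(LINT y:hcube a L|lborel. f y - c)\<^sup>2 / v \<le> I * I / v"
    using v by (auto intro!: divide_right_mono simp: power2_eq_square)
  also have "\<dots> \<le> I * (4 * b * v) / v"
    using 0(2) I v by (intro divide_right_mono mult_left_mono) (auto simp: I_def v_def)
  also have "\<dots> = 4 * 1 * b * I" using v by simp
  also have "\<dots> \<le> 64 * 2 ^ DIM('a) * b * I"
    using b I by (intro mult_right_mono mult_mono) auto
  finally show ?case by (simp add: I_def v_def)
next
  case (Suc N)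
  \<comment> \<open>The factor 64 closes the induction: on a restarted child
    \<open>(c - c')\<^sup>2 * v\<close> has to be at most \<open>A / 4 * w\<close>, and the bound
    available there is \<open>16 * b * 2 ^ DIM('a) * w\<close>.\<close>
  define A where "A = 64 * 2 ^ DIM('a) * b"
  have A: "A > 0" using b by (simp add: A_def)
  have L2: "0 < L / 2" using Suc.prems by simp
  have intc: "set_integrable lborel (hcube a L) (\<lambda>y. \<bar>f y - c\<bar>)"
    by (intro set_integrable_abs loc_int_hcube f Suc.prems)
  have child: "dyadic_var f N (subcube a L S) (L / 2) c \<le> A * (LINT y:hcube (subcube a L S) (L / 2)|lborel. \<bar>f y - c\<bar>)"
    if S: "S \<in> Pow Basis" for S
  proof -
    define a' where "a' = subcube a L S"
    define M where "M = L / 2"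
    define v where "v = M ^ DIM('a)"
    have M: "0 < M" and v: "0 < v" using L2 by (auto simp: M_def v_def)
    define w where "w = (LINT y:hcube a' M|lborel. \<bar>f y - c\<bar>)"
    show ?thesis
    proof (cases "w \<le> 4 * b * v")
      case True
      then show ?thesis using Suc.IH[OF L2, of a' c] by (simp add: w_def A_def a'_def M_def v_def)
    next
      case False
      \<comment> \<open>Above the threshold, the child's own constant has oscillation at most
        \<open>b * v\<close>, less than a quarter of \<open>w\<close>; after the restart the
        inductive bound therefore uses only a quarter of the allowance.\<close>
      define c' where "c' = cc a' M"
      define I where "I = (LINT y:hcube a' M|lborel. \<bar>f y - c'\<bar>)"
      have I: "I \<le> b * v" unfolding I_def c'_def v_def using cc[OF M] .
      have "I \<le> 4 * b * v" using I mult_pos_pos[OF b v] by linarith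
      then have "dyadic_var f N a' M c' \<le> A * I"
        using Suc.IH[OF L2, of a' c'] unfolding I_def A_def M_def v_def by simp
      also have "\<dots> \<le> A * (w / 4)" using A I False by (intro mult_left_mono) auto
      finally have V': "dyadic_var f N a' M c' \<le> A * (w / 4)" .
      have int: "set_integrable lborel (hcube a' M) (\<lambda>y. \<bar>f y - d\<bar>)" for d
        by (intro set_integrable_abs loc_int_hcube f M)
      have "\<bar>c - c'\<bar> * v = (LINT y:hcube a' M|lborel. \<bar>c - c'\<bar>)"
        using M by (simp add: set_integral_hcube_const v_def)
      also have "\<dots> \<le> (LINT y:hcube a' M|lborel. \<bar>f y - c\<bar> + \<bar>f y - c'\<bar>)"
        using M by (intro set_integral_mono set_integral_add set_integrable_hcube_const int) auto
      also have "\<dots> = w + I" unfolding w_def I_def by (intro set_integral_add int)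
      also have "\<dots> \<le> 2 * w" using I False mult_pos_pos[OF b v] by linarith
      finally have d: "\<bar>c - c'\<bar> * v \<le> 2 * w" .
      \<comment> \<open>The parent is below the threshold, which bounds \<open>w\<close> up to the
        ratio \<open>2 ^ DIM('a)\<close> of the volumes. This makes the quadratic term in
        \<open>w\<close> linear.\<close>
      have "hcube a' M \<subseteq> hcube a L"
        using hcube_split[OF Suc.prems(1), of a] S unfolding a'_def M_def by blast
      then have "w \<le> (LINT y:hcube a L|lborel. \<bar>f y - c\<bar>)"
        unfolding w_def by (intro set_integral_abs_mono_set loc_int_hcube f Suc.prems) auto
      also have "\<dots> \<le> 4 * b * L ^ DIM('a)" by (rule Suc.prems)
      also have "\<dots> = 4 * b * 2 ^ DIM('a) * v" by (simp add: v_def M_def power_divide)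
      finally have w: "w \<le> 4 * b * 2 ^ DIM('a) * v" .
      have w0: "0 \<le> w" using False mult_pos_pos[OF b v] by linarith
      have "((c - c')\<^sup>2 * v) * v = (\<bar>c - c'\<bar> * v)\<^sup>2" by (simp add: power2_eq_square abs_mult_self_eq algebra_simps)
      also have "\<dots> \<le> (2 * w)\<^sup>2" using d v by (intro power_mono) auto
      also have "\<dots> = 4 * w * w" by (simp add: power2_eq_square)
      also have "\<dots> \<le> 4 * w * (4 * b * 2 ^ DIM('a) * v)" using w w0 by (intro mult_left_mono) auto
      also have "\<dots> = (A / 4 * w) * v" by (simp add: A_def)
      finally have "(c - c')\<^sup>2 * v \<le> A / 4 * w" using v by simp
      then have "dyadic_var f N a' M c \<le> 2 * (A * (w / 4)) + 2 * (A / 4 * w)"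
        using dyadic_var_change_const[OF f M, of N a' c c'] V' by (simp add: v_def)
      then show ?thesis by (simp add: w_def a'_def M_def)
    qed
  qed
  have "dyadic_var f (Suc N) a L c \<le> (\<Sum>S\<in>Pow Basis. A * (LINT y:hcube (subcube a L S) (L / 2)|lborel. \<bar>f y - c\<bar>))"
    unfolding dyadic_var.simps by (intro sum_mono child)
  also have "\<dots> = A * (LINT y:hcube a L|lborel. \<bar>f y - c\<bar>)"
    by (simp add: set_integral_hcube_split[OF Suc.prems(1) intc] sum_distrib_left)
  finally show ?case by (simp add: A_def)
qed

lemma hcube_integrable_bounded:
  fixes f h :: "'a::euclidean_space \<Rightarrow> real"
  assumes f: "loc_int f" and [measurable]: "h \<in> borel_measurable borel" and H: "\<And>y. \<bar>h y\<bar> \<le> H" and L: "0 < L"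
  shows "set_integrable lborel (hcube a L) h"
    and "set_integrable lborel (hcube a L) (\<lambda>y. (h y)\<^sup>2)"
    and "set_integrable lborel (hcube a L) (\<lambda>y. (f y - c) * h y)"
proof -
  have L0: "0 \<le> L" using L by simp
  have H0: "0 \<le> H" using H[of 0] by simp
  have [measurable]: "f \<in> borel_measurable borel" by (rule loc_int_measurable[OF f])
  show "set_integrable lborel (hcube a L) h"
    using H by (intro set_integrable_bound[OF set_integrable_hcube_const[OF L0, of a H]] AE_I2 impI)
      (auto simp: set_borel_measurable_def intro: order_trans[OF H abs_ge_self])
  show "set_integrable lborel (hcube a L) (\<lambda>y. (h y)\<^sup>2)"
    using power_mono[OF H, where n=2] H0
    by (intro set_integrable_bound[OF set_integrable_hcube_const[OF L0, of a "H\<^sup>2"]]) (auto simp: set_borel_measurable_def)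
  show "set_integrable lborel (hcube a L) (\<lambda>y. (f y - c) * h y)"
    using H H0 set_integrable_mult_right[OF set_integrable_abs[OF loc_int_hcube[OF f L, of a c]], of H]
    by (elim set_integrable_bound) (auto simp: set_borel_measurable_def abs_mult mult.commute intro!: mult_right_mono AE_I2)
qed

text \<open>If \<open>h\<close> were constant on the cubes of generation \<open>N\<close>, only the
  means of \<open>f - c\<close> over them would enter, and Cauchy--Schwarz over these cubes would
  give the first term. The second term is the cost of replacing \<open>h\<close> on each of them by
  its mean, from which it deviates by at most \<eta>.\<close>

lemma dyadic_duality:
  fixes f h :: "'a::euclidean_space \<Rightarrow> real"
  assumes f: "loc_int f" and [measurable]: "h \<in> borel_measurable borel" and H: "\<And>y. \<bar>h y\<bar> \<le> H"
  shows "0 < L \<Longrightarrow> (\<And>y y'. y \<in> hcube a L \<Longrightarrow> y' \<in> hcube a L \<Longrightarrow>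
      (\<And>b. b \<in> Basis \<Longrightarrow> \<bar>(y - y') \<bullet> b\<bar> \<le> L / 2 ^ N) \<Longrightarrow> \<bar>h y - h y'\<bar> \<le> \<eta>) \<Longrightarrow>
    \<bar>LINT y:hcube a L|lborel. (f y - c) * h y\<bar>
     \<le> sqrt (dyadic_var f N a L c) * sqrt (LINT y:hcube a L|lborel. (h y)\<^sup>2)
        + \<eta> * (LINT y:hcube a L|lborel. \<bar>f y - c\<bar>)"
proof (induction N arbitrary: a L)
  case 0
  define v where "v = L ^ DIM('a)"
  have L: "0 \<le> L" and v: "v > 0" using 0 by (auto simp: v_def)
  note inth = hcube_integrable_bounded(1)[OF f assms(2) H 0(1), of a]
    and inth2 = hcube_integrable_bounded(2)[OF f assms(2) H 0(1), of a]
    and intfh = hcube_integrable_bounded(3)[OF f assms(2) H 0(1), of a c]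
    and intf = loc_int_hcube[OF f 0(1), of a c]
  define hb where "hb = (LINT y:hcube a L|lborel. h y) / v"
  have hbv: "(LINT y:hcube a L|lborel. h y) = hb * v" using v by (simp add: hb_def)
  define I where "I = (LINT y:hcube a L|lborel. f y - c)"
  have osc: "\<bar>h y - h y'\<bar> \<le> \<eta>" if "y \<in> hcube a L" "y' \<in> hcube a L" for y y'
  proof (rule 0(2)[OF that])
    fix b :: 'a assume "b \<in> Basis"
    then have "a \<bullet> b \<le> y \<bullet> b" "y \<bullet> b < a \<bullet> b + L" "a \<bullet> b \<le> y' \<bullet> b" "y' \<bullet> b < a \<bullet> b + L"
      using that by (auto simp: hcube_def)
    then show "\<bar>(y - y') \<bullet> b\<bar> \<le> L / 2 ^ 0" by (simp add: inner_diff_left abs_le_iff)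
  qed
  have hb: "\<bar>h y - hb\<bar> \<le> \<eta>" if y: "y \<in> hcube a L" for y
  proof -
    have "(h y - hb) * v = (LINT y':hcube a L|lborel. h y - h y')"
      using L by (subst set_integral_diff) (auto simp: set_integrable_hcube_const inth set_integral_hcube_const hbv left_diff_distrib v_def)
    also have "\<bar>\<dots>\<bar> \<le> (LINT y':hcube a L|lborel. \<bar>h y - h y'\<bar>)"
      using set_integral_norm_bound[OF set_integral_diff(1)[OF set_integrable_hcube_const[OF L] inth], of "h y"] by simp
    also have "\<dots> \<le> (LINT y':hcube a L|lborel. \<eta>)"
      using osc[OF y] by (intro set_integral_mono set_integrable_abs set_integral_diff(1) set_integrable_hcube_const L inth)
    also have "\<dots> = \<eta> * v" using L by (simp add: set_integral_hcube_const v_def)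
    finally show ?thesis using v by (simp add: abs_mult)
  qed
  \<comment> \<open>Nonnegativity of the variance of \<open>h\<close> yields Jensen's inequality for
    the square of its mean.\<close>
  have "0 \<le> (LINT y:hcube a L|lborel. (h y - hb)\<^sup>2)"
    unfolding set_lebesgue_integral_def by (intro integral_nonneg_AE) auto
  also have "\<dots> = (LINT y:hcube a L|lborel. ((h y)\<^sup>2 - 2 * hb * h y) + hb\<^sup>2)"
    by (simp add: power2_diff algebra_simps)
  also have "\<dots> = (LINT y:hcube a L|lborel. (h y)\<^sup>2) - 2 * hb * (hb * v) + hb\<^sup>2 * v"
    using L inth inth2
    by (simp add: set_integral_add set_integral_diff set_integrable_hcube_const set_integral_hcube_const hbv v_def)
  finally have hb2: "hb\<^sup>2 * v \<le> (LINT y:hcube a L|lborel. (h y)\<^sup>2)" by (simp add: power2_eq_square)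
  have "\<bar>I * hb\<bar> = sqrt (I\<^sup>2 / v) * sqrt (hb\<^sup>2 * v)"
    using v by (simp add: real_sqrt_mult[symmetric] abs_mult power_mult_distrib[symmetric])
  also have "\<dots> \<le> sqrt (I\<^sup>2 / v) * sqrt (LINT y:hcube a L|lborel. (h y)\<^sup>2)"
    using v by (intro mult_left_mono real_sqrt_le_mono hb2) auto
  finally have 1: "\<bar>I * hb\<bar> \<le> sqrt (dyadic_var f 0 a L c) * sqrt (LINT y:hcube a L|lborel. (h y)\<^sup>2)"
    by (simp add: I_def v_def)
  have intd: "set_integrable lborel (hcube a L) (\<lambda>y. (f y - c) * (h y - hb))"
    unfolding right_diff_distrib by (intro set_integral_diff(1) intfh set_integrable_mult_left impI intf)
  have "(LINT y:hcube a L|lborel. (f y - c) * h y) = (LINT y:hcube a L|lborel. (f y - c) * (h y - hb) + (f y - c) * hb)"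
    by (simp add: algebra_simps)
  also have "\<dots> = (LINT y:hcube a L|lborel. (f y - c) * (h y - hb)) + I * hb"
    unfolding I_def by (subst set_integral_add) (auto intro: intd intf)
  finally have "\<bar>LINT y:hcube a L|lborel. (f y - c) * h y\<bar> \<le> \<bar>LINT y:hcube a L|lborel. (f y - c) * (h y - hb)\<bar> + \<bar>I * hb\<bar>"
    by simp
  moreover have "\<bar>LINT y:hcube a L|lborel. (f y - c) * (h y - hb)\<bar> \<le> \<eta> * (LINT y:hcube a L|lborel. \<bar>f y - c\<bar>)"
  proof -
    have "\<bar>LINT y:hcube a L|lborel. (f y - c) * (h y - hb)\<bar> \<le> (LINT y:hcube a L|lborel. \<bar>(f y - c) * (h y - hb)\<bar>)"
      using set_integral_norm_bound[OF intd] by simp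
    also have "\<dots> \<le> (LINT y:hcube a L|lborel. \<eta> * \<bar>f y - c\<bar>)"
      using hb by (intro set_integral_mono set_integrable_abs intd set_integrable_mult_right intf)
        (simp add: abs_mult mult.commute[of "\<bar>f _ - c\<bar>"] mult_right_mono)
    finally show ?thesis by simp
  qed
  ultimately show ?case using 1 by linarith
next
  case (Suc N)
  let ?h = "\<lambda>S. LINT y:hcube (subcube a L S) (L / 2)|lborel. (h y)\<^sup>2"
  let ?V = "\<lambda>S. dyadic_var f N (subcube a L S) (L / 2) c"
  let ?I = "\<lambda>S. LINT y:hcube (subcube a L S) (L / 2)|lborel. \<bar>f y - c\<bar>"
  have L: "0 \<le> L" and L2: "0 < L / 2" using Suc.prems by auto
  note inth2 = hcube_integrable_bounded(2)[OF f assms(2) H Suc.prems(1), of a]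
    and intfh = hcube_integrable_bounded(3)[OF f assms(2) H Suc.prems(1), of a c]
    and intf = loc_int_hcube[OF f Suc.prems(1), of a c]
  have child: "\<bar>LINT y:hcube (subcube a L S) (L / 2)|lborel. (f y - c) * h y\<bar> \<le> sqrt (?V S) * sqrt (?h S) + \<eta> * ?I S"
    if S: "S \<in> Pow Basis" for S
  proof (rule Suc.IH[OF L2])
    fix y y' assume y: "y \<in> hcube (subcube a L S) (L / 2)" "y' \<in> hcube (subcube a L S) (L / 2)"
      and d: "\<And>b. b \<in> Basis \<Longrightarrow> \<bar>(y - y') \<bullet> b\<bar> \<le> L / 2 / 2 ^ N"
    have "y \<in> hcube a L" "y' \<in> hcube a L" using y S hcube_split[OF Suc.prems(1), of a] by blast+
    then show "\<bar>h y - h y'\<bar> \<le> \<eta>" using d by (intro Suc.prems(2)) auto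
  qed
  have "\<bar>LINT y:hcube a L|lborel. (f y - c) * h y\<bar> \<le> (\<Sum>S\<in>Pow Basis. \<bar>LINT y:hcube (subcube a L S) (L / 2)|lborel. (f y - c) * h y\<bar>)"
    unfolding set_integral_hcube_split[OF Suc.prems(1) intfh] by (rule sum_abs)
  also have "\<dots> \<le> (\<Sum>S\<in>Pow Basis. sqrt (?V S) * sqrt (?h S) + \<eta> * ?I S)"
    by (intro sum_mono child)
  also have "\<dots> = (\<Sum>S\<in>Pow Basis. sqrt (?V S) * sqrt (?h S)) + \<eta> * (LINT y:hcube a L|lborel. \<bar>f y - c\<bar>)"
    by (simp add: sum.distrib sum_distrib_left set_integral_hcube_split[OF Suc.prems(1) set_integrable_abs[OF intf]])
  also have "(\<Sum>S\<in>Pow Basis. sqrt (?V S) * sqrt (?h S)) \<le> sqrt (dyadic_var f (Suc N) a L c) * sqrt (LINT y:hcube a L|lborel. (h y)\<^sup>2)"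
  proof -
    have V0: "0 \<le> ?V S" for S using L2 by (intro dyadic_var_nonneg) auto
    have h0: "0 \<le> ?h S" for S unfolding set_lebesgue_integral_def by (intro integral_nonneg_AE) auto
    \<comment> \<open>Cauchy--Schwarz over the children. Both factors are additive:
      \<open>dyadic_var\<close> by its recursion, the integral of \<open>(h y)\<^sup>2\<close> by
      the partition.\<close>
    have "(\<Sum>S\<in>Pow Basis. sqrt (?V S) * sqrt (?h S))\<^sup>2 \<le> (\<Sum>S\<in>Pow Basis. (sqrt (?V S))\<^sup>2) * (\<Sum>S\<in>Pow Basis. (sqrt (?h S))\<^sup>2)"
      by (rule Cauchy_Schwarz_ineq_sum)
    also have "\<dots> = dyadic_var f (Suc N) a L c * (LINT y:hcube a L|lborel. (h y)\<^sup>2)"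
      by (simp add: V0 h0 set_integral_hcube_split[OF Suc.prems(1) inth2])
    finally show ?thesis by (simp add: real_le_rsqrt real_sqrt_mult[symmetric])
  qed
  finally show ?case by simp
qed

text \<open>Letting the depth tend to infinity removes the error term, because Hoelder continuity
  makes the variation of \<open>h\<close> on small cubes vanish. The constant \<open>D\<close>
  leaves no trace in the bound, so \<open>h\<close> may come from a truncated problem in which
  \<open>D\<close> is huge.\<close>

lemma bmo_duality:
  fixes f h :: "'a::euclidean_space \<Rightarrow> real"
  assumes f: "bmo_le f b" and b: "0 < b" and L: "0 < L"
    and h: "h \<in> borel_measurable borel" and H: "\<And>y. \<bar>h y\<bar> \<le> H"
    and e: "0 < e" and hoelder: "\<And>y y'. \<bar>h y - h y'\<bar> \<le> D * norm (y - y') powr e"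
  shows "\<bar>LINT y:hcube a L|lborel. (f y - avg_ball f a (real (DIM('a) + 1) * L)) * h y\<bar>
     \<le> sqrt (64 * 2 ^ DIM('a)) * (b * ubv DIM('a) * real (DIM('a) + 1) ^ DIM('a)) * sqrt (L ^ DIM('a))
        * sqrt (LINT y:hcube a L|lborel. (h y)\<^sup>2)"
proof -
  \<comment> \<open>Oscillation over the ball of radius \<open>(DIM('a) + 1) * L\<close> is
    converted into oscillation over the cube; the extra factor is the ratio of the volumes.\<close>
  define \<beta> where "\<beta> = b * ubv DIM('a) * real (DIM('a) + 1) ^ DIM('a)"
  have \<beta>: "0 < \<beta>" using b by (simp add: \<beta>_def)
  define cc where "cc a L = avg_ball f a (real (DIM('a) + 1) * L)" for a L
  define h2 where "h2 = (LINT y:hcube a L|lborel. (h y)\<^sup>2)"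
  have h2: "0 \<le> h2" unfolding h2_def set_lebesgue_integral_def by (intro integral_nonneg_AE) auto
  have loc: "loc_int f" using f by (simp add: bmo_le_def)
  have cc: "(LINT y:hcube a L|lborel. \<bar>f y - cc a L\<bar>) \<le> \<beta> * L ^ DIM('a)" if "0 < L" for a L
  proof -
    have "(LINT y:hcube a L|lborel. \<bar>f y - cc a L\<bar>) \<le> b * (ubv DIM('a) * (real (DIM('a) + 1) * L) ^ DIM('a))"
      unfolding cc_def using that by (intro bmo_le_osc_subset[OF f] hcube_subset_ball) auto
    also have "\<dots> = \<beta> * L ^ DIM('a)" by (simp only: \<beta>_def power_mult_distrib mult_ac)
    finally show ?thesis .
  qed
  define c where "c = cc a L"
  define I where "I = (LINT y:hcube a L|lborel. \<bar>f y - c\<bar>)"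
  have I: "I \<le> \<beta> * L ^ DIM('a)" unfolding I_def c_def by (rule cc[OF L])
  have I0: "0 \<le> I" unfolding I_def set_lebesgue_integral_def by (intro integral_nonneg_AE) auto
  let ?Y = "sqrt (64 * 2 ^ DIM('a)) * \<beta> * sqrt (L ^ DIM('a)) * sqrt h2"
  let ?\<eta> = "\<lambda>N. \<bar>D\<bar> * (real DIM('a) * (L * (1/2) ^ N)) powr e"
  have main: "\<bar>LINT y:hcube a L|lborel. (f y - c) * h y\<bar> \<le> ?Y + ?\<eta> N * I" for N
  proof -
    have "\<bar>LINT y:hcube a L|lborel. (f y - c) * h y\<bar> \<le> sqrt (dyadic_var f N a L c) * sqrt h2 + ?\<eta> N * I"
      unfolding h2_def I_def
    proof (rule dyadic_duality[OF loc h H L])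
      fix y y' :: 'a assume d: "\<And>b. b \<in> Basis \<Longrightarrow> \<bar>(y - y') \<bullet> b\<bar> \<le> L / 2 ^ N"
      have "norm (y - y') \<le> (\<Sum>b\<in>Basis. \<bar>(y - y') \<bullet> b\<bar>)" by (rule norm_le_l1)
      also have "\<dots> \<le> (\<Sum>b\<in>(Basis::'a set). L / 2 ^ N)" by (intro sum_mono d)
      also have "\<dots> = real DIM('a) * (L * (1/2) ^ N)" by (simp add: power_divide)
      finally have "norm (y - y') powr e \<le> (real DIM('a) * (L * (1/2) ^ N)) powr e"
        using e by (intro powr_mono2) auto
      then have "\<bar>D\<bar> * norm (y - y') powr e \<le> ?\<eta> N" by (rule mult_left_mono) simp
      moreover have "D * norm (y - y') powr e \<le> \<bar>D\<bar> * norm (y - y') powr e" by (intro mult_right_mono) auto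
      ultimately show "\<bar>h y - h y'\<bar> \<le> ?\<eta> N" using hoelder[of y y'] by linarith
    qed
    moreover have "sqrt (dyadic_var f N a L c) * sqrt h2 \<le> ?Y"
    proof (rule mult_right_mono)
      have "\<beta> * L ^ DIM('a) \<le> 4 * \<beta> * L ^ DIM('a)" using \<beta> L by simp
      with I have I4: "I \<le> 4 * \<beta> * L ^ DIM('a)" by linarith
      have "dyadic_var f N a L c \<le> 64 * 2 ^ DIM('a) * \<beta> * I"
        unfolding I_def by (rule dyadic_var_le[OF loc \<beta> cc L I4[unfolded I_def]])
      also have "\<dots> \<le> 64 * 2 ^ DIM('a) * \<beta> * (\<beta> * L ^ DIM('a))"
        using I \<beta> by (intro mult_left_mono) auto
      also have "\<dots> = (64 * 2 ^ DIM('a)) * \<beta>\<^sup>2 * L ^ DIM('a)"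
        by (simp add: power2_eq_square)
      finally have "sqrt (dyadic_var f N a L c) \<le> sqrt ((64 * 2 ^ DIM('a)) * \<beta>\<^sup>2 * L ^ DIM('a))"
        by (rule real_sqrt_le_mono)
      then show "sqrt (dyadic_var f N a L c) \<le> sqrt (64 * 2 ^ DIM('a)) * \<beta> * sqrt (L ^ DIM('a))"
        using \<beta> by (simp only: real_sqrt_mult real_sqrt_abs abs_of_pos)
    qed (use h2 in simp)
    ultimately show ?thesis by linarith
  qed
  have "(\<lambda>N. real DIM('a) * (L * (1/2) ^ N)) \<longlonglongrightarrow> real DIM('a) * (L * 0)"
    by (intro tendsto_mult tendsto_const LIMSEQ_power_zero) auto
  then have "(\<lambda>N. (real DIM('a) * (L * (1/2) ^ N)) powr e) \<longlonglongrightarrow> 0"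
    using e L by (intro tendsto_zero_powrI[OF _ tendsto_const]) (auto intro!: always_eventually)
  then have "(\<lambda>N. ?Y + ?\<eta> N * I) \<longlonglongrightarrow> ?Y + \<bar>D\<bar> * 0 * I"
    by (intro tendsto_add tendsto_mult tendsto_const)
  then have "(\<lambda>N. ?Y + ?\<eta> N * I) \<longlonglongrightarrow> ?Y" by simp
  then have "\<bar>LINT y:hcube a L|lborel. (f y - c) * h y\<bar> \<le> ?Y"
    using main by (intro LIMSEQ_le_const) auto
  then show ?thesis by (simp add: \<beta>_def c_def cc_def h2_def)
qed

subsection \<open>Schur's test\<close>

lemma nn_integral_powr_Icc:
  assumes "-1 < p" "0 \<le> c"
  shows "(\<integral>\<^sup>+s. ennreal (s powr p) * indicator {0..c} s \<partial>lborel) = ennreal (c powr (p + 1) / (p + 1))"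
  by (rule nn_integral_has_integral_lebesgue'[OF _ has_integral_powr_from_0[OF assms]]) simp

lemma nn_integral_powr_atLeast:
  assumes "p < -1" "0 < c"
  shows "(\<integral>\<^sup>+s. ennreal (s powr p) * indicator {c..} s \<partial>lborel) = ennreal (- (c powr (p + 1)) / (p + 1))"
  by (rule nn_integral_has_integral_lebesgue'[OF _ has_integral_powr_to_inf[OF assms]]) simp

text \<open>The integral of \<open>(s / t) powr e / s\<close> over \<open>0 < s \<le> t\<close> and
  that of \<open>(t / s) powr e / s\<close> over \<open>s \<ge> t\<close> both equal
  \<open>1 / e\<close>.\<close>

lemma nn_integral_scale_min_powr:
  assumes t: "0 < t" and e: "0 < e"
  shows "(\<integral>\<^sup>+s. ennreal (min (s / t) (t / s) powr e / s) * indicator {0<..} s \<partial>lborel) \<le> ennreal (2 / e)"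
proof -
  have "(\<integral>\<^sup>+s. ennreal (min (s / t) (t / s) powr e / s) * indicator {0<..} s \<partial>lborel)
     \<le> (\<integral>\<^sup>+s. ennreal (t powr (- e)) * (ennreal (s powr (e - 1)) * indicator {0..t} s)
             + ennreal (t powr e) * (ennreal (s powr (- e - 1)) * indicator {t..} s) \<partial>lborel)"
  proof (rule nn_integral_mono)
    fix s :: real
    consider "s \<le> 0" | "0 < s" "s \<le> t" | "t < s" "0 < s" using t by linarith
    then show "ennreal (min (s / t) (t / s) powr e / s) * indicator {0<..} s
      \<le> ennreal (t powr (- e)) * (ennreal (s powr (e - 1)) * indicator {0..t} s)
             + ennreal (t powr e) * (ennreal (s powr (- e - 1)) * indicator {t..} s)"
    proof cases
      case 2
      have "min (s / t) (t / s) powr e / s \<le> (s / t) powr e / s"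
        using 2 t e by (intro divide_right_mono powr_mono2) auto
      also have "\<dots> = t powr (- e) * s powr (e - 1)"
        using 2 t by (simp add: powr_divide powr_minus powr_diff field_simps)
      finally have "ennreal (min (s / t) (t / s) powr e / s) \<le> ennreal (t powr (- e)) * ennreal (s powr (e - 1))"
        by (simp add: ennreal_mult[symmetric] ennreal_leI)
      then show ?thesis using 2 by (simp add: add_increasing2)
    next
      case 3
      have "min (s / t) (t / s) powr e / s \<le> (t / s) powr e / s"
        using 3 t e by (intro divide_right_mono powr_mono2) auto
      also have "\<dots> = t powr e * s powr (- e - 1)"
        using 3 t by (simp add: powr_divide powr_minus powr_diff field_simps)
      finally have "ennreal (min (s / t) (t / s) powr e / s) \<le> ennreal (t powr e) * ennreal (s powr (- e - 1))"
        by (simp add: ennreal_mult[symmetric] ennreal_leI)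
      then show ?thesis using 3 by simp
    qed simp
  qed
  also have "\<dots> = ennreal (t powr (- e)) * ennreal (t powr e / e) + ennreal (t powr e) * ennreal (t powr (- e) / e)"
    using nn_integral_powr_Icc[of "e - 1" t] nn_integral_powr_atLeast[of "- e - 1" t] t e
    by (subst nn_integral_add) (auto simp: nn_integral_cmult)
  also have "\<dots> = ennreal (2 / e)"
    using t e by (simp add: ennreal_mult[symmetric] ennreal_plus[symmetric] powr_minus del: ennreal_plus)
  finally show ?thesis .
qed

lemma measurable_uncurried_comp:
  assumes "case_prod \<kappa> \<in> borel_measurable (M \<Otimes>\<^sub>M N)" "f \<in> measurable K M" "g \<in> measurable K N"
  shows "(\<lambda>x. \<kappa> (f x) (g x)) \<in> borel_measurable K"
  using measurable_compose[OF measurable_Pair[OF assms(2,3)] assms(1)] by simp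

text \<open>Schur's test for the operator with kernel \<open>\<integral>\<kappa> p y * \<kappa> q y \<partial>N\<close>, which is \<open>T T\<^sup>*\<close> for \<open>T\<close> with kernel \<open>\<kappa>\<close>.\<close>

lemma schur_TTstar:
  fixes \<kappa> :: "'p \<Rightarrow> 'y \<Rightarrow> real" and u :: "'p \<Rightarrow> real"
  assumes "finite_measure \<nu>" "sigma_finite_measure N"
    and [measurable]: "case_prod \<kappa> \<in> borel_measurable (\<nu> \<Otimes>\<^sub>M N)" "u \<in> borel_measurable \<nu>"
    and \<kappa>: "\<And>p y. \<bar>\<kappa> p y\<bar> \<le> H" "\<And>p. (\<integral>\<^sup>+y. ennreal \<bar>\<kappa> p y\<bar> \<partial>N) \<le> ennreal C" and C: "0 \<le> C"
    and u: "\<And>p. \<bar>u p\<bar> \<le> U"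
    and M: "\<And>p. p \<in> space \<nu> \<Longrightarrow> (\<integral>\<^sup>+q. ennreal \<bar>LINT y|N. \<kappa> p y * \<kappa> q y\<bar> \<partial>\<nu>) \<le> ennreal M" and M0: "0 \<le> M"
  shows "integrable N (\<lambda>y. (LINT p|\<nu>. u p * \<kappa> p y)\<^sup>2)"
    and "(LINT y|N. (LINT p|\<nu>. u p * \<kappa> p y)\<^sup>2) \<le> M * (LINT p|\<nu>. (u p)\<^sup>2)"
proof -
  interpret \<nu>: finite_measure \<nu> by fact
  interpret N: sigma_finite_measure N by fact
  interpret P: pair_sigma_finite \<nu> N ..
  interpret PP: pair_sigma_finite \<nu> \<nu> ..
  have H0: "0 \<le> H" using order_trans[OF abs_ge_zero \<kappa>(1)] .
  have U0: "0 \<le> U" using order_trans[OF abs_ge_zero u] .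
  note [measurable (raw)] = measurable_uncurried_comp[OF assms(3)]
  define h where "h y = (LINT p|\<nu>. u p * \<kappa> p y)" for y
  define G where "G p q = (LINT y|N. \<kappa> p y * \<kappa> q y)" for p q
  have [measurable]: "h \<in> borel_measurable N" unfolding h_def by measurable
  have Gm: "case_prod G \<in> borel_measurable (\<nu> \<Otimes>\<^sub>M \<nu>)" unfolding G_def by measurable
  then have [measurable]: "G p \<in> borel_measurable \<nu>" if "p \<in> space \<nu>" for p
    using that by (rule measurable_Pair2[where f="case_prod G", simplified])
  have uk: "\<bar>u p * \<kappa> p y\<bar> \<le> U * H" for p y
    unfolding abs_mult by (intro mult_mono u \<kappa> U0) auto
  have uk_int: "integrable \<nu> (\<lambda>p. u p * \<kappa> p y)" if "y \<in> space N" for y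
    using that uk by (intro \<nu>.integrable_const_bound[of _ "U * H"]) auto
  define V where "V = measure \<nu> (space \<nu>)"
  have V: "0 \<le> V" by (simp add: V_def)
  have h: "\<bar>h y\<bar> \<le> U * H * V" if "y \<in> space N" for y
  proof -
    have "\<bar>h y\<bar> \<le> (LINT p|\<nu>. \<bar>u p * \<kappa> p y\<bar>)" unfolding h_def by (rule integral_abs_bound)
    also have "\<dots> \<le> (LINT p|\<nu>. U * H)"
      using uk uk_int[OF that] by (intro integral_mono) auto
    finally show ?thesis by (simp add: V_def mult_ac)
  qed
  have \<kappa>_int: "integrable N (\<kappa> p)" if "p \<in> space \<nu>" for p
    using \<kappa>(2)[of p] that by (intro integrableI_bounded) (auto intro: order.strict_trans1)
  define B where "B = U * H * V"
  have B: "0 \<le> B" using U0 H0 V by (simp add: B_def)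
  \<comment> \<open>Absolute integrability for Fubini: \<open>u\<close> and \<open>h\<close> are
    bounded, \<kappa> is integrable in \<open>y\<close> uniformly in \<open>p\<close>, and \<nu> is
    finite.\<close>
  have F1: "integrable (\<nu> \<Otimes>\<^sub>M N) (\<lambda>(p, y). u p * \<kappa> p y * h y)"
  proof (rule integrableI_bounded)
    show "(\<lambda>(p, y). u p * \<kappa> p y * h y) \<in> borel_measurable (\<nu> \<Otimes>\<^sub>M N)" by measurable
    have "(\<integral>\<^sup>+x. ennreal (norm (case x of (p, y) \<Rightarrow> u p * \<kappa> p y * h y)) \<partial>(\<nu> \<Otimes>\<^sub>M N))
      = (\<integral>\<^sup>+p. \<integral>\<^sup>+y. ennreal (norm (u p * \<kappa> p y * h y)) \<partial>N \<partial>\<nu>)"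
      by (subst N.nn_integral_fst[symmetric]) auto
    also have "\<dots> \<le> (\<integral>\<^sup>+p. \<integral>\<^sup>+y. ennreal (U * B) * ennreal \<bar>\<kappa> p y\<bar> \<partial>N \<partial>\<nu>)"
    proof (intro nn_integral_mono)
      fix p y assume "y \<in> space N"
      then have "\<bar>u p\<bar> * \<bar>\<kappa> p y\<bar> * \<bar>h y\<bar> \<le> U * \<bar>\<kappa> p y\<bar> * B"
        using u[of p] h[of y] U0 by (intro mult_mono) (auto simp: B_def)
      then show "ennreal (norm (u p * \<kappa> p y * h y)) \<le> ennreal (U * B) * ennreal \<bar>\<kappa> p y\<bar>"
        using U0 B by (subst ennreal_mult[symmetric]) (auto intro!: ennreal_leI simp: abs_mult mult_ac)
    qed
    also have "\<dots> \<le> (\<integral>\<^sup>+p. ennreal (U * B) * ennreal C \<partial>\<nu>)"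
    proof (intro nn_integral_mono)
      fix p assume [measurable]: "p \<in> space \<nu>"
      have "(\<integral>\<^sup>+y. ennreal (U * B) * ennreal \<bar>\<kappa> p y\<bar> \<partial>N) = ennreal (U * B) * (\<integral>\<^sup>+y. ennreal \<bar>\<kappa> p y\<bar> \<partial>N)"
        by (rule nn_integral_cmult) measurable
      also have "\<dots> \<le> ennreal (U * B) * ennreal C" by (intro mult_left_mono \<kappa>) auto
      finally show "(\<integral>\<^sup>+y. ennreal (U * B) * ennreal \<bar>\<kappa> p y\<bar> \<partial>N) \<le> ennreal (U * B) * ennreal C" .
    qed
    also have "\<dots> < \<infinity>" by (simp add: ennreal_mult_eq_top_iff less_top[symmetric])
    finally show "(\<integral>\<^sup>+x. ennreal (norm (case x of (p, y) \<Rightarrow> u p * \<kappa> p y * h y)) \<partial>(\<nu> \<Otimes>\<^sub>M N)) < \<infinity>" .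
  qed
  \<comment> \<open>Only one factor \<open>h\<close> is unfolded here. The other is unfolded in
    \<open>inner\<close>, after the first exchange, so that each exchange concerns two variables
    only.\<close>
  have heq: "(h y)\<^sup>2 = (LINT p|\<nu>. u p * \<kappa> p y * h y)" for y
    by (simp add: power2_eq_square h_def)
  show "integrable N (\<lambda>y. (LINT p|\<nu>. u p * \<kappa> p y)\<^sup>2)"
    unfolding h_def[symmetric] heq by (rule P.integrable_snd[OF F1])
  have h2: "(LINT y|N. (h y)\<^sup>2) = (LINT p|\<nu>. LINT y|N. u p * \<kappa> p y * h y)"
    unfolding heq using P.Fubini_integral[OF F1] .
  have inner: "(LINT y|N. u p * \<kappa> p y * h y) = (LINT q|\<nu>. u p * (u q * G p q))" if p[measurable]: "p \<in> space \<nu>" for p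
  proof -
    have F2: "integrable (\<nu> \<Otimes>\<^sub>M N) (\<lambda>(q, y). \<kappa> p y * (u q * \<kappa> q y))"
    proof (rule integrableI_bounded)
      show "(\<lambda>(q, y). \<kappa> p y * (u q * \<kappa> q y)) \<in> borel_measurable (\<nu> \<Otimes>\<^sub>M N)" by measurable
      have "(\<integral>\<^sup>+x. ennreal (norm (case x of (q, y) \<Rightarrow> \<kappa> p y * (u q * \<kappa> q y))) \<partial>(\<nu> \<Otimes>\<^sub>M N))
        = (\<integral>\<^sup>+q. \<integral>\<^sup>+y. ennreal (norm (\<kappa> p y * (u q * \<kappa> q y))) \<partial>N \<partial>\<nu>)"
        by (subst N.nn_integral_fst[symmetric]) auto
      also have "\<dots> \<le> (\<integral>\<^sup>+q. \<integral>\<^sup>+y. ennreal (U * H) * ennreal \<bar>\<kappa> p y\<bar> \<partial>N \<partial>\<nu>)"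
      proof (intro nn_integral_mono)
        fix q y
        have "\<bar>\<kappa> p y\<bar> * \<bar>u q * \<kappa> q y\<bar> \<le> \<bar>\<kappa> p y\<bar> * (U * H)"
          using uk[of q y] by (intro mult_left_mono) auto
        then show "ennreal (norm (\<kappa> p y * (u q * \<kappa> q y))) \<le> ennreal (U * H) * ennreal \<bar>\<kappa> p y\<bar>"
          using U0 H0 by (subst ennreal_mult[symmetric]) (auto intro!: ennreal_leI simp: abs_mult mult_ac)
      qed
      also have "\<dots> = (\<integral>\<^sup>+q. ennreal (U * H) * (\<integral>\<^sup>+y. ennreal \<bar>\<kappa> p y\<bar> \<partial>N) \<partial>\<nu>)"
        by (intro nn_integral_cong nn_integral_cmult) measurable
      also have "\<dots> \<le> (\<integral>\<^sup>+q. ennreal (U * H) * ennreal C \<partial>\<nu>)"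
        by (intro nn_integral_mono mult_left_mono \<kappa>) auto
      also have "\<dots> < \<infinity>" by (simp add: ennreal_mult_eq_top_iff less_top[symmetric])
      finally show "(\<integral>\<^sup>+x. ennreal (norm (case x of (q, y) \<Rightarrow> \<kappa> p y * (u q * \<kappa> q y))) \<partial>(\<nu> \<Otimes>\<^sub>M N)) < \<infinity>" .
    qed
    have "(LINT y|N. u p * \<kappa> p y * h y) = u p * (LINT y|N. LINT q|\<nu>. \<kappa> p y * (u q * \<kappa> q y))"
      by (simp add: h_def mult.assoc)
    also have "\<dots> = u p * (LINT q|\<nu>. LINT y|N. \<kappa> p y * (u q * \<kappa> q y))"
      using P.Fubini_integral[OF F2] by simp
    also have "\<dots> = u p * (LINT q|\<nu>. u q * G p q)"
      by (simp add: G_def mult.left_commute)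
    finally show ?thesis by simp
  qed
  have Gsym: "G p q = G q p" for p q by (simp add: G_def mult.commute)
  define I where "I = (LINT p|\<nu>. (u p)\<^sup>2)"
  have u2: "(u p)\<^sup>2 \<le> U\<^sup>2" for p using power_mono[OF u[of p], of 2] by simp
  have I_int: "integrable \<nu> (\<lambda>p. (u p)\<^sup>2)"
    using u2 by (intro \<nu>.integrable_const_bound[of _ "U\<^sup>2"]) auto
  have nnI: "(\<integral>\<^sup>+p. ennreal ((u p)\<^sup>2) \<partial>\<nu>) = ennreal I"
    unfolding I_def by (rule nn_integral_eq_integral[OF I_int]) simp
  have I0: "0 \<le> I" by (simp add: I_def)
  let ?A = "\<integral>\<^sup>+p. \<integral>\<^sup>+q. ennreal ((u p)\<^sup>2) * ennreal \<bar>G p q\<bar> \<partial>\<nu> \<partial>\<nu>"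
  let ?B = "\<integral>\<^sup>+p. \<integral>\<^sup>+q. ennreal ((u q)\<^sup>2) * ennreal \<bar>G p q\<bar> \<partial>\<nu> \<partial>\<nu>"
  have half: "?A \<le> ennreal (M * I)"
  proof -
    have "?A \<le> (\<integral>\<^sup>+p. ennreal M * ennreal ((u p)\<^sup>2) \<partial>\<nu>)"
    proof (intro nn_integral_mono)
      fix p assume p[measurable]: "p \<in> space \<nu>"
      have "(\<integral>\<^sup>+q. ennreal ((u p)\<^sup>2) * ennreal \<bar>G p q\<bar> \<partial>\<nu>) = ennreal ((u p)\<^sup>2) * (\<integral>\<^sup>+q. ennreal \<bar>G p q\<bar> \<partial>\<nu>)"
        by (rule nn_integral_cmult) measurable
      also have "\<dots> \<le> ennreal ((u p)\<^sup>2) * ennreal M"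
        unfolding G_def by (intro mult_left_mono M p) auto
      finally show "(\<integral>\<^sup>+q. ennreal ((u p)\<^sup>2) * ennreal \<bar>G p q\<bar> \<partial>\<nu>) \<le> ennreal M * ennreal ((u p)\<^sup>2)"
        by (simp add: mult.commute)
    qed
    also have "\<dots> = ennreal (M * I)" using M0 I0 by (simp add: nn_integral_cmult nnI ennreal_mult)
    finally show ?thesis .
  qed
  \<comment> \<open>Symmetry of \<open>G\<close> lets the row bound serve for the columns.\<close>
  have half': "?B \<le> ennreal (M * I)"
  proof -
    have "?B = (\<integral>\<^sup>+q. \<integral>\<^sup>+p. ennreal ((u q)\<^sup>2) * ennreal \<bar>G p q\<bar> \<partial>\<nu> \<partial>\<nu>)"
      unfolding G_def by (intro PP.Fubini') measurable
    also have "\<dots> = ?A"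
      by (subst Gsym) simp
    finally show ?thesis using half by simp
  qed
  have "ennreal (LINT y|N. (h y)\<^sup>2) \<le> ennreal \<bar>LINT p|\<nu>. LINT q|\<nu>. u p * (u q * G p q)\<bar>"
    unfolding h2 using inner by (intro ennreal_leI) (simp cong: Bochner_Integration.integral_cong)
  also have "\<dots> \<le> (\<integral>\<^sup>+p. ennreal \<bar>LINT q|\<nu>. u p * (u q * G p q)\<bar> \<partial>\<nu>)"
    using integral_norm_bound_ennreal[of \<nu> "\<lambda>p. LINT q|\<nu>. u p * (u q * G p q)"]
    by (cases "integrable \<nu> (\<lambda>p. LINT q|\<nu>. u p * (u q * G p q))") (auto simp: not_integrable_integral_eq)
  also have "\<dots> \<le> (\<integral>\<^sup>+p. \<integral>\<^sup>+q. ennreal \<bar>u p * (u q * G p q)\<bar> \<partial>\<nu> \<partial>\<nu>)"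
  proof (rule nn_integral_mono)
    fix p
    show "ennreal \<bar>LINT q|\<nu>. u p * (u q * G p q)\<bar> \<le> (\<integral>\<^sup>+q. ennreal \<bar>u p * (u q * G p q)\<bar> \<partial>\<nu>)"
      using integral_norm_bound_ennreal[of \<nu> "\<lambda>q. u p * (u q * G p q)"]
      by (cases "integrable \<nu> (\<lambda>q. u p * (u q * G p q))") (auto simp: not_integrable_integral_eq)
  qed
  \<comment> \<open>The inequality between arithmetic and geometric mean separates
    \<open>u p\<close> from \<open>u q\<close>, so constant test weights suffice in Schur's
    test.\<close>
  also have "\<dots> \<le> (\<integral>\<^sup>+p. \<integral>\<^sup>+q. ennreal (1/2) * (ennreal ((u p)\<^sup>2) * ennreal \<bar>G p q\<bar> + ennreal ((u q)\<^sup>2) * ennreal \<bar>G p q\<bar>) \<partial>\<nu> \<partial>\<nu>)"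
  proof (intro nn_integral_mono)
    fix p q
    have "2 * (\<bar>u p\<bar> * \<bar>u q\<bar>) \<le> (u p)\<^sup>2 + (u q)\<^sup>2"
      using zero_le_power2[of "\<bar>u p\<bar> - \<bar>u q\<bar>"] by (simp add: power2_diff)
    then have "\<bar>u p\<bar> * \<bar>u q\<bar> * \<bar>G p q\<bar> \<le> (1/2 * ((u p)\<^sup>2 + (u q)\<^sup>2)) * \<bar>G p q\<bar>"
      by (intro mult_right_mono) auto
    then have "\<bar>u p * (u q * G p q)\<bar> \<le> 1/2 * ((u p)\<^sup>2 * \<bar>G p q\<bar> + (u q)\<^sup>2 * \<bar>G p q\<bar>)"
      by (simp add: abs_mult algebra_simps)
    then show "ennreal \<bar>u p * (u q * G p q)\<bar> \<le> ennreal (1/2) * (ennreal ((u p)\<^sup>2) * ennreal \<bar>G p q\<bar> + ennreal ((u q)\<^sup>2) * ennreal \<bar>G p q\<bar>)"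
      by (simp only: ennreal_mult[symmetric] ennreal_plus[symmetric] zero_le_power2 abs_ge_zero mult_nonneg_nonneg
        add_nonneg_nonneg ennreal_leI zero_le_divide_1_iff zero_le_numeral)
  qed
  also have "\<dots> = ennreal (1/2) * (?A + ?B)"
  proof -
    have "(\<integral>\<^sup>+p. \<integral>\<^sup>+q. ennreal (1/2) * (ennreal ((u p)\<^sup>2) * ennreal \<bar>G p q\<bar> + ennreal ((u q)\<^sup>2) * ennreal \<bar>G p q\<bar>) \<partial>\<nu> \<partial>\<nu>)
      = (\<integral>\<^sup>+p. ennreal (1/2) * ((\<integral>\<^sup>+q. ennreal ((u p)\<^sup>2) * ennreal \<bar>G p q\<bar> \<partial>\<nu>) + (\<integral>\<^sup>+q. ennreal ((u q)\<^sup>2) * ennreal \<bar>G p q\<bar> \<partial>\<nu>)) \<partial>\<nu>)"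
      by (intro nn_integral_cong, subst nn_integral_cmult, measurable, subst nn_integral_add) auto
    also have "\<dots> = ennreal (1/2) * (?A + ?B)"
      using Gm by (subst nn_integral_cmult, measurable, subst nn_integral_add) auto
    finally show ?thesis .
  qed
  also have "\<dots> \<le> ennreal (1/2) * (ennreal (M * I) + ennreal (M * I))"
    by (intro mult_left_mono add_mono half half') auto
  also have "\<dots> = ennreal (M * I)"
  proof -
    have half_sum: "ennreal (1/2) * (ennreal x + ennreal x) = ennreal x" if "0 \<le> x" for x
    proof -
      have "ennreal (1/2) * (ennreal x + ennreal x) = ennreal (1/2 * (x + x))"
        by (simp only: ennreal_plus[OF that that, symmetric] ennreal_mult[symmetric, of "1/2" "x + x"] that add_nonneg_nonneg)
      also have "1/2 * (x + x) = x" by simp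
      finally show ?thesis .
    qed
    show ?thesis by (rule half_sum) (use M0 I0 in simp)
  qed
  finally show "(LINT y|N. (LINT p|\<nu>. u p * \<kappa> p y)\<^sup>2) \<le> M * (LINT p|\<nu>. (u p)\<^sup>2)"
    using M0 I0 by (simp add: h_def I_def)
qed

subsection \<open>Almost orthogonality of square function kernels\<close>

text \<open>\<open>A\<close> is the constant that will vary with the functions, while
  \<open>a\<close>, \<open>e\<close> and \<open>S\<close> will be fixed by the multilinear kernel.
  In \<open>reg\<close> the centre is excluded for both points: by \<open>0 powr _ = 0\<close> the
  singular factor is missing exactly there. This costs null sets only.\<close>

locale square_kernel =
  fixes a e S A :: real and k :: "'a::euclidean_space \<times> real \<Rightarrow> 'a \<Rightarrow> real"
  assumes k_meas: "case_prod k \<in> borel_measurable ((lborel \<Otimes>\<^sub>M lborel) \<Otimes>\<^sub>M lborel)"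
    and e: "0 < e" "e < 1" "e < a" and A: "0 \<le> A" and S: "0 < S"
    and sing: "\<And>t z. 0 < t \<Longrightarrow> (\<integral>\<^sup>+y. ennreal (sing_wt e a t (z - y :: 'a)) \<partial>lborel) \<le> ennreal S"
    and size: "\<And>z t y. 0 < t \<Longrightarrow> \<bar>k (z, t) y\<bar> \<le> A * wt a t (z - y)"
    and reg: "\<And>z t y y'. 0 < t \<Longrightarrow> y \<noteq> z \<Longrightarrow> y' \<noteq> z \<Longrightarrow> \<bar>k (z, t) y - k (z, t) y'\<bar>
        \<le> A * (norm (y - y') / t) powr e * (sing_wt e a t (z - y) + sing_wt e a t (z - y'))"
    and canc: "\<And>z t. 0 < t \<Longrightarrow> (LINT y|lborel. k (z, t) y) = 0"
begin

text \<open>The exponent drops from \<open>a\<close> to \<open>a - e\<close> because this weight has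
  absorbed a Hoelder factor of order \<open>e\<close>; \<open>e < a\<close> keeps it
  integrable.\<close>

definition W :: real where "W = wt_const DIM('a) (a - e) * ubv DIM('a)"
definition W0 :: real where "W0 = wt_const DIM('a) a * ubv DIM('a)"

lemma a: "0 < a" using e by simp

lemma W_pos: "0 < W" using e wt_const_pos[of "a - e"] by (simp add: W_def)
lemma W0_pos: "0 < W0" using a wt_const_pos[of a] by (simp add: W0_def)

lemmas k_measurable [measurable (raw)] = measurable_uncurried_comp[OF k_meas]

lemma k_nn_integral: "0 < t \<Longrightarrow> (\<integral>\<^sup>+y. ennreal \<bar>k (z, t) y\<bar> \<partial>lborel) \<le> ennreal (A * W0)"
proof -
  assume t: "0 < t"
  have "(\<integral>\<^sup>+y. ennreal \<bar>k (z, t) y\<bar> \<partial>lborel) \<le> (\<integral>\<^sup>+y. ennreal A * ennreal (wt a t (z - y)) \<partial>lborel)"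
    using size[OF t] A t by (intro nn_integral_mono) (simp add: ennreal_mult[symmetric] ennreal_leI)
  also have "\<dots> = ennreal A * (\<integral>\<^sup>+y. ennreal (wt a t (z - y)) \<partial>lborel)"
    by (rule nn_integral_cmult) measurable
  also have "\<dots> \<le> ennreal A * ennreal W0"
    unfolding W0_def by (intro mult_left_mono nn_integral_wt_le t a) auto
  finally show ?thesis using A W0_pos by (simp add: ennreal_mult)
qed

lemma k_integrable: "0 < t \<Longrightarrow> integrable lborel (k (z, t))"
  by (rule integrableI_bounded) (auto intro: order.strict_trans1[OF k_nn_integral])

lemma k_bound: "0 < t \<Longrightarrow> \<bar>k (z, t) y\<bar> \<le> A / t ^ DIM('a)"
  using order_trans[OF size[of t z y] mult_left_mono[OF wt_le[of t a "z - y"] A]] a by simp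

lemma wt_times_powr:
  fixes v :: "'b::euclidean_space"
  assumes "0 < s" shows "wt a s v * (norm v / s) powr e \<le> wt (a - e) s v"
proof -
  define \<rho> where "\<rho> = norm v / s"
  have \<rho>: "0 \<le> \<rho>" using assms by (simp add: \<rho>_def)
  have "(1 + \<rho>) powr (- (real DIM('b) + a)) * \<rho> powr e \<le> (1 + \<rho>) powr (- (real DIM('b) + a)) * (1 + \<rho>) powr e"
    using \<rho> e by (intro mult_left_mono powr_mono2) auto
  also have "\<dots> = (1 + \<rho>) powr (- (real DIM('b) + (a - e)))"
    by (simp add: powr_add[symmetric] algebra_simps)
  finally show ?thesis using assms by (simp add: wt_def \<rho>_def divide_right_mono)
qed

text \<open>Cancellation of \<open>k (w, s)\<close> permits subtracting from \<open>k (z, t)\<close>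
  its value at \<open>w\<close>. Regularity at scale \<open>t\<close> then supplies
  \<open>(norm (y - w) / t) powr e\<close>, which is \<open>(s / t) powr e\<close> times a factor
  absorbed by the weight of scale \<open>s\<close>. This is a gain when
  \<open>s \<le> t\<close>.\<close>

lemma pairing_bound:
  assumes t: "0 < t" and s: "0 < s" and wz: "w \<noteq> z"
  shows "ennreal \<bar>LINT y|lborel. k (w, s) y * k (z, t) y\<bar>
    \<le> ennreal (A\<^sup>2 * (s / t) powr e) *
      (\<integral>\<^sup>+y. ennreal (wt (a - e) s (w - y)) * ennreal (sing_wt e a t (z - y) + sing_wt e a t (z - w)) \<partial>lborel)"
proof -
  have b: "\<bar>k (z, t) y\<bar> \<le> A / t ^ DIM('a)" for y by (rule k_bound[OF t])
  have int: "integrable lborel (\<lambda>y. k (w, s) y * k (z, t) y)"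
  proof (rule Bochner_Integration.integrable_bound)
    show "integrable lborel (\<lambda>y. A / t ^ DIM('a) * k (w, s) y)"
      using k_integrable[OF s] by simp
    show "AE y in lborel. norm (k (w, s) y * k (z, t) y) \<le> norm (A / t ^ DIM('a) * k (w, s) y)"
      using mult_right_mono[OF b abs_ge_zero] A t by (simp add: abs_mult mult.commute)
  qed measurable
  have "(LINT y|lborel. k (w, s) y * k (z, t) y) = (LINT y|lborel. k (w, s) y * (k (z, t) y - k (z, t) w))"
    using int k_integrable[OF s] canc[OF s] by (simp add: right_diff_distrib)
  then have "ennreal \<bar>LINT y|lborel. k (w, s) y * k (z, t) y\<bar> = ennreal (norm (LINT y|lborel. k (w, s) y * (k (z, t) y - k (z, t) w)))"
    by simp
  also have "\<dots> \<le> (\<integral>\<^sup>+y. ennreal (norm (k (w, s) y * (k (z, t) y - k (z, t) w))) \<partial>lborel)"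
    using int k_integrable[OF s] by (intro integral_norm_bound_ennreal) (simp add: right_diff_distrib)
  also have "\<dots> \<le> (\<integral>\<^sup>+y. ennreal (A\<^sup>2 * (s / t) powr e) * (ennreal (wt (a - e) s (w - y)) * ennreal (sing_wt e a t (z - y) + sing_wt e a t (z - w))) \<partial>lborel)"
  proof (rule nn_integral_mono_AE)
    \<comment> \<open>The point \<open>y = z\<close> is not covered by \<open>reg\<close>.\<close>
    show "AE y in lborel. ennreal (norm (k (w, s) y * (k (z, t) y - k (z, t) w)))
      \<le> ennreal (A\<^sup>2 * (s / t) powr e) * (ennreal (wt (a - e) s (w - y)) * ennreal (sing_wt e a t (z - y) + sing_wt e a t (z - w)))"
      using AE_lborel_singleton[of z]
    proof eventually_elim
      case (elim y)
      define g where "g = sing_wt e a t (z - y) + sing_wt e a t (z - w)"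
      have g: "0 \<le> g" using t by (simp add: g_def)
      have "\<bar>k (w, s) y\<bar> * \<bar>k (z, t) y - k (z, t) w\<bar> \<le> (A * wt a s (w - y)) * (A * (norm (y - w) / t) powr e * g)"
        unfolding g_def using size[OF s] reg[OF t elim wz] A s by (intro mult_mono) auto
      also have "(norm (y - w) / t) powr e = (s / t) powr e * (norm (w - y) / s) powr e"
        using s t by (simp add: powr_divide norm_minus_commute)
      also have "A * wt a s (w - y) * (A * ((s / t) powr e * (norm (w - y) / s) powr e) * g)
         = A\<^sup>2 * (s / t) powr e * g * (wt a s (w - y) * (norm (w - y) / s) powr e)"
        by (simp add: power2_eq_square mult_ac)
      also have "\<dots> \<le> A\<^sup>2 * (s / t) powr e * g * wt (a - e) s (w - y)"
        using g by (intro mult_left_mono wt_times_powr s) auto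
      finally have "norm (k (w, s) y * (k (z, t) y - k (z, t) w)) \<le> A\<^sup>2 * (s / t) powr e * (wt (a - e) s (w - y) * g)"
        by (simp add: abs_mult mult_ac)
      then show ?case unfolding g_def[symmetric]
        using g s by (simp add: ennreal_mult[symmetric] ennreal_leI)
    qed
  qed
  also have "\<dots> = ennreal (A\<^sup>2 * (s / t) powr e) *
      (\<integral>\<^sup>+y. ennreal (wt (a - e) s (w - y)) * ennreal (sing_wt e a t (z - y) + sing_wt e a t (z - w)) \<partial>lborel)"
    by (rule nn_integral_cmult) measurable
  finally show ?thesis .
qed

text \<open>Two versions, since the integration variable \<open>w\<close> may belong to the kernel
  whose cancellation is used or to the one whose regularity is used. In both, the order of
  integration is arranged so that each inner integral is the mass of a single weight or of a sum of
  two.\<close>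

lemma double_wt_sing:
  fixes z :: 'a
  assumes t: "0 < t" and s: "0 < s"
  shows "(\<integral>\<^sup>+w. \<integral>\<^sup>+y. ennreal (wt (a - e) s (w - y)) * ennreal (sing_wt e a t (z - y) + sing_wt e a t (z - w)) \<partial>lborel \<partial>lborel)
     \<le> ennreal (2 * W * S)"
    and "(\<integral>\<^sup>+w. \<integral>\<^sup>+y. ennreal (wt (a - e) s (z - y)) * ennreal (sing_wt e a t (w - y) + sing_wt e a t (w - z)) \<partial>lborel \<partial>lborel)
     \<le> ennreal (2 * W * S)"
proof -
  have Wle: "(\<integral>\<^sup>+y. ennreal (wt (a - e) s (w - y :: 'a)) \<partial>lborel) \<le> ennreal W" for w
    unfolding W_def using e s by (intro nn_integral_wt_le) auto
  have Wle': "(\<integral>\<^sup>+w. ennreal (wt (a - e) s (w - y :: 'a)) \<partial>lborel) \<le> ennreal W" for y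
    using Wle[of y] by (simp add: wt_commute)
  have Sle': "(\<integral>\<^sup>+w. ennreal (sing_wt e a t (w - y :: 'a)) \<partial>lborel) \<le> ennreal S" for y
    using sing[OF t, of y] by (simp add: sing_wt_commute)
  have WS: "ennreal W * ennreal S + ennreal W * ennreal S = ennreal (2 * W * S)"
    using W_pos S by (simp add: ennreal_mult[symmetric] ennreal_plus[symmetric] del: ennreal_plus)
  let ?w = "\<lambda>v. ennreal (wt (a - e) s (v :: 'a))" and ?g = "\<lambda>v. ennreal (sing_wt e a t (v :: 'a))"
  have "(\<integral>\<^sup>+w. \<integral>\<^sup>+y. ?w (w - y) * ?g (z - y) \<partial>lborel \<partial>lborel) = (\<integral>\<^sup>+y. \<integral>\<^sup>+w. ?w (w - y) * ?g (z - y) \<partial>lborel \<partial>lborel)"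
    by (rule lborel_pair.Fubini') measurable
  also have "\<dots> = (\<integral>\<^sup>+y. (\<integral>\<^sup>+w. ?w (w - y) \<partial>lborel) * ?g (z - y) \<partial>lborel)"
    by (intro nn_integral_cong nn_integral_multc) measurable
  also have "\<dots> \<le> (\<integral>\<^sup>+y. ennreal W * ?g (z - y) \<partial>lborel)"
    by (intro nn_integral_mono mult_right_mono Wle') auto
  also have "\<dots> = ennreal W * (\<integral>\<^sup>+y. ?g (z - y) \<partial>lborel)"
    by (rule nn_integral_cmult) measurable
  also have "\<dots> \<le> ennreal W * ennreal S" by (intro mult_left_mono sing t) auto
  finally have 1: "(\<integral>\<^sup>+w. \<integral>\<^sup>+y. ?w (w - y) * ?g (z - y) \<partial>lborel \<partial>lborel) \<le> ennreal W * ennreal S" .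
  have "(\<integral>\<^sup>+w. \<integral>\<^sup>+y. ?g (z - w) * ?w (w - y) \<partial>lborel \<partial>lborel) = (\<integral>\<^sup>+w. ?g (z - w) * (\<integral>\<^sup>+y. ?w (w - y) \<partial>lborel) \<partial>lborel)"
    by (intro nn_integral_cong nn_integral_cmult) measurable
  also have "\<dots> \<le> (\<integral>\<^sup>+w. ?g (z - w) * ennreal W \<partial>lborel)"
    by (intro nn_integral_mono mult_left_mono Wle) auto
  also have "\<dots> = (\<integral>\<^sup>+w. ?g (z - w) \<partial>lborel) * ennreal W"
    by (rule nn_integral_multc) measurable
  also have "\<dots> \<le> ennreal S * ennreal W" by (intro mult_right_mono sing t) auto
  finally have 2: "(\<integral>\<^sup>+w. \<integral>\<^sup>+y. ?g (z - w) * ?w (w - y) \<partial>lborel \<partial>lborel) \<le> ennreal S * ennreal W" .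
  have "(\<integral>\<^sup>+w. \<integral>\<^sup>+y. ?w (w - y) * ennreal (sing_wt e a t (z - y) + sing_wt e a t (z - w)) \<partial>lborel \<partial>lborel)
    = (\<integral>\<^sup>+w. (\<integral>\<^sup>+y. ?w (w - y) * ?g (z - y) \<partial>lborel) + (\<integral>\<^sup>+y. ?g (z - w) * ?w (w - y) \<partial>lborel) \<partial>lborel)"
    by (subst nn_integral_add[symmetric]) (measurable, use t in \<open>auto simp: distrib_left mult.commute\<close>)
  also have "\<dots> = (\<integral>\<^sup>+w. \<integral>\<^sup>+y. ?w (w - y) * ?g (z - y) \<partial>lborel \<partial>lborel) + (\<integral>\<^sup>+w. \<integral>\<^sup>+y. ?g (z - w) * ?w (w - y) \<partial>lborel \<partial>lborel)"
    by (rule nn_integral_add) measurable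
  also have "\<dots> \<le> ennreal W * ennreal S + ennreal S * ennreal W" by (intro add_mono 1 2)
  finally show "(\<integral>\<^sup>+w. \<integral>\<^sup>+y. ?w (w - y) * ennreal (sing_wt e a t (z - y) + sing_wt e a t (z - w)) \<partial>lborel \<partial>lborel)
     \<le> ennreal (2 * W * S)" by (simp only: WS[symmetric] mult.commute[of "ennreal S"])
  have "(\<integral>\<^sup>+w. \<integral>\<^sup>+y. ?w (z - y) * ennreal (sing_wt e a t (w - y) + sing_wt e a t (w - z)) \<partial>lborel \<partial>lborel)
    = (\<integral>\<^sup>+y. \<integral>\<^sup>+w. ?w (z - y) * ennreal (sing_wt e a t (w - y) + sing_wt e a t (w - z)) \<partial>lborel \<partial>lborel)"
    by (rule lborel_pair.Fubini') measurable
  also have "\<dots> = (\<integral>\<^sup>+y. ?w (z - y) * (\<integral>\<^sup>+w. ?g (w - y) + ?g (w - z) \<partial>lborel) \<partial>lborel)"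
    by (subst nn_integral_cmult[symmetric]) (measurable, use t in \<open>simp\<close>)
  also have "\<dots> = (\<integral>\<^sup>+y. ?w (z - y) * ((\<integral>\<^sup>+w. ?g (w - y) \<partial>lborel) + (\<integral>\<^sup>+w. ?g (w - z) \<partial>lborel)) \<partial>lborel)"
    by (subst nn_integral_add) measurable
  also have "\<dots> \<le> (\<integral>\<^sup>+y. ?w (z - y) * (ennreal S + ennreal S) \<partial>lborel)"
    by (intro nn_integral_mono mult_left_mono add_mono Sle') auto
  also have "\<dots> = (\<integral>\<^sup>+y. ?w (z - y) \<partial>lborel) * (ennreal S + ennreal S)"
    by (rule nn_integral_multc) measurable
  also have "\<dots> \<le> ennreal W * (ennreal S + ennreal S)" by (intro mult_right_mono Wle) auto
  also have "\<dots> = ennreal (2 * W * S)" by (simp add: WS[symmetric] distrib_left)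
  finally show "(\<integral>\<^sup>+w. \<integral>\<^sup>+y. ?w (z - y) * ennreal (sing_wt e a t (w - y) + sing_wt e a t (w - z)) \<partial>lborel \<partial>lborel)
     \<le> ennreal (2 * W * S)" .
qed

text \<open>Cancellation is taken from the kernel of smaller scale and regularity from the other
  one; the pairing is symmetric, so both cases come from \<open>pairing_bound\<close>.\<close>

lemma almost_orthogonal:
  assumes t: "0 < t" and s: "0 < s"
  shows "(\<integral>\<^sup>+w. ennreal \<bar>LINT y|lborel. k (z, t) y * k (w, s) y\<bar> \<partial>lborel)
     \<le> ennreal (2 * W * S * A\<^sup>2 * min (s / t) (t / s) powr e)"
proof (cases "s \<le> t")
  case True
  have "(\<integral>\<^sup>+w. ennreal \<bar>LINT y|lborel. k (z, t) y * k (w, s) y\<bar> \<partial>lborel)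
    \<le> (\<integral>\<^sup>+w. ennreal (A\<^sup>2 * (s / t) powr e) *
      (\<integral>\<^sup>+y. ennreal (wt (a - e) s (w - y)) * ennreal (sing_wt e a t (z - y) + sing_wt e a t (z - w)) \<partial>lborel) \<partial>lborel)"
    using AE_lborel_singleton[of z] pairing_bound[OF t s]
    by (intro nn_integral_mono_AE) (auto simp: mult.commute[of "k (z, t) _"])
  also have "\<dots> = ennreal (A\<^sup>2 * (s / t) powr e) *
      (\<integral>\<^sup>+w. \<integral>\<^sup>+y. ennreal (wt (a - e) s (w - y)) * ennreal (sing_wt e a t (z - y) + sing_wt e a t (z - w)) \<partial>lborel \<partial>lborel)"
    by (rule nn_integral_cmult) measurable
  also have "\<dots> \<le> ennreal (A\<^sup>2 * (s / t) powr e) * ennreal (2 * W * S)"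
    by (intro mult_left_mono double_wt_sing t s) auto
  also have "\<dots> = ennreal (2 * W * S * A\<^sup>2 * (s / t) powr e)"
    using W_pos S by (simp add: ennreal_mult[symmetric] mult_ac)
  also have "s / t = min (s / t) (t / s)"
  proof -
    have "s / t \<le> 1" "1 \<le> t / s" using True s t by auto
    then show ?thesis by simp
  qed
  finally show ?thesis .
next
  case False
  have "(\<integral>\<^sup>+w. ennreal \<bar>LINT y|lborel. k (z, t) y * k (w, s) y\<bar> \<partial>lborel)
    \<le> (\<integral>\<^sup>+w. ennreal (A\<^sup>2 * (t / s) powr e) *
      (\<integral>\<^sup>+y. ennreal (wt (a - e) t (z - y)) * ennreal (sing_wt e a s (w - y) + sing_wt e a s (w - z)) \<partial>lborel) \<partial>lborel)"
    using AE_lborel_singleton[of z] pairing_bound[OF s t]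
    by (intro nn_integral_mono_AE) auto
  also have "\<dots> = ennreal (A\<^sup>2 * (t / s) powr e) *
      (\<integral>\<^sup>+w. \<integral>\<^sup>+y. ennreal (wt (a - e) t (z - y)) * ennreal (sing_wt e a s (w - y) + sing_wt e a s (w - z)) \<partial>lborel \<partial>lborel)"
    by (rule nn_integral_cmult) measurable
  also have "\<dots> \<le> ennreal (A\<^sup>2 * (t / s) powr e) * ennreal (2 * W * S)"
    by (intro mult_left_mono double_wt_sing t s) auto
  also have "\<dots> = ennreal (2 * W * S * A\<^sup>2 * (t / s) powr e)"
    using W_pos S by (simp add: ennreal_mult[symmetric] mult_ac)
  also have "t / s = min (s / t) (t / s)"
  proof -
    have "t / s \<le> 1" "1 \<le> s / t" using False s t by auto
    then show ?thesis by simp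
  qed
  finally show ?thesis .
qed

text \<open>Integration in \<open>w\<close> leaves a power of the ratio of the scales, and
  integration against \<open>ds / s\<close> costs \<open>2 / e\<close>. This is the row bound for
  Schur's test on the half space with measure \<open>dw ds / s\<close>.\<close>

lemma schur_bound:
  assumes t: "0 < t"
  shows "(\<integral>\<^sup>+q. ennreal (indicator {0<..} (snd q) / snd q) * ennreal \<bar>LINT y|lborel. k (z, t) y * k q y\<bar> \<partial>(lborel \<Otimes>\<^sub>M lborel))
     \<le> ennreal (4 * W * S * A\<^sup>2 / e)"
proof -
  have "(\<integral>\<^sup>+q. ennreal (indicator {0<..} (snd q) / snd q) * ennreal \<bar>LINT y|lborel. k (z, t) y * k q y\<bar> \<partial>(lborel \<Otimes>\<^sub>M lborel))
    = (\<integral>\<^sup>+s. \<integral>\<^sup>+w. ennreal (indicator {0<..} s / s) * ennreal \<bar>LINT y|lborel. k (z, t) y * k (w, s) y\<bar> \<partial>lborel \<partial>lborel)"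
  proof -
    have [measurable]: "(\<lambda>q. LINT y|lborel. k (z, t) y * k q y) \<in> borel_measurable (lborel \<Otimes>\<^sub>M lborel)"
      by measurable
    have [measurable]: "(\<lambda>q :: 'a \<times> real. indicator {0<..} (snd q) / snd q :: real) \<in> borel_measurable (lborel \<Otimes>\<^sub>M lborel)"
      by measurable
    have [measurable]: "(\<lambda>q. ennreal (indicator {0<..} (snd q) / snd q) * ennreal \<bar>LINT y|lborel. k (z, t) y * k q y\<bar>) \<in> borel_measurable (lborel \<Otimes>\<^sub>M lborel)"
      by measurable
    show ?thesis
      by (subst lborel_pair.nn_integral_snd[symmetric]) simp_all
  qed
  also have "\<dots> \<le> (\<integral>\<^sup>+s. ennreal (2 * W * S * A\<^sup>2) * (ennreal (min (s / t) (t / s) powr e / s) * indicator {0<..} s) \<partial>lborel)"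
  proof (rule nn_integral_mono)
    fix s :: real
    show "(\<integral>\<^sup>+w. ennreal (indicator {0<..} s / s) * ennreal \<bar>LINT y|lborel. k (z, t) y * k (w, s) y\<bar> \<partial>lborel)
      \<le> ennreal (2 * W * S * A\<^sup>2) * (ennreal (min (s / t) (t / s) powr e / s) * indicator {0<..} s)"
    proof (cases "0 < s")
      case s: True
      have "(\<integral>\<^sup>+w. ennreal (indicator {0<..} s / s) * ennreal \<bar>LINT y|lborel. k (z, t) y * k (w, s) y\<bar> \<partial>lborel)
        = ennreal (1 / s) * (\<integral>\<^sup>+w. ennreal \<bar>LINT y|lborel. k (z, t) y * k (w, s) y\<bar> \<partial>lborel)"
        by (subst nn_integral_cmult) (measurable, use s in \<open>simp\<close>)
      also have "\<dots> \<le> ennreal (1 / s) * ennreal (2 * W * S * A\<^sup>2 * min (s / t) (t / s) powr e)"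
        by (intro mult_left_mono almost_orthogonal t s) auto
      also have "\<dots> = ennreal (2 * W * S * A\<^sup>2) * (ennreal (min (s / t) (t / s) powr e / s) * indicator {0<..} s)"
        using s W_pos S by (simp add: ennreal_mult[symmetric] mult_ac)
      finally show ?thesis .
    qed simp
  qed
  also have "\<dots> = ennreal (2 * W * S * A\<^sup>2) * (\<integral>\<^sup>+s. ennreal (min (s / t) (t / s) powr e / s) * indicator {0<..} s \<partial>lborel)"
    by (rule nn_integral_cmult) measurable
  also have "\<dots> \<le> ennreal (2 * W * S * A\<^sup>2) * ennreal (2 / e)"
    using e by (intro mult_left_mono nn_integral_scale_min_powr t) auto
  also have "\<dots> = ennreal (4 * W * S * A\<^sup>2 / e)"
    using W_pos S e by (simp add: ennreal_mult[symmetric] mult_ac)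
  finally show ?thesis .
qed

end

subsection \<open>Carleson estimate in the linear case\<close>

context square_kernel
begin

context
  fixes f :: "'a \<Rightarrow> real" and b :: real
  assumes bmo: "bmo_le f b"
begin

lemma f_meas [measurable]: "f \<in> borel_measurable borel"
  using bmo by (simp add: bmo_le_def loc_int_measurable)

lemma k_times_nn_integral:
  assumes t: "0 < t"
  shows "(\<integral>\<^sup>+y. ennreal \<bar>k (z, t) y * (f y - c)\<bar> \<partial>lborel)
    \<le> ennreal (A * (W0 * (2 ^ DIM('a) * b + \<bar>avg_ball f z t - c\<bar>)))"
proof -
  have "(\<integral>\<^sup>+y. ennreal \<bar>k (z, t) y * (f y - c)\<bar> \<partial>lborel) \<le> (\<integral>\<^sup>+y. ennreal A * (ennreal (wt a t (z - y)) * ennreal \<bar>f y - c\<bar>) \<partial>lborel)"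
  proof (rule nn_integral_mono)
    fix y
    have "\<bar>k (z, t) y * (f y - c)\<bar> \<le> A * (wt a t (z - y) * \<bar>f y - c\<bar>)"
      using mult_right_mono[OF size[OF t, of z y] abs_ge_zero[of "f y - c"]] by (simp add: abs_mult mult.assoc)
    then show "ennreal \<bar>k (z, t) y * (f y - c)\<bar> \<le> ennreal A * (ennreal (wt a t (z - y)) * ennreal \<bar>f y - c\<bar>)"
      using A t by (simp add: ennreal_mult[symmetric] ennreal_leI)
  qed
  also have "\<dots> = ennreal A * (\<integral>\<^sup>+y. ennreal (wt a t (z - y)) * ennreal \<bar>f y - c\<bar> \<partial>lborel)"
    by (rule nn_integral_cmult) measurable
  also have "\<dots> \<le> ennreal A * ennreal (W0 * (2 ^ DIM('a) * b + \<bar>avg_ball f z t - c\<bar>))"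
    unfolding W0_def by (intro mult_left_mono bmo_wt_integral_const bmo t a) auto
  finally show ?thesis using A W0_pos bmo_le_nonneg[OF bmo] by (simp add: ennreal_mult)
qed

lemma k_times_integrable: "0 < t \<Longrightarrow> integrable lborel (\<lambda>y. k (z, t) y * (f y - c))"
  by (rule integrableI_bounded) (auto intro: order.strict_trans1[OF k_times_nn_integral])

lemma k_times_shift:
  assumes t: "0 < t"
  shows "(LINT y|lborel. k (z, t) y * f y) = (LINT y|lborel. k (z, t) y * (f y - c))"
proof -
  have "(LINT y|lborel. k (z, t) y * f y) = (LINT y|lborel. k (z, t) y * (f y - c) + c * k (z, t) y)"
    by (simp add: algebra_simps)
  also have "\<dots> = (LINT y|lborel. k (z, t) y * (f y - c))"
    using k_times_integrable[OF t] k_integrable[OF t] canc[OF t] by simp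
  finally show ?thesis .
qed

text \<open>The subtracted constant is the mean over the ball with exactly the centre and scale of
  the kernel, so no term from comparing means survives.\<close>

lemma transform_bound:
  assumes t: "0 < t"
  shows "\<bar>LINT y|lborel. k (z, t) y * f y\<bar> \<le> A * (W0 * (2 ^ DIM('a) * b))"
proof -
  let ?c = "avg_ball f z t"
  have "ennreal \<bar>LINT y|lborel. k (z, t) y * f y\<bar> = ennreal (norm (LINT y|lborel. k (z, t) y * (f y - ?c)))"
    using k_times_shift[OF t, of z ?c] by simp
  also have "\<dots> \<le> (\<integral>\<^sup>+y. ennreal (norm (k (z, t) y * (f y - ?c))) \<partial>lborel)"
    by (intro integral_norm_bound_ennreal k_times_integrable t)
  also have "\<dots> \<le> ennreal (A * (W0 * (2 ^ DIM('a) * b)))"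
    using k_times_nn_integral[OF t, of z ?c] by simp
  finally show ?thesis
    using A W0_pos bmo_le_nonneg[OF bmo] by simp
qed

text \<open>The factor of \<open>b\<close> in \<open>bmo_duality\<close>, apart from the square
  roots of the volume and of the integral of \<open>(h y)\<^sup>2\<close>.\<close>

definition J_const :: real where
  "J_const = sqrt (64 * 2 ^ DIM('a)) * (ubv DIM('a) * real (DIM('a) + 1) ^ DIM('a))"

text \<open>The factor of \<open>b * (t / r) powr a\<close> in \<open>bmo_far\<close> for
  \<open>R = 8 * (DIM('a) + 1) * r\<close>.\<close>

definition F_const :: real where
  "F_const = 2 powr (real DIM('a) + a) * W0 * (2 ^ DIM('a) + (8 * real (DIM('a) + 1)) ^ DIM('a))"

text \<open>The outer 2 comes from absorbing half of the energy. In the near term,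
  \<open>8 ^ DIM('a)\<close> belongs to a cube of side \<open>8 * r\<close> and the last factor is
  the Schur bound without \<open>A\<^sup>2\<close>. In the far term, \<open>1 / (2 * a)\<close> is
  the integral of \<open>(t / r) powr (2 * a)\<close> against \<open>dt / t\<close> over
  \<open>0 < t \<le> r\<close>, and the remaining factors are the volume of a ball of radius
  2.\<close>

definition carleson_const :: real where
  "carleson_const = 2 * (J_const\<^sup>2 * 8 ^ DIM('a) * (4 * W * S / e) + F_const\<^sup>2 * (ubv DIM('a) * 2 ^ DIM('a) / (2 * a)))"

text \<open>The energy \<open>I\<close> of the truncated transform \<open>u\<close> is the pairing
  of \<open>u\<close> with the transform of \<open>f - c\<close>. For the part of
  \<open>f - c\<close> on a large cube the pairing is moved to the adjoint side, where
  \<open>bmo_duality\<close> and Schur's test give a multiple of \<open>sqrt I\<close>; off the cube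
  the kernel is small. The cutoff \<eta> makes every quantity finite, so that \<open>I\<close> can
  be absorbed.\<close>

lemma carleson_truncated:
  assumes b: "0 < b" and r: "0 < r" and \<eta>: "0 < \<eta>"
  shows "(\<integral>\<^sup>+p. indicator (ball x0 (2 * r) \<times> {\<eta>..r}) p * ennreal ((LINT y|lborel. k p y * f y)\<^sup>2 / snd p) \<partial>(lborel \<Otimes>\<^sub>M lborel))
     \<le> ennreal (carleson_const * A\<^sup>2 * b\<^sup>2 * r ^ DIM('a))"
proof -
  let ?n = "DIM('a)"
  define E where "E = ball x0 (2 * r) \<times> {\<eta>..r}"
  have E[measurable]: "E \<in> sets (lborel \<Otimes>\<^sub>M lborel)" unfolding E_def by measurable
  have [measurable, simp]: "p \<in> space (lborel \<Otimes>\<^sub>M lborel)" for p :: "'a \<times> real"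
    by (simp add: space_pair_measure)
  have Et: "0 < t" "\<eta> \<le> t" "t \<le> r" "dist z x0 < 2 * r" if "(z, t) \<in> E" for z t
    using that \<eta> by (auto simp: E_def dist_commute)
  \<comment> \<open>The density of \<open>dz dt / t\<close> on \<open>E\<close>, matching the
    measure in \<open>schur_bound\<close>.\<close>
  define \<rho> :: "'a \<times> real \<Rightarrow> real" where "\<rho> p = indicator E p / snd p" for p
  have \<rho>0: "0 \<le> \<rho> p" for p using Et(1)[of "fst p" "snd p"] by (auto simp: \<rho>_def indicator_def)
  have [measurable]: "\<rho> \<in> borel_measurable (lborel \<Otimes>\<^sub>M lborel)" unfolding \<rho>_def by measurable
  define \<nu> where "\<nu> = density (lborel \<Otimes>\<^sub>M lborel) (\<lambda>p. ennreal (\<rho> p))"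
  have [measurable_cong]: "sets \<nu> = sets (lborel \<Otimes>\<^sub>M lborel)" by (simp add: \<nu>_def)
  have sp: "space \<nu> = UNIV" by (simp add: \<nu>_def space_pair_measure)
  have nn\<nu>: "(\<integral>\<^sup>+p. g p \<partial>\<nu>) = (\<integral>\<^sup>+p. ennreal (\<rho> p) * g p \<partial>(lborel \<Otimes>\<^sub>M lborel))"
    if [measurable]: "g \<in> borel_measurable (lborel \<Otimes>\<^sub>M lborel)" for g
    unfolding \<nu>_def by (rule nn_integral_density) measurable
  define m0 where "m0 = 1 / \<eta> * (ubv ?n * (2 * r) ^ ?n * r)"
  have m0: "0 \<le> m0" using \<eta> r by (simp add: m0_def)
  have em\<nu>: "emeasure \<nu> (space \<nu>) \<le> ennreal m0"
  proof -
    have "emeasure \<nu> (space \<nu>) = (\<integral>\<^sup>+p. 1 \<partial>\<nu>)" by simp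
    also have "\<dots> = (\<integral>\<^sup>+p. ennreal (\<rho> p) * 1 \<partial>(lborel \<Otimes>\<^sub>M lborel))" by (rule nn\<nu>) simp
    also have "\<dots> \<le> (\<integral>\<^sup>+p. ennreal (1 / \<eta>) * indicator (ball x0 (2 * r) \<times> {0..r}) p \<partial>(lborel \<Otimes>\<^sub>M lborel))"
    proof (rule nn_integral_mono)
      fix p :: "'a \<times> real"
      show "ennreal (\<rho> p) * 1 \<le> ennreal (1 / \<eta>) * indicator (ball x0 (2 * r) \<times> {0..r}) p"
      proof (cases "p \<in> E")
        case True
        have "p \<in> ball x0 (2 * r) \<times> {0..r}" using True \<eta> by (auto simp: E_def)
        moreover have "\<rho> p \<le> 1 / \<eta>" using True Et[of "fst p" "snd p"] \<eta> by (auto simp: \<rho>_def intro!: divide_left_mono)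
        ultimately show ?thesis by (simp add: ennreal_leI)
      qed (simp add: \<rho>_def)
    qed
    also have "\<dots> = ennreal (1 / \<eta>) * (emeasure lborel (ball x0 (2 * r)) * emeasure lborel {0..r})"
      by (subst nn_integral_cmult_indicator) (auto simp: lborel.emeasure_pair_measure_Times)
    also have "\<dots> = ennreal m0"
      using r \<eta> by (simp add: emeasure_ball ennreal_mult[symmetric] m0_def)
    finally show ?thesis .
  qed
  interpret \<nu>: finite_measure \<nu>
    using em\<nu> by (intro finite_measureI) (auto simp: top_unique)
  interpret P: pair_sigma_finite \<nu> lborel ..
  have m\<nu>: "measure \<nu> (space \<nu>) \<le> m0"
    using em\<nu> m0 by (simp add: measure_def enn2real_leI)
  define U where "U p = (LINT y|lborel. k p y * f y)" for p
  have [measurable]: "U \<in> borel_measurable (lborel \<Otimes>\<^sub>M lborel)" unfolding U_def by measurable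
  define u where "u p = indicator E p * U p" for p
  have [measurable]: "u \<in> borel_measurable (lborel \<Otimes>\<^sub>M lborel)" unfolding u_def by measurable
  define \<kappa> where "\<kappa> p y = indicator E p * k p y" for p y
  have "case_prod \<kappa> \<in> borel_measurable ((lborel \<Otimes>\<^sub>M lborel) \<Otimes>\<^sub>M lborel)"
    unfolding \<kappa>_def by measurable
  note [measurable (raw)] = measurable_uncurried_comp[OF this]
  define B where "B = A * (W0 * (2 ^ ?n * b))"
  have B: "0 \<le> B" using A W0_pos b by (simp add: B_def)
  have u_le: "\<bar>u p\<bar> \<le> B" for p
    using transform_bound[of "snd p" "fst p"] Et(1)[of "fst p" "snd p"] B by (auto simp: u_def U_def B_def indicator_def)
  define H where "H = A / \<eta> ^ ?n"
  have H: "0 \<le> H" using A \<eta> by (simp add: H_def)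
  have \<kappa>_le: "\<bar>\<kappa> p y\<bar> \<le> H" for p y
  proof (cases "p \<in> E")
    case True
    obtain z t where p: "p = (z, t)" by (cases p)
    have t: "0 < t" "\<eta> \<le> t" using Et[of z t] True p by auto
    have "\<bar>k p y\<bar> \<le> A / t ^ ?n" using k_bound[OF t(1)] p by simp
    also have "\<dots> \<le> H" unfolding H_def using A \<eta> t by (intro divide_left_mono power_mono) auto
    finally show ?thesis using True by (simp add: \<kappa>_def)
  qed (use H in \<open>simp add: \<kappa>_def\<close>)
  have \<kappa>_nn: "(\<integral>\<^sup>+y. ennreal \<bar>\<kappa> p y\<bar> \<partial>lborel) \<le> ennreal (A * W0)" for p
  proof (cases "p \<in> E")
    case True
    then show ?thesis using k_nn_integral[of "snd p" "fst p"] Et(1)[of "fst p" "snd p"] by (simp add: \<kappa>_def)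
  qed (simp add: \<kappa>_def)
  define M where "M = 4 * W * S * A\<^sup>2 / e"
  have M: "0 \<le> M" using W_pos S e by (simp add: M_def)
  have schur: "(\<integral>\<^sup>+q. ennreal \<bar>LINT y|lborel. \<kappa> p y * \<kappa> q y\<bar> \<partial>\<nu>) \<le> ennreal M" for p
  proof (cases "p \<in> E")
    case True
    obtain z t where p: "p = (z, t)" by (cases p)
    have t: "0 < t" using Et[of z t] True p by auto
    have "(\<integral>\<^sup>+q. ennreal \<bar>LINT y|lborel. \<kappa> p y * \<kappa> q y\<bar> \<partial>\<nu>)
      = (\<integral>\<^sup>+q. ennreal (\<rho> q) * ennreal \<bar>LINT y|lborel. \<kappa> p y * \<kappa> q y\<bar> \<partial>(lborel \<Otimes>\<^sub>M lborel))"
      by (rule nn\<nu>) measurable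
    also have "\<dots> \<le> (\<integral>\<^sup>+q. ennreal (indicator {0<..} (snd q) / snd q) * ennreal \<bar>LINT y|lborel. k (z, t) y * k q y\<bar> \<partial>(lborel \<Otimes>\<^sub>M lborel))"
    proof (rule nn_integral_mono)
      fix q :: "'a \<times> real"
      show "ennreal (\<rho> q) * ennreal \<bar>LINT y|lborel. \<kappa> p y * \<kappa> q y\<bar> \<le> ennreal (indicator {0<..} (snd q) / snd q) * ennreal \<bar>LINT y|lborel. k (z, t) y * k q y\<bar>"
        using True Et(1)[of "fst q" "snd q"] by (cases "q \<in> E") (auto simp: \<rho>_def \<kappa>_def p)
    qed
    also have "\<dots> \<le> ennreal M" unfolding M_def by (rule schur_bound[OF t])
    finally show ?thesis .
  qed (simp add: \<kappa>_def)
  \<comment> \<open>The adjoint applied to \<open>u\<close>, to be paired with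
    \<open>f - c\<close>.\<close>
  define h where "h y = (LINT p|\<nu>. u p * \<kappa> p y)" for y
  have hm[measurable]: "h \<in> borel_measurable borel"
  proof -
    have "h \<in> borel_measurable lborel" unfolding h_def by measurable
    then show ?thesis by simp
  qed
  define I where "I = (LINT p|\<nu>. (u p)\<^sup>2)"
  have I0: "0 \<le> I" by (simp add: I_def)
  have um: "u \<in> borel_measurable \<nu>" by measurable
  have \<kappa>m: "case_prod \<kappa> \<in> borel_measurable (\<nu> \<Otimes>\<^sub>M lborel)" by measurable
  note sch = schur_TTstar[OF \<nu>.finite_measure_axioms lborel.sigma_finite_measure_axioms \<kappa>m um \<kappa>_le \<kappa>_nn _ u_le schur M]
  have h2_int: "integrable lborel (\<lambda>y. (h y)\<^sup>2)" and h2: "(LINT y|lborel. (h y)\<^sup>2) \<le> M * I"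
    unfolding h_def I_def using sch A W0_pos by auto
  have uk_int: "integrable \<nu> (\<lambda>p. u p * \<kappa> p y)" for y
    using mult_mono[OF u_le \<kappa>_le B abs_ge_zero]
    by (intro \<nu>.integrable_const_bound[of _ "B * H"]) (auto simp: abs_mult)
  have h_le: "\<bar>h y\<bar> \<le> B * H * m0" for y
  proof -
    have "\<bar>h y\<bar> \<le> (LINT p|\<nu>. \<bar>u p * \<kappa> p y\<bar>)" unfolding h_def by (rule integral_abs_bound)
    also have "\<dots> \<le> (LINT p|\<nu>. B * H)"
      using mult_mono[OF u_le \<kappa>_le B abs_ge_zero] by (intro integral_mono integrable_abs uk_int) (auto simp: abs_mult)
    also have "\<dots> = B * H * measure \<nu> (space \<nu>)" by simp
    also have "\<dots> \<le> B * H * m0" using B H m\<nu> by (intro mult_left_mono) auto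
    finally show ?thesis .
  qed
  \<comment> \<open>This constant blows up as \<eta> tends to 0; the bound of
    \<open>bmo_duality\<close> does not contain it.\<close>
  define D where "D = B * A * (1 / \<eta>) powr e * (2 * S) * (1 / \<eta>) * r"
  have hoelder: "\<bar>h y - h y'\<bar> \<le> D * norm (y - y') powr e" for y y'
  proof -
    define N where "N = B * A * (norm (y - y') / \<eta>) powr e"
    have N: "0 \<le> N" using A B by (simp add: N_def)
    let ?s = "\<lambda>z t. (ennreal (N / \<eta>) * indicator {0..r} t) * (ennreal (sing_wt e a t (z - y)) + ennreal (sing_wt e a t (z - y')))"
    let ?k = "\<lambda>z t. norm (u (z, t) * (\<kappa> (z, t) y - \<kappa> (z, t) y'))"
    have "\<bar>h y - h y'\<bar> = norm (LINT p|\<nu>. u p * (\<kappa> p y - \<kappa> p y'))"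
      unfolding h_def using uk_int by (simp add: right_diff_distrib)
    then have "ennreal \<bar>h y - h y'\<bar> \<le> (\<integral>\<^sup>+p. ennreal (norm (u p * (\<kappa> p y - \<kappa> p y'))) \<partial>\<nu>)"
      using uk_int by (simp only:) (intro integral_norm_bound_ennreal, simp add: right_diff_distrib)
    also have "\<dots> = (\<integral>\<^sup>+p. ennreal (\<rho> p) * ennreal (norm (u p * (\<kappa> p y - \<kappa> p y'))) \<partial>(lborel \<Otimes>\<^sub>M lborel))"
      by (rule nn\<nu>) measurable
    also have "\<dots> = (\<integral>\<^sup>+t. \<integral>\<^sup>+z. ennreal (\<rho> (z, t)) * ennreal (?k z t) \<partial>lborel \<partial>lborel)"
      by (rule lborel_pair.nn_integral_snd[symmetric]) measurable
    also have "\<dots> \<le> (\<integral>\<^sup>+t. \<integral>\<^sup>+z. ?s z t \<partial>lborel \<partial>lborel)"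
    proof (rule nn_integral_mono, rule nn_integral_mono_AE)
      fix t :: real
      show "AE z in lborel. ennreal (\<rho> (z, t)) * ennreal (?k z t)
        \<le> ?s z t"
        using AE_lborel_singleton[of y] AE_lborel_singleton[of y']
      proof eventually_elim
        case (elim z)
        show ?case
        proof (cases "(z, t) \<in> E")
          case True
          note t = Et[OF True]
          define g where "g = sing_wt e a t (z - y) + sing_wt e a t (z - y')"
          have g: "0 \<le> g" using t by (simp add: g_def)
          have "\<bar>k (z, t) y - k (z, t) y'\<bar> \<le> A * (norm (y - y') / t) powr e * g"
            unfolding g_def using elim by (intro reg t) auto
          also have "\<dots> \<le> A * (norm (y - y') / \<eta>) powr e * g"
            using t \<eta> e A g by (intro mult_right_mono mult_left_mono powr_mono2 divide_left_mono) auto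
          finally have "?k z t \<le> B * (A * (norm (y - y') / \<eta>) powr e * g)"
            using True u_le[of "(z, t)"] B by (simp add: abs_mult \<kappa>_def mult_mono)
          also have "\<dots> = N * g" by (simp add: N_def)
          finally have 1: "?k z t \<le> N * g" .
          have "\<rho> (z, t) \<le> 1 / \<eta>" using True t \<eta> by (auto simp: \<rho>_def intro!: divide_left_mono)
          then have "\<rho> (z, t) * ?k z t \<le> 1 / \<eta> * (N * g)"
            using 1 \<eta> \<rho>0 by (intro mult_mono) auto
          then have "ennreal (\<rho> (z, t)) * ennreal (?k z t) \<le> ennreal (N / \<eta> * g)"
            using \<rho>0 by (subst ennreal_mult[symmetric]) (auto intro!: ennreal_leI)
          also have "\<dots> = ennreal (N / \<eta>) * ennreal g" using N \<eta> g by (intro ennreal_mult) auto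
          also have "ennreal g = ennreal (sing_wt e a t (z - y)) + ennreal (sing_wt e a t (z - y'))"
            using t by (simp add: g_def)
          finally show ?thesis using t by simp
        qed (simp add: \<rho>_def)
      qed
    qed
    also have "\<dots> \<le> (\<integral>\<^sup>+t. ennreal (N / \<eta> * (2 * S)) * indicator {0..r} t \<partial>lborel)"
    proof (rule nn_integral_mono_AE)
      show "AE t in lborel. (\<integral>\<^sup>+z. ?s z t \<partial>lborel)
         \<le> ennreal (N / \<eta> * (2 * S)) * indicator {0..r} t"
        using AE_lborel_singleton[of 0]
      proof eventually_elim
        case (elim t)
        show ?case
        proof (cases "0 < t \<and> t \<le> r")
          case True
          then have t: "0 < t" by simp
          have "(\<integral>\<^sup>+z. ?s z t \<partial>lborel)
            = (ennreal (N / \<eta>) * indicator {0..r} t) * (\<integral>\<^sup>+z. ennreal (sing_wt e a t (z - y)) + ennreal (sing_wt e a t (z - y')) \<partial>lborel)"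
            by (rule nn_integral_cmult) measurable
          also have "\<dots> = ennreal (N / \<eta>) * ((\<integral>\<^sup>+z. ennreal (sing_wt e a t (z - y)) \<partial>lborel) + (\<integral>\<^sup>+z. ennreal (sing_wt e a t (z - y')) \<partial>lborel))"
            by (subst nn_integral_add) (measurable, use True in simp)
          also have "\<dots> \<le> ennreal (N / \<eta>) * (ennreal S + ennreal S)"
            using sing[OF t, of y] sing[OF t, of y'] by (intro mult_left_mono add_mono) (auto simp: sing_wt_commute)
          also have "\<dots> = ennreal (N / \<eta> * (2 * S)) * indicator {0..r} t"
            using True N \<eta> S by (simp add: ennreal_mult[symmetric] ennreal_plus[symmetric] del: ennreal_plus)
          finally show ?thesis .
        qed (use elim in \<open>auto simp: indicator_def\<close>)
      qed
    qed
    also have "\<dots> = ennreal (N / \<eta> * (2 * S) * r)"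
      using N \<eta> S r by (subst nn_integral_cmult_indicator) (auto simp: ennreal_mult[symmetric])
    also have "N / \<eta> * (2 * S) * r = D * norm (y - y') powr e"
      using \<eta> by (simp add: N_def D_def powr_divide mult_ac)
    finally show ?thesis using N \<eta> S r A B by (simp add: D_def)
  qed
  \<comment> \<open>The cube is centred at \<open>x0\<close> with half side \<open>4 * r\<close>: it
    contains every point at distance less than \<open>r\<close> from some \<open>z\<close> in
    \<open>ball x0 (2 * r)\<close>. The radius \<open>R\<close> is dictated by
    \<open>bmo_duality\<close>, so that near and far parts share the constant
    \<open>c\<close>.\<close>
  define L where "L = 8 * r"
  define a0 where "a0 = x0 - (4 * r) *\<^sub>R One"
  define R where "R = real (?n + 1) * L"
  define Q where "Q = hcube a0 L"
  define c where "c = avg_ball f a0 R"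
  have L: "0 < L" and R: "0 < R" using r by (auto simp: L_def R_def)
  have [measurable]: "Q \<in> sets borel" by (simp add: Q_def)
  have intQ: "set_integrable lborel Q (\<lambda>y. f y - c)"
    unfolding Q_def using bmo by (intro loc_int_hcube L) (simp add: bmo_le_def)
  have near: "\<bar>LINT y:Q|lborel. (f y - c) * h y\<bar> \<le> J_const * b * sqrt (L ^ ?n) * sqrt (M * I)"
  proof -
    have "\<bar>LINT y:Q|lborel. (f y - c) * h y\<bar> \<le> J_const * b * sqrt (L ^ ?n) * sqrt (LINT y:Q|lborel. (h y)\<^sup>2)"
      using bmo_duality[OF bmo b L hm h_le e(1) hoelder, of a0] unfolding Q_def c_def R_def J_const_def
      by (simp only: mult_ac)
    also have "(LINT y:Q|lborel. (h y)\<^sup>2) \<le> (LINT y|lborel. (h y)\<^sup>2)"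
      unfolding set_lebesgue_integral_def using h2_int
      by (intro integral_mono integrable_mult_indicator) (auto simp: indicator_def)
    then have "J_const * b * sqrt (L ^ ?n) * sqrt (LINT y:Q|lborel. (h y)\<^sup>2) \<le> J_const * b * sqrt (L ^ ?n) * sqrt (M * I)"
      using h2 b L by (intro mult_left_mono real_sqrt_le_mono) (auto simp: J_const_def)
    finally show ?thesis .
  qed
  define Nr where "Nr p = (LINT y|lborel. \<kappa> p y * (indicator Q y * (f y - c)))" for p
  define Fr where "Fr p = (LINT y|lborel. \<kappa> p y * (indicator (- Q) y * (f y - c)))" for p
  have [measurable]: "Nr \<in> borel_measurable \<nu>" "Fr \<in> borel_measurable \<nu>"
    unfolding Nr_def Fr_def by measurable
  have kf: "integrable lborel (\<lambda>y. \<kappa> p y * (f y - c))" for p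
    using k_times_integrable[of "snd p" "fst p" c] Et(1)[of "fst p" "snd p"] by (cases "p \<in> E") (auto simp: \<kappa>_def)
  have kfQ: "integrable lborel (\<lambda>y. \<kappa> p y * (indicator X y * (f y - c)))" if "X \<in> sets borel" for p X
    using integrable_mult_indicator[OF _ kf, of X p] that by (simp add: mult_ac)
  have u_eq: "u p = Nr p + Fr p" for p
  proof -
    have "Nr p + Fr p = (LINT y|lborel. \<kappa> p y * (indicator Q y * (f y - c)) + \<kappa> p y * (indicator (- Q) y * (f y - c)))"
      unfolding Nr_def Fr_def by (intro Bochner_Integration.integral_add[symmetric] kfQ) auto
    also have "\<dots> = (LINT y|lborel. \<kappa> p y * (f y - c))"
      by (intro Bochner_Integration.integral_cong) (auto simp: indicator_def)
    also have "\<dots> = u p"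
      using k_times_shift[of "snd p" "fst p" c] Et(1)[of "fst p" "snd p"] by (cases "p \<in> E") (auto simp: \<kappa>_def u_def U_def)
    finally show ?thesis by simp
  qed
  have far: "\<bar>Fr p\<bar> \<le> A * F_const * b * (snd p / r) powr a" if p: "p \<in> E" for p
  proof -
    obtain z t where zt: "p = (z, t)" by (cases p)
    note t = Et[OF p[unfolded zt]]
    \<comment> \<open>With \<open>n = DIM('a)\<close>, the distance to the corner \<open>a0\<close>
      is below \<open>3 * r + 4 * r * n\<close>, hence below
      \<open>R = 8 * (n + 1) * r\<close>.\<close>
    have sub: "ball z r \<subseteq> ball a0 R"
    proof
      fix y assume "y \<in> ball z r"
      then have "norm (y - a0) \<le> norm (y - z) + norm (z - x0) + norm (x0 - a0)" "norm (y - z) < r"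
        using norm_triangle_ineq[of "y - z" "z - a0"] norm_triangle_ineq[of "z - x0" "x0 - a0"]
        by (auto simp: dist_norm norm_minus_commute)
      moreover have "norm (x0 - a0) \<le> 4 * r * real ?n"
      proof -
        have "norm (One :: 'a) \<le> real ?n" using norm_le_l1[of "One :: 'a"] by simp
        then show ?thesis using r by (simp add: a0_def)
      qed
      moreover have "norm (z - x0) < 2 * r" using t by (simp add: dist_norm)
      moreover have "3 * r + 4 * r * real ?n \<le> R" using r by (simp add: R_def L_def algebra_simps)
      ultimately have "norm (y - a0) < R" by linarith
      then show "y \<in> ball a0 R" by (simp add: dist_norm norm_minus_commute)
    qed
    have out: "r \<le> norm (z - y)" if "y \<in> - Q" for y
    proof (rule ccontr)
      assume "\<not> r \<le> norm (z - y)"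
      then have yx: "norm (y - x0) < 3 * r"
        using norm_triangle_ineq[of "y - z" "z - x0"] t by (simp add: dist_norm norm_minus_commute)
      have "y \<in> Q" unfolding Q_def hcube_def
      proof (clarsimp)
        fix i :: 'a assume i: "i \<in> Basis"
        have "\<bar>(y - x0) \<bullet> i\<bar> < 3 * r" using Basis_le_norm[OF i, of "y - x0"] yx by linarith
        moreover have "a0 \<bullet> i = x0 \<bullet> i - 4 * r" using i by (simp add: a0_def inner_diff_left)
        ultimately show "a0 \<bullet> i \<le> y \<bullet> i \<and> y \<bullet> i < a0 \<bullet> i + L" using r by (auto simp: inner_diff_left L_def abs_less_iff)
      qed
      with that show False by simp
    qed
    have "ennreal \<bar>Fr p\<bar> \<le> (\<integral>\<^sup>+y. ennreal (norm (\<kappa> p y * (indicator (- Q) y * (f y - c)))) \<partial>lborel)"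
      unfolding Fr_def real_norm_def[symmetric] by (intro integral_norm_bound_ennreal kfQ) auto
    also have "\<dots> \<le> (\<integral>\<^sup>+y. ennreal A * (ennreal (wt a t (z - y)) * ennreal \<bar>f y - c\<bar> * indicator (- Q) y) \<partial>lborel)"
    proof (rule nn_integral_mono)
      fix y
      have "\<bar>k p y\<bar> * \<bar>f y - c\<bar> \<le> A * wt a t (z - y) * \<bar>f y - c\<bar>"
        unfolding zt using size[OF t(1), of z y] by (intro mult_right_mono) auto
      then have "norm (k p y * (f y - c)) \<le> A * (wt a t (z - y) * \<bar>f y - c\<bar>)" by (simp add: abs_mult mult.assoc)
      then have "ennreal (norm (k p y * (f y - c))) \<le> ennreal A * (ennreal (wt a t (z - y)) * ennreal \<bar>f y - c\<bar>)"
        using A t by (simp add: ennreal_mult[symmetric] ennreal_leI)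
      then show "ennreal (norm (\<kappa> p y * (indicator (- Q) y * (f y - c)))) \<le> ennreal A * (ennreal (wt a t (z - y)) * ennreal \<bar>f y - c\<bar> * indicator (- Q) y)"
        using p by (auto simp: \<kappa>_def indicator_def)
    qed
    also have "\<dots> = ennreal A * (\<integral>\<^sup>+y. ennreal (wt a t (z - y)) * ennreal \<bar>f y - c\<bar> * indicator (- Q) y \<partial>lborel)"
      by (rule nn_integral_cmult) measurable
    also have "\<dots> \<le> ennreal A * ennreal (2 powr (real ?n + a) * wt_const ?n a * ubv ?n * (2 ^ ?n + (R / r) ^ ?n) * b * (t / r) powr a)"
      unfolding c_def by (intro mult_left_mono bmo_far bmo t a R sub out) auto
    also have "\<dots> = ennreal A * ennreal (F_const * b * (t / r) powr a)"
      using r by (simp add: F_const_def W0_def R_def L_def mult_ac)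
    also have "\<dots> = ennreal (A * (F_const * b * (t / r) powr a))" using A by (simp add: ennreal_mult')
    finally show ?thesis
      using A b W0_pos by (simp add: zt F_const_def mult.assoc)
  qed
  have F0: "0 \<le> F_const" using W0_pos by (simp add: F_const_def)
  define C1 where "C1 = A * F_const * b"
  have C1: "0 \<le> C1" using A F0 b by (simp add: C1_def)
  have Fr_le: "\<bar>Fr p\<bar> \<le> C1" for p
  proof (cases "p \<in> E")
    case True
    have "(snd p / r) powr a \<le> 1" using Et[of "fst p" "snd p"] True r a by (intro powr_le1) auto
    then show ?thesis using far[OF True] C1 mult_left_mono[of "(snd p / r) powr a" 1 C1] by (simp add: C1_def)
  qed (use C1 in \<open>simp add: Fr_def \<kappa>_def\<close>)
  have Nr_le: "\<bar>Nr p\<bar> \<le> B + C1" for p using u_eq[of p] u_le[of p] Fr_le[of p] by linarith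
  have BC: "0 \<le> B + C1" using B C1 by simp
  have int_uN: "integrable \<nu> (\<lambda>p. u p * Nr p)"
    using mult_mono[OF u_le Nr_le B abs_ge_zero]
    by (intro \<nu>.integrable_const_bound[of _ "B * (B + C1)"]) (auto simp: abs_mult)
  have int_uF: "integrable \<nu> (\<lambda>p. u p * Fr p)"
    using mult_mono[OF u_le Fr_le B abs_ge_zero]
    by (intro \<nu>.integrable_const_bound[of _ "B * C1"]) (auto simp: abs_mult)
  have int_u2: "integrable \<nu> (\<lambda>p. (u p)\<^sup>2)"
    using power_mono[OF u_le abs_ge_zero, where n=2]
    by (intro \<nu>.integrable_const_bound[of _ "B\<^sup>2"] AE_I2) auto
  have int_F2: "integrable \<nu> (\<lambda>p. (Fr p)\<^sup>2)"
    using power_mono[OF Fr_le abs_ge_zero, where n=2]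
    by (intro \<nu>.integrable_const_bound[of _ "C1\<^sup>2"] AE_I2) auto
  have I_split: "I = (LINT p|\<nu>. u p * Nr p) + (LINT p|\<nu>. u p * Fr p)"
  proof -
    have "I = (LINT p|\<nu>. u p * Nr p + u p * Fr p)"
      unfolding I_def by (intro Bochner_Integration.integral_cong refl) (metis power2_eq_square u_eq distrib_left)
    then show ?thesis using int_uN int_uF by simp
  qed
  have uN: "(LINT p|\<nu>. u p * Nr p) = (LINT y:Q|lborel. (f y - c) * h y)"
  proof -
    define gQ where "gQ y = indicator Q y * (f y - c)" for y
    have [measurable]: "gQ \<in> borel_measurable borel" unfolding gQ_def by measurable
    have gQ: "integrable lborel gQ" using intQ by (simp add: set_integrable_def gQ_def[abs_def])
    have F: "integrable (\<nu> \<Otimes>\<^sub>M lborel) (\<lambda>(p, y). u p * \<kappa> p y * gQ y)"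
    proof (rule integrableI_bounded)
      show "(\<lambda>(p, y). u p * \<kappa> p y * gQ y) \<in> borel_measurable (\<nu> \<Otimes>\<^sub>M lborel)" by measurable
      have "(\<integral>\<^sup>+x. ennreal (norm (case x of (p, y) \<Rightarrow> u p * \<kappa> p y * gQ y)) \<partial>(\<nu> \<Otimes>\<^sub>M lborel))
        = (\<integral>\<^sup>+p. \<integral>\<^sup>+y. ennreal (norm (u p * \<kappa> p y * gQ y)) \<partial>lborel \<partial>\<nu>)"
        by (subst lborel.nn_integral_fst[symmetric]) auto
      also have "\<dots> \<le> (\<integral>\<^sup>+p. \<integral>\<^sup>+y. ennreal (B * H) * ennreal (norm (gQ y)) \<partial>lborel \<partial>\<nu>)"
      proof (intro nn_integral_mono)
        fix p y
        have "\<bar>u p\<bar> * \<bar>\<kappa> p y\<bar> * \<bar>gQ y\<bar> \<le> B * H * \<bar>gQ y\<bar>"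
          by (intro mult_right_mono mult_mono u_le \<kappa>_le B) auto
        then show "ennreal (norm (u p * \<kappa> p y * gQ y)) \<le> ennreal (B * H) * ennreal (norm (gQ y))"
          using B H by (subst ennreal_mult[symmetric]) (auto intro!: ennreal_leI simp: abs_mult)
      qed
      also have "\<dots> = ennreal (B * H) * (\<integral>\<^sup>+y. ennreal (norm (gQ y)) \<partial>lborel) * emeasure \<nu> (space \<nu>)"
        by (simp add: nn_integral_cmult)
      also have "\<dots> < \<infinity>"
        using gQ by (simp add: integrable_iff_bounded ennreal_mult_eq_top_iff less_top[symmetric])
      finally show "(\<integral>\<^sup>+x. ennreal (norm (case x of (p, y) \<Rightarrow> u p * \<kappa> p y * gQ y)) \<partial>(\<nu> \<Otimes>\<^sub>M lborel)) < \<infinity>" .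
    qed
    have "(LINT p|\<nu>. u p * Nr p) = (LINT p|\<nu>. LINT y|lborel. u p * \<kappa> p y * gQ y)"
      unfolding Nr_def gQ_def by (simp add: mult.assoc)
    also have "\<dots> = (LINT y|lborel. LINT p|\<nu>. u p * \<kappa> p y * gQ y)"
      using P.Fubini_integral[OF F] by simp
    also have "\<dots> = (LINT y|lborel. h y * gQ y)" by (simp add: h_def)
    finally show ?thesis by (simp add: set_lebesgue_integral_def gQ_def mult_ac)
  qed
  \<comment> \<open>Since \<open>(t / r) powr (2 * a)\<close> is integrable against
    \<open>dt / t\<close> down to 0, the bound is free of \<eta>.\<close>
  have F2: "(LINT p|\<nu>. (Fr p)\<^sup>2) \<le> C1\<^sup>2 * (ubv ?n * 2 ^ ?n / (2 * a)) * r ^ ?n"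
  proof -
    have "ennreal (LINT p|\<nu>. (Fr p)\<^sup>2) = (\<integral>\<^sup>+p. ennreal ((Fr p)\<^sup>2) \<partial>\<nu>)"
      by (rule nn_integral_eq_integral[OF int_F2, symmetric]) simp
    also have "\<dots> = (\<integral>\<^sup>+p. ennreal (\<rho> p) * ennreal ((Fr p)\<^sup>2) \<partial>(lborel \<Otimes>\<^sub>M lborel))"
    proof (rule nn\<nu>)
      have "Fr \<in> borel_measurable \<nu>" by measurable
      then have [measurable]: "Fr \<in> borel_measurable (lborel \<Otimes>\<^sub>M lborel)" by (simp cong: measurable_cong_sets add: \<open>sets \<nu> = sets (lborel \<Otimes>\<^sub>M lborel)\<close>)
      show "(\<lambda>p. ennreal ((Fr p)\<^sup>2)) \<in> borel_measurable (lborel \<Otimes>\<^sub>M lborel)" by measurable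
    qed
    also have "\<dots> \<le> (\<integral>\<^sup>+p. (indicator (ball x0 (2 * r)) (fst p)) * (ennreal (C1\<^sup>2 * r powr (- (2 * a))) * (ennreal (snd p powr (2 * a - 1)) * indicator {0..r} (snd p))) \<partial>(lborel \<Otimes>\<^sub>M lborel))"
    proof (rule nn_integral_mono)
      fix p :: "'a \<times> real"
      show "ennreal (\<rho> p) * ennreal ((Fr p)\<^sup>2) \<le> (indicator (ball x0 (2 * r)) (fst p)) * (ennreal (C1\<^sup>2 * r powr (- (2 * a))) * (ennreal (snd p powr (2 * a - 1)) * indicator {0..r} (snd p)))"
      proof (cases "p \<in> E")
        case True
        note t = Et[of "fst p" "snd p", simplified, OF True]
        have "(Fr p)\<^sup>2 \<le> (C1 * (snd p / r) powr a)\<^sup>2"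
          using far[OF True] by (intro power2_le_iff_abs_le[THEN iffD2]) (auto simp: C1_def intro: order_trans[OF abs_ge_zero])
        also have "\<dots> = C1\<^sup>2 * r powr (- (2 * a)) * (snd p powr (2 * a))"
          using t r by (simp add: power_mult_distrib powr_divide powr_minus power2_eq_square powr_add[symmetric] field_simps mult_2)
        finally have "\<rho> p * (Fr p)\<^sup>2 \<le> \<rho> p * (C1\<^sup>2 * r powr (- (2 * a)) * (snd p powr (2 * a)))"
          by (rule mult_left_mono[OF _ \<rho>0])
        also have "\<dots> = C1\<^sup>2 * r powr (- (2 * a)) * (snd p powr (2 * a - 1))"
          using t True by (simp add: \<rho>_def powr_diff)
        finally have "ennreal (\<rho> p) * ennreal ((Fr p)\<^sup>2) \<le> ennreal (C1\<^sup>2 * r powr (- (2 * a))) * ennreal (snd p powr (2 * a - 1))"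
          using \<rho>0[of p] by (simp add: ennreal_mult[symmetric] ennreal_leI)
        then show ?thesis using t True by (auto simp: E_def mem_Times_iff)
      qed (simp add: \<rho>_def)
    qed
    also have "\<dots> = (\<integral>\<^sup>+z. \<integral>\<^sup>+t. (indicator (ball x0 (2 * r)) z) * (ennreal (C1\<^sup>2 * r powr (- (2 * a))) * (ennreal (t powr (2 * a - 1)) * indicator {0..r} t)) \<partial>lborel \<partial>lborel)"
      by (subst lborel.nn_integral_fst[symmetric]) auto
    also have "\<dots> = (\<integral>\<^sup>+z. (indicator (ball x0 (2 * r)) z) * (ennreal (C1\<^sup>2 * r powr (- (2 * a))) * ennreal (r powr (2 * a) / (2 * a))) \<partial>lborel)"
    proof (intro nn_integral_cong)
      fix z :: 'a
      show "(\<integral>\<^sup>+t. (indicator (ball x0 (2 * r)) z) * (ennreal (C1\<^sup>2 * r powr (- (2 * a))) * (ennreal (t powr (2 * a - 1)) * indicator {0..r} t)) \<partial>lborel)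
        = (indicator (ball x0 (2 * r)) z) * (ennreal (C1\<^sup>2 * r powr (- (2 * a))) * ennreal (r powr (2 * a) / (2 * a)))"
        using nn_integral_powr_Icc[of "2 * a - 1" r] a r by (simp add: nn_integral_cmult)
    qed
    also have "\<dots> = ennreal (C1\<^sup>2 * r powr (- (2 * a))) * ennreal (r powr (2 * a) / (2 * a)) * emeasure lborel (ball x0 (2 * r))"
      by (subst mult.commute, subst nn_integral_cmult_indicator) auto
    also have "\<dots> = ennreal (C1\<^sup>2 * (ubv ?n * 2 ^ ?n / (2 * a)) * r ^ ?n)"
      using r a by (simp add: emeasure_ball ennreal_mult[symmetric] powr_minus field_simps power_mult_distrib)
    finally show ?thesis using r a by simp
  qed
  have uF: "(LINT p|\<nu>. u p * Fr p) \<le> I / 4 + (LINT p|\<nu>. (Fr p)\<^sup>2)"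
  proof -
    have "(LINT p|\<nu>. u p * Fr p) \<le> (LINT p|\<nu>. (u p)\<^sup>2 / 4 + (Fr p)\<^sup>2)"
    proof (rule integral_mono[OF int_uF])
      fix p
      show "u p * Fr p \<le> (u p)\<^sup>2 / 4 + (Fr p)\<^sup>2"
        using zero_le_power2[of "u p / 2 - Fr p"] by (simp add: power2_diff power_divide)
    qed (use int_u2 int_F2 in simp)
    then show ?thesis using int_u2 int_F2 by (simp add: I_def)
  qed
  define X where "X = J_const * b * sqrt (L ^ ?n) * sqrt M"
  have "(LINT p|\<nu>. u p * Nr p) \<le> X * sqrt I"
    using near I0 M unfolding uN X_def by (simp add: real_sqrt_mult abs_le_iff mult_ac)
  also have "X * sqrt I \<le> I / 4 + X\<^sup>2"
    using zero_le_power2[of "sqrt I / 2 - X"] I0 by (simp add: power2_diff power_divide mult.commute)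
  finally have uN': "(LINT p|\<nu>. u p * Nr p) \<le> I / 4 + X\<^sup>2" .
  \<comment> \<open>Two quarters of the finite number \<open>I\<close> are moved to the left, which
    leaves one half.\<close>
  have absorb: "i \<le> 2 * (v + w)" if "s \<le> i / 4 + v" "t \<le> i / 4 + w" "i = s + t" for i s t v w :: real
    using that by (simp add: field_simps)
  have "I \<le> 2 * (X\<^sup>2 + (LINT p|\<nu>. (Fr p)\<^sup>2))"
    by (rule absorb[OF uN' uF I_split])
  also have "\<dots> \<le> 2 * (X\<^sup>2 + C1\<^sup>2 * (ubv ?n * 2 ^ ?n / (2 * a)) * r ^ ?n)" using F2 by simp
  also have "X\<^sup>2 = J_const\<^sup>2 * b\<^sup>2 * (L ^ ?n) * M"
    using L M by (simp add: X_def power_mult_distrib)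
  also have "2 * (J_const\<^sup>2 * b\<^sup>2 * (L ^ ?n) * M + C1\<^sup>2 * (ubv ?n * 2 ^ ?n / (2 * a)) * r ^ ?n)
    = carleson_const * A\<^sup>2 * b\<^sup>2 * r ^ ?n"
    by (simp add: carleson_const_def C1_def M_def L_def power_mult_distrib algebra_simps)
  finally have Ile: "I \<le> carleson_const * A\<^sup>2 * b\<^sup>2 * r ^ ?n" .
  have "(\<integral>\<^sup>+p. indicator E p * ennreal ((LINT y|lborel. k p y * f y)\<^sup>2 / snd p) \<partial>(lborel \<Otimes>\<^sub>M lborel))
     = (\<integral>\<^sup>+p. ennreal (\<rho> p) * ennreal ((u p)\<^sup>2) \<partial>(lborel \<Otimes>\<^sub>M lborel))"
  proof (intro nn_integral_cong)
    fix p :: "'a \<times> real"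
    show "indicator E p * ennreal ((LINT y|lborel. k p y * f y)\<^sup>2 / snd p) = ennreal (\<rho> p) * ennreal ((u p)\<^sup>2)"
      using Et(1)[of "fst p" "snd p"] by (cases "p \<in> E") (auto simp: \<rho>_def u_def U_def ennreal_mult[symmetric])
  qed
  also have "\<dots> = (\<integral>\<^sup>+p. ennreal ((u p)\<^sup>2) \<partial>\<nu>)" by (rule nn\<nu>[symmetric]) measurable
  also have "\<dots> = ennreal I" unfolding I_def by (rule nn_integral_eq_integral[OF int_u2]) simp
  also have "\<dots> \<le> ennreal (carleson_const * A\<^sup>2 * b\<^sup>2 * r ^ ?n)" using Ile by (rule ennreal_leI)
  finally show ?thesis by (simp add: E_def)
qed

text \<open>Monotone convergence along the cutoffs \<open>1 / Suc j\<close>, for which the truncated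
  bound is always the same.\<close>

lemma carleson:
  assumes b: "0 < b" and r: "0 < r"
  shows "(\<integral>\<^sup>+p. indicator (ball x0 (2 * r) \<times> {0<..r}) p * ennreal ((LINT y|lborel. k p y * f y)\<^sup>2 / snd p) \<partial>(lborel \<Otimes>\<^sub>M lborel))
     \<le> ennreal (carleson_const * A\<^sup>2 * b\<^sup>2 * r ^ DIM('a))"
proof -
  let ?g = "\<lambda>p. ennreal ((LINT y|lborel. k p y * f y)\<^sup>2 / snd p)"
  let ?E = "\<lambda>j. ball x0 (2 * r) \<times> {1 / real (Suc j)..r}"
  have [measurable]: "?g \<in> borel_measurable (lborel \<Otimes>\<^sub>M lborel)" by measurable
  have sup: "indicator (ball x0 (2 * r) \<times> {0<..r}) p * ?g p \<le> (SUP j. indicator (?E j) p * ?g p)" for p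
  proof (cases "p \<in> ball x0 (2 * r) \<times> {0<..r}")
    case True
    then have "0 < snd p" by auto
    then obtain j where "inverse (real (Suc j)) < snd p" using reals_Archimedean by blast
    then have "p \<in> ?E j" using True by (auto simp: inverse_eq_divide)
    then have "indicator (?E j) p * ?g p = ?g p" by simp
    moreover have "indicator (?E j) p * ?g p \<le> (SUP j. indicator (?E j) p * ?g p)" by (rule SUP_upper) simp
    ultimately show ?thesis using True by simp
  qed simp
  have "(\<integral>\<^sup>+p. indicator (ball x0 (2 * r) \<times> {0<..r}) p * ?g p \<partial>(lborel \<Otimes>\<^sub>M lborel))
    \<le> (\<integral>\<^sup>+p. (SUP j. indicator (?E j) p * ?g p) \<partial>(lborel \<Otimes>\<^sub>M lborel))"
    by (intro nn_integral_mono sup)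
  also have "\<dots> = (SUP j. \<integral>\<^sup>+p. indicator (?E j) p * ?g p \<partial>(lborel \<Otimes>\<^sub>M lborel))"
  proof (rule nn_integral_monotone_convergence_SUP)
    show "incseq (\<lambda>j p. indicator (?E j) p * ?g p)"
    proof (intro incseq_SucI le_funI mult_right_mono)
      fix j p
      have "1 / real (Suc (Suc j)) \<le> 1 / real (Suc j)" by (intro divide_left_mono) auto
      then have "?E j \<subseteq> ?E (Suc j)" by auto
      then show "indicator (?E j) p \<le> (indicator (?E (Suc j)) p :: ennreal)" by (auto simp: indicator_def)
    qed simp
  qed measurable
  also have "\<dots> \<le> ennreal (carleson_const * A\<^sup>2 * b\<^sup>2 * r ^ DIM('a))"
    by (intro SUP_least carleson_truncated b r) simp
  finally show ?thesis .
qed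

end

end

text \<open>The constant has to precede the kernel: the estimate will be applied to frozen kernels
  that vary with the functions, and these enter through \<open>A\<close> alone. The maximum with 1
  secures positivity, since the signs of the parameters are not known outside the locale.\<close>

lemma carleson_uniform:
  fixes a e S :: real
  shows "\<exists>C>0. \<forall>A (k :: 'a::euclidean_space \<times> real \<Rightarrow> 'a \<Rightarrow> real) f b x0 r.
    square_kernel a e S A k \<longrightarrow> bmo_le f b \<longrightarrow> 0 < b \<longrightarrow> 0 < r \<longrightarrow>
    (\<integral>\<^sup>+p. indicator (ball x0 (2 * r) \<times> {0<..r}) p * ennreal ((LINT y|lborel. k p y * f y)\<^sup>2 / snd p) \<partial>(lborel \<Otimes>\<^sub>M lborel))
     \<le> ennreal (C * (A * b)\<^sup>2 * r ^ DIM('a))"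
proof -
  define C where "C = max 1 (square_kernel.carleson_const TYPE('a) a e S)"
  show ?thesis
  proof (intro exI[of _ C] conjI allI impI)
    fix A b r :: real and k :: "'a \<times> real \<Rightarrow> 'a \<Rightarrow> real" and f :: "'a \<Rightarrow> real" and x0 :: 'a
    assume k: "square_kernel a e S A k" and f: "bmo_le f b" "0 < b" and r: "0 < r"
    have "square_kernel.carleson_const TYPE('a) a e S * A\<^sup>2 * b\<^sup>2 * r ^ DIM('a) \<le> C * A\<^sup>2 * b\<^sup>2 * r ^ DIM('a)"
      using r by (intro mult_right_mono) (auto simp: C_def)
    then show "(\<integral>\<^sup>+p. indicator (ball x0 (2 * r) \<times> {0<..r}) p * ennreal ((LINT y|lborel. k p y * f y)\<^sup>2 / snd p) \<partial>(lborel \<Otimes>\<^sub>M lborel))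
     \<le> ennreal (C * (A * b)\<^sup>2 * r ^ DIM('a))"
      using square_kernel.carleson[OF k f r, of x0] by (simp add: power_mult_distrib mult.assoc order_trans[OF _ ennreal_leI])
  qed (simp add: C_def)
qed

subsection \<open>Multilinear kernels\<close>

text \<open>The substitution \<open>w = (z - y) / t\<close> has constant Jacobian. It carries the
  cancellation of \<open>K\<close> over to each slot of the scaled and reflected kernel.\<close>

lemma lborel_integral_reflect_scale_eq_0:
  fixes g :: "'a::euclidean_space \<Rightarrow> real" and z :: 'a
  assumes [measurable]: "g \<in> borel_measurable borel" and t: "0 < t" and g: "(LINT w|lborel. g w) = 0"
  shows "(LINT y|lborel. g ((1 / t) *\<^sub>R (z - y))) = 0"
proof -
  have *: "(lborel :: 'a measure) = density (distr lborel borel (\<lambda>x. (1 / t) *\<^sub>R z + (- 1 / t) *\<^sub>R x)) (\<lambda>_. ennreal (\<bar>- 1 / t\<bar> ^ DIM('a)))"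
    using lborel_affine[of "- 1 / t" "(1 / t) *\<^sub>R z"] t by simp
  have "(LINT w|lborel. g w) = (LINT w|density (distr lborel borel (\<lambda>x. (1 / t) *\<^sub>R z + (- 1 / t) *\<^sub>R x)) (\<lambda>_. ennreal (\<bar>- 1 / t\<bar> ^ DIM('a))). g w)"
    using * by (rule arg_cong)
  also have "\<dots> = (LINT w|distr lborel borel (\<lambda>x. (1 / t) *\<^sub>R z + (- 1 / t) *\<^sub>R x). \<bar>- 1 / t\<bar> ^ DIM('a) *\<^sub>R g w)"
    by (rule integral_density) auto
  also have "\<dots> = (LINT y|lborel. \<bar>- 1 / t\<bar> ^ DIM('a) *\<^sub>R g ((1 / t) *\<^sub>R z + (- 1 / t) *\<^sub>R y))"
    by (rule integral_distr) auto
  finally show ?thesis using g t by (simp add: scaleR_diff_right)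
qed

lemma avg_ball_measurable [measurable (raw)]:
  fixes f :: "'a::euclidean_space \<Rightarrow> real"
  assumes f: "f \<in> borel_measurable borel" and g[measurable]: "g \<in> borel_measurable M" and h[measurable]: "h \<in> borel_measurable M"
  shows "(\<lambda>x. avg_ball f (g x) (h x)) \<in> borel_measurable M"
proof -
  have [measurable]: "f \<in> borel_measurable lborel" using f by simp
  \<comment> \<open>A condition on \<open>dist z y\<close> replaces the moving domain; the branch 0
    records that a ball of negative radius has no volume.\<close>
  have "avg_ball f z r = (LINT y|lborel. (if dist z y < r then f y else 0)) / (if 0 \<le> r then ubv DIM('a) * r ^ DIM('a) else 0)" for z r
  proof -
    have "(LINT y:ball z r|lborel. f y) = (LINT y|lborel. (if dist z y < r then f y else 0))"
      unfolding set_lebesgue_integral_def by (intro Bochner_Integration.integral_cong) auto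
    then show ?thesis by (simp add: avg_ball_def measure_lborel_ball)
  qed
  then show ?thesis by simp
qed

text \<open>Product weights replace the joint decay in \<open>ssum_norm\<close>, so that integrals
  of the bounds factor over the slots. Regularity is kept in slot 0, the one that is not
  frozen.\<close>

locale multilinear_kernel =
  fixes m :: nat and K :: "(nat \<Rightarrow> 'a::euclidean_space) \<Rightarrow> real" and C a e :: real
  assumes m: "0 < m" and C: "0 < C" and e: "0 < e" "e < 1" "e < a"
    and K_meas: "K \<in> borel_measurable (PiM {..<m} (\<lambda>_. lborel))"
    and K_size: "\<And>y. \<bar>K y\<bar> \<le> C * (\<Prod>j<m. wt a 1 (y j))"
    and K_reg: "\<And>y y'. y 0 \<noteq> 0 \<Longrightarrow> y' \<noteq> 0 \<Longrightarrow> \<bar>K y - K (y(0 := y'))\<bar>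
       \<le> C * norm (y 0 - y') powr e * (sing_wt e a 1 (y 0) + sing_wt e a 1 y') * (\<Prod>j\<in>{1..<m}. wt a 1 (y j))"
    and K_canc: "\<And>i y. i < m \<Longrightarrow> (LINT z|lborel. K (y(i := z))) = 0"

text \<open>The surplus decay \<open>m * d\<close> is shared equally: each of the \<open>m\<close>
  factors receives the exponent \<open>- (DIM('a) + d)\<close>, and
  \<open>norm (y j) \<le> ssum_norm m y\<close>.\<close>

lemma one_plus_sum_powr_le:
  fixes y :: "nat \<Rightarrow> 'a::euclidean_space"
  assumes d: "0 < d"
  shows "(1 + ssum_norm m y) powr (- (real m * real DIM('a) + real m * d)) \<le> (\<Prod>j<m. wt d 1 (y j))"
proof -
  have s0: "0 \<le> ssum_norm m y" by (simp add: ssum_norm_def sum_nonneg)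
  have "(1 + ssum_norm m y) powr (- (real m * real DIM('a) + real m * d)) = ((1 + ssum_norm m y) powr (- (real DIM('a) + d))) ^ m"
    using s0 by (simp add: powr_realpow[symmetric] powr_powr algebra_simps)
  also have "\<dots> = (\<Prod>j<m. (1 + ssum_norm m y) powr (- (real DIM('a) + d)))" by simp
  also have "\<dots> \<le> (\<Prod>j<m. wt d 1 (y j))"
  proof (intro prod_mono conjI)
    fix j assume "j \<in> {..<m}"
    then have "norm (y j) \<le> ssum_norm m y"
      unfolding ssum_norm_def by (intro member_le_sum) auto
    then show "(1 + ssum_norm m y) powr (- (real DIM('a) + d)) \<le> wt d 1 (y j)"
      using d by (simp add: wt_def) (intro powr_mono2', auto simp: add_pos_nonneg)
  qed simp
  finally show ?thesis .
qed

text \<open>Regularity has two regimes. If the displacement \<open>h\<close> is at most half of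
  \<open>smax_norm m y\<close>, the hypothesis applies and its order is lowered to \<open>e\<close>.
  Otherwise both points have norm at most \<open>3 * h\<close>, and there the weight in the size
  bound is at most \<open>3 * h powr e\<close> times the singular weight.\<close>

lemma LP_kernel_multilinear_kernel:
  fixes K :: "(nat \<Rightarrow> 'a::euclidean_space) \<Rightarrow> real"
  assumes K: "LP_kernel m K" and m: "0 < m"
  shows "\<exists>C a e. multilinear_kernel m K C a e"
proof -
  let ?N = "real m * real DIM('a)"
  obtain C1 d1 where C1: "C1 > 0" "d1 > 0" and size: "\<And>y. \<bar>K y\<bar> \<le> C1 * (1 + ssum_norm m y) powr (- (?N + d1))"
    using K unfolding LP_kernel_def by blast
  obtain C2 d2 \<gamma> where C2: "C2 > 0" "d2 > 0" "\<gamma> > 0" and hoelder_all: "\<forall>i<m. \<forall>y y'. 2 * norm (y i - y') \<le> smax_norm m y \<longrightarrow>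
           \<bar>K y - K (y(i := y'))\<bar> \<le> C2 * norm (y i - y') powr \<gamma> * (1 + ssum_norm m y) powr (- (?N + d2 + \<gamma>))"
    using K unfolding LP_kernel_def by (elim conjE exE)
  note hoelder = hoelder_all[rule_format]
  \<comment> \<open>The decay rates in the size and regularity conditions may differ; the smaller
    one is shared among the \<open>m\<close> slots.\<close>
  define a where "a = min d1 d2 / real m"
  \<comment> \<open>Below 1 to keep the singular weight integrable, below \<open>a\<close> to let a
    weight absorb a Hoelder factor, and at most \<gamma> so that regularity can be weakened to order
    \<open>e\<close>.\<close>
  define e where "e = min \<gamma> (min (1/2) (a / 2))"
  have a: "0 < a" using C1 C2 m by (simp add: a_def)
  have e: "0 < e" "e < 1" "e < a" "e \<le> \<gamma>" using a C2 by (auto simp: e_def)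
  have ma: "real m * a = min d1 d2" using m by (simp add: a_def)
  define C where "C = 3 * C1 + C2"
  have s0: "0 \<le> ssum_norm m y" for y :: "nat \<Rightarrow> 'a" by (simp add: ssum_norm_def sum_nonneg)
  have size': "\<bar>K y\<bar> \<le> C1 * (\<Prod>j<m. wt a 1 (y j))" for y
  proof -
    have "(1 + ssum_norm m y) powr (- (?N + d1)) \<le> (1 + ssum_norm m y) powr (- (?N + real m * a))"
      using s0[of y] by (intro powr_mono) (auto simp: ma)
    also have "\<dots> \<le> (\<Prod>j<m. wt a 1 (y j))" by (rule one_plus_sum_powr_le[OF a])
    finally show ?thesis using size[of y] C1 by (meson mult_left_mono order_trans less_imp_le)
  qed
  have prod0: "0 \<le> (\<Prod>j\<in>J. wt a 1 (y j :: 'a))" for J :: "nat set" and y by (intro prod_nonneg) simp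
  have m_insert: "{..<m} = insert 0 {1..<m}" using m by auto
  have split: "(\<Prod>j<m. wt a 1 (y j :: 'a)) = wt a 1 (y 0) * (\<Prod>j\<in>{1..<m}. wt a 1 (y j))" for y
    unfolding m_insert by simp
  have reg: "\<bar>K y - K (y(0 := y'))\<bar>
       \<le> C * norm (y 0 - y') powr e * (sing_wt e a 1 (y 0) + sing_wt e a 1 y') * (\<Prod>j\<in>{1..<m}. wt a 1 (y j))"
    if nz: "y 0 \<noteq> 0" "y' \<noteq> 0" for y y'
  proof -
    define P where "P = (\<Prod>j\<in>{1..<m}. wt a 1 (y j))"
    define h where "h = norm (y 0 - y')"
    have P: "0 \<le> P" using prod0 by (simp add: P_def)
    have h0: "0 \<le> h" by (simp add: h_def)
    have wt_le_sing: "wt a 1 v \<le> sing_wt e a 1 v" for v :: 'a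
      by (simp add: sing_wt_def algebra_simps)
    show ?thesis
    proof (cases "2 * h \<le> smax_norm m y")
      case True
      define \<sigma> where "\<sigma> = 1 + ssum_norm m y"
      have \<sigma>: "1 \<le> \<sigma>" using s0 by (simp add: \<sigma>_def)
      have "smax_norm m y \<le> ssum_norm m y"
        unfolding smax_norm_def ssum_norm_def using m
        by (intro Max.boundedI) (auto intro!: member_le_sum)
      then have h\<sigma>: "h \<le> \<sigma>" using True h0 by (simp add: \<sigma>_def)
      have "\<bar>K y - K (y(0 := y'))\<bar> \<le> C2 * h powr \<gamma> * \<sigma> powr (- (?N + d2 + \<gamma>))"
        using hoelder[of 0 y y'] m True by (simp add: h_def \<sigma>_def)
      \<comment> \<open>The excess order \<open>\<gamma> - e\<close> is traded for a power of
        \<sigma>, which the decay \<open>- \<gamma>\<close> in the hypothesis more than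
        compensates.\<close>
      also have "h powr \<gamma> \<le> h powr e * \<sigma> powr (\<gamma> - e)"
      proof -
        have "h powr \<gamma> = h powr e * h powr (\<gamma> - e)" by (simp flip: powr_add)
        also have "\<dots> \<le> h powr e * \<sigma> powr (\<gamma> - e)"
          using e h0 h\<sigma> by (intro mult_left_mono powr_mono2) auto
        finally show ?thesis .
      qed
      then have "C2 * h powr \<gamma> * \<sigma> powr (- (?N + d2 + \<gamma>)) \<le> C2 * (h powr e * \<sigma> powr (\<gamma> - e)) * \<sigma> powr (- (?N + d2 + \<gamma>))"
        using C2 by (intro mult_right_mono mult_left_mono) auto
      also have "\<dots> = C2 * h powr e * \<sigma> powr (- (?N + d2 + e))"
        by (simp add: mult.assoc powr_add[symmetric])
      also have "\<dots> \<le> C2 * h powr e * \<sigma> powr (- (?N + real m * a))"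
        using \<sigma> C2 e by (intro mult_left_mono powr_mono) (auto simp: ma)
      also have "\<dots> \<le> C2 * h powr e * (\<Prod>j<m. wt a 1 (y j))"
        unfolding \<sigma>_def using C2 by (intro mult_left_mono one_plus_sum_powr_le a) auto
      also have "\<dots> = C2 * h powr e * wt a 1 (y 0) * P" by (simp add: split P_def)
      also have "\<dots> \<le> C * h powr e * (sing_wt e a 1 (y 0) + sing_wt e a 1 y') * P"
        using C1 C2 wt_le_sing[of "y 0"] P
        by (intro mult_right_mono mult_mono) (auto simp: C_def intro: add_increasing2)
      finally show ?thesis by (simp add: h_def P_def)
    next
      case False
      have near: "wt a 1 v \<le> 3 * h powr e * sing_wt e a 1 v" if v: "v \<noteq> 0" "norm v \<le> 3 * h" for v :: 'a
      proof -
        have nv: "0 < norm v" using v by simp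
        have "1 = norm v powr e * norm v powr (- e)" using nv by (simp flip: powr_add)
        also have "\<dots> \<le> (3 * h) powr e * norm v powr (- e)"
          using v e by (intro mult_right_mono powr_mono2) auto
        also have "\<dots> = 3 powr e * (h powr e * norm v powr (- e))" using h0 by (simp add: powr_mult)
        also have "\<dots> \<le> 3 powr 1 * (h powr e * norm v powr (- e))"
          using e by (intro mult_right_mono powr_mono) auto
        finally have "1 \<le> 3 * h powr e * norm v powr (- e)" by simp
        also have "\<dots> \<le> 3 * h powr e * (1 + norm v powr (- e))" by (intro mult_left_mono) auto
        finally have "1 * wt a 1 v \<le> 3 * h powr e * (1 + norm v powr (- e)) * wt a 1 v"
          by (intro mult_right_mono) auto
        then show ?thesis by (simp add: sing_wt_def mult.assoc)
      qed
      have "norm (y 0) \<le> smax_norm m y"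
        unfolding smax_norm_def using m by (intro Max_ge) auto
      then have y0: "norm (y 0) \<le> 2 * h" using False by simp
      have y1: "norm y' \<le> 3 * h" using y0 norm_triangle_ineq[of "y 0" "y' - y 0"] by (simp add: h_def norm_minus_commute)
      have "\<bar>K y - K (y(0 := y'))\<bar> \<le> C1 * (wt a 1 (y 0) * P) + C1 * (wt a 1 y' * P)"
        using size'[of y] size'[of "y(0 := y')"] by (simp add: split P_def)
      also have "\<dots> \<le> C1 * ((3 * h powr e * sing_wt e a 1 (y 0)) * P) + C1 * ((3 * h powr e * sing_wt e a 1 y') * P)"
        using near[OF nz(1)] near[OF nz(2) y1] y0 h0 C1 P by (intro add_mono mult_left_mono mult_right_mono) auto
      also have "\<dots> = (3 * C1) * h powr e * (sing_wt e a 1 (y 0) + sing_wt e a 1 y') * P"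
        by (simp add: algebra_simps)
      also have "\<dots> \<le> C * h powr e * (sing_wt e a 1 (y 0) + sing_wt e a 1 y') * P"
        using C2 P by (intro mult_right_mono) (auto simp: C_def)
      finally show ?thesis by (simp add: h_def P_def)
    qed
  qed
  have "multilinear_kernel m K C a e"
  proof
    show "\<bar>K y\<bar> \<le> C * (\<Prod>j<m. wt a 1 (y j))" for y
    proof -
      have "C1 * (\<Prod>j<m. wt a 1 (y j)) \<le> C * (\<Prod>j<m. wt a 1 (y j))"
        using C1 C2 prod0 by (intro mult_right_mono) (auto simp: C_def)
      then show ?thesis using size'[of y] by linarith
    qed
  qed (use K m e reg C1 C2 in \<open>auto simp: LP_kernel_def C_def\<close>)
  then show ?thesis by blast
qed

interpretation lborel_PiM: product_sigma_finite "\<lambda>_ :: nat. lborel :: 'a::euclidean_space measure"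
  by standard

section \<open>Scaled kernels, cancellation and Fubini in single slots\<close>

context multilinear_kernel
begin

lemma a: "0 < a" using e by simp

definition Ks :: "real \<Rightarrow> 'a \<Rightarrow> (nat \<Rightarrow> 'a) \<Rightarrow> real" where
  "Ks t z y = t powr (- (real m * real DIM('a))) * K (\<lambda>j\<in>{..<m}. (1 / t) *\<^sub>R (z - y j))"

lemma Ks_measurable [measurable (raw)]:
  assumes [measurable]: "T \<in> borel_measurable M" "Z \<in> borel_measurable M"
    and Y: "\<And>j. j < m \<Longrightarrow> (\<lambda>x. Y x j) \<in> borel_measurable M"
  shows "(\<lambda>x. Ks (T x) (Z x) (Y x)) \<in> borel_measurable M"
proof -
  have "(\<lambda>x. \<lambda>j\<in>{..<m}. (1 / T x) *\<^sub>R (Z x - Y x j)) \<in> measurable M (PiM {..<m} (\<lambda>_. lborel))"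
  proof (rule measurable_restrict)
    fix j assume "j \<in> {..<m}"
    then have [measurable]: "(\<lambda>x. Y x j) \<in> borel_measurable M" using Y by simp
    show "(\<lambda>x. (1 / T x) *\<^sub>R (Z x - Y x j)) \<in> measurable M lborel" by measurable
  qed
  from measurable_compose[OF this K_meas]
  show ?thesis unfolding Ks_def by measurable
qed

lemma scale_prod:
  fixes y :: "nat \<Rightarrow> 'a"
  assumes t: "0 < t" and J: "finite J"
  shows "(\<Prod>j\<in>J. wt a 1 ((1 / t) *\<^sub>R (z - y j))) = (t ^ DIM('a)) ^ card J * (\<Prod>j\<in>J. wt a t (z - y j))"
proof -
  have "wt a 1 ((1 / t) *\<^sub>R v) = t ^ DIM('a) * wt a t v" for v :: 'a
    using t by (simp add: wt_def)
  then show ?thesis by (simp add: prod.distrib)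
qed

lemma sing_wt_scale: "0 < t \<Longrightarrow> sing_wt e a 1 ((1 / t) *\<^sub>R v) = t ^ DIM('a) * sing_wt e a t (v :: 'a)"
  by (simp add: sing_wt_def wt_def)

lemma t_powr_m: "0 < t \<Longrightarrow> t powr (- (real m * real DIM('a))) = 1 / (t ^ DIM('a)) ^ m"
  by (simp add: powr_minus powr_realpow[symmetric] powr_powr divide_inverse mult.commute)

lemma Ks_size: "0 < t \<Longrightarrow> \<bar>Ks t z y\<bar> \<le> C * (\<Prod>j<m. wt a t (z - y j))"
proof -
  assume t: "0 < t"
  have "\<bar>K (\<lambda>j\<in>{..<m}. (1 / t) *\<^sub>R (z - y j))\<bar> \<le> C * (\<Prod>j<m. wt a 1 ((1 / t) *\<^sub>R (z - y j)))"
    using K_size[of "\<lambda>j\<in>{..<m}. (1 / t) *\<^sub>R (z - y j)"] by simp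
  also have "\<dots> = (t ^ DIM('a)) ^ m * (C * (\<Prod>j<m. wt a t (z - y j)))"
    by (simp only: scale_prod[OF t finite_lessThan] card_lessThan) simp
  finally show ?thesis
    using t by (simp add: Ks_def t_powr_m abs_mult pos_divide_le_eq mult.commute)
qed

lemma Ks_reg:
  assumes t: "0 < t" and y: "y 0 \<noteq> z" "y' \<noteq> z"
  shows "\<bar>Ks t z y - Ks t z (y(0 := y'))\<bar>
     \<le> C * (norm (y 0 - y') / t) powr e * (sing_wt e a t (z - y 0) + sing_wt e a t (z - y')) * (\<Prod>j\<in>{1..<m}. wt a t (z - y j))"
proof -
  define w where "w = (\<lambda>j\<in>{..<m}. (1 / t) *\<^sub>R (z - y j))"
  define w' where "w' = (1 / t) *\<^sub>R (z - y')"
  define T where "T = t ^ DIM('a)"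
  have T: "0 < T" using t by (simp add: T_def)
  have w0: "w 0 = (1 / t) *\<^sub>R (z - y 0)" using m by (simp add: w_def)
  have upd: "(\<lambda>j\<in>{..<m}. (1 / t) *\<^sub>R (z - (y(0 := y')) j)) = w(0 := w')"
    using m by (auto simp: w_def w'_def fun_eq_iff)
  have diff: "norm (w 0 - w') = norm (y 0 - y') / t"
  proof -
    have "w 0 - w' = (1 / t) *\<^sub>R (y' - y 0)" by (simp add: w0 w'_def algebra_simps)
    then show ?thesis using t by (simp add: norm_minus_commute)
  qed
  \<comment> \<open>One power of \<open>T\<close> comes from the displaced slot and
    \<open>m - 1\<close> from the product; together they cancel the normalisation of
    \<open>Ks\<close>.\<close>
  have Tm: "T ^ m = T * T ^ (m - 1)" using m by (cases m) auto
  have "\<bar>K w - K (w(0 := w'))\<bar> \<le> C * norm (w 0 - w') powr e * (sing_wt e a 1 (w 0) + sing_wt e a 1 w') * (\<Prod>j\<in>{1..<m}. wt a 1 (w j))"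
    by (rule K_reg) (use y t in \<open>auto simp: w0 w'_def\<close>)
  also have "(\<Prod>j\<in>{1..<m}. wt a 1 (w j)) = (\<Prod>j\<in>{1..<m}. wt a 1 ((1 / t) *\<^sub>R (z - y j)))"
    by (intro prod.cong) (auto simp: w_def)
  also have "\<dots> = T ^ (m - 1) * (\<Prod>j\<in>{1..<m}. wt a t (z - y j))"
    by (simp only: scale_prod[OF t finite_atLeastLessThan] card_atLeastLessThan T_def)
  also have "sing_wt e a 1 (w 0) + sing_wt e a 1 w' = T * (sing_wt e a t (z - y 0) + sing_wt e a t (z - y'))"
    by (simp only: w0 w'_def sing_wt_scale[OF t] T_def distrib_left)
  finally have "\<bar>K w - K (w(0 := w'))\<bar> \<le> T ^ m * (C * (norm (y 0 - y') / t) powr e * (sing_wt e a t (z - y 0) + sing_wt e a t (z - y')) * (\<Prod>j\<in>{1..<m}. wt a t (z - y j)))"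
    unfolding diff Tm by (simp only: mult_ac)
  moreover have "\<bar>Ks t z y - Ks t z (y(0 := y'))\<bar> = \<bar>K w - K (w(0 := w'))\<bar> / T ^ m"
    unfolding Ks_def upd w_def[symmetric] t_powr_m[OF t] T_def[symmetric]
    using T by (simp add: abs_mult flip: right_diff_distrib diff_divide_distrib)
  ultimately show ?thesis using T by (simp add: pos_divide_le_eq mult.commute)
qed

definition Phi :: "(nat \<Rightarrow> 'a \<Rightarrow> real) \<Rightarrow> real \<Rightarrow> 'a \<Rightarrow> (nat \<Rightarrow> 'a) \<Rightarrow> real" where
  "Phi g t z y = Ks t z y * (\<Prod>j<m. g j (y j))"

lemma LP_G_eq: "LP_G m K f t z = (LINT y|PiM {..<m} (\<lambda>_. lborel). Phi f t z y)"
  by (simp add: LP_G_def Phi_def Ks_def mult.assoc)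

text \<open>Integrability against the size weight, required in each slot separately. Constants and
  BMO functions minus constants both satisfy it, so single slots can be exchanged while the
  integrand stays absolutely integrable.\<close>

definition adm :: "real \<Rightarrow> 'a \<Rightarrow> ('a \<Rightarrow> real) \<Rightarrow> bool" where
  "adm t z g \<longleftrightarrow> g \<in> borel_measurable borel \<and> (\<integral>\<^sup>+y. ennreal (wt a t (z - y)) * ennreal \<bar>g y\<bar> \<partial>lborel) < \<infinity>"

lemma adm_measurable [measurable_dest]: "adm t z g \<Longrightarrow> g \<in> borel_measurable borel"
  by (simp add: adm_def)

lemma adm_const: "0 < t \<Longrightarrow> adm t z (\<lambda>_. c)"
proof -
  assume t: "0 < t"
  have "(\<integral>\<^sup>+y. ennreal (wt a t (z - y)) * ennreal \<bar>c\<bar> \<partial>lborel) = (\<integral>\<^sup>+y. ennreal (wt a t (z - y)) \<partial>lborel) * ennreal \<bar>c\<bar>"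
    by (rule nn_integral_multc) measurable
  also have "\<dots> < \<infinity>"
    using order.strict_trans1[OF nn_integral_wt_le[OF t a, of z] ennreal_less_top] by (simp add: ennreal_mult_less_top)
  finally show ?thesis by (simp add: adm_def)
qed

lemma adm_bmo:
  assumes f: "bmo_le f b" and t: "0 < t"
  shows "adm t z (\<lambda>y. f y - c)"
  unfolding adm_def
proof
  have [measurable]: "f \<in> borel_measurable borel" using f by (simp add: bmo_le_def loc_int_measurable)
  show "(\<lambda>y. f y - c) \<in> borel_measurable borel" by measurable
  show "(\<integral>\<^sup>+y. ennreal (wt a t (z - y)) * ennreal \<bar>f y - c\<bar> \<partial>lborel) < \<infinity>"
    using order.strict_trans1[OF bmo_wt_integral_const[OF f t a] ennreal_less_top] by simp
qed

lemma prod_nn_bound: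
  fixes J :: "nat set"
  assumes t: "0 < t" and J: "finite J" and g: "\<And>j. j \<in> J \<Longrightarrow> adm t z (g j)"
  shows "(\<integral>\<^sup>+y. ennreal (\<Prod>j\<in>J. wt a t (z - y j) * \<bar>g j (y j)\<bar>) \<partial>PiM J (\<lambda>_. lborel))
    = (\<Prod>j\<in>J. \<integral>\<^sup>+y. ennreal (wt a t (z - y)) * ennreal \<bar>g j y\<bar> \<partial>lborel)"
proof -
  have "(\<integral>\<^sup>+y. ennreal (\<Prod>j\<in>J. wt a t (z - y j) * \<bar>g j (y j)\<bar>) \<partial>PiM J (\<lambda>_. lborel))
    = (\<integral>\<^sup>+y. (\<Prod>j\<in>J. ennreal (wt a t (z - y j)) * ennreal \<bar>g j (y j)\<bar>) \<partial>PiM J (\<lambda>_. lborel))"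
    using t by (simp add: prod_ennreal[symmetric] ennreal_mult)
  also have "\<dots> = (\<Prod>j\<in>J. \<integral>\<^sup>+y. ennreal (wt a t (z - y)) * ennreal \<bar>g j y\<bar> \<partial>lborel)"
  proof (rule lborel_PiM.product_nn_integral_prod[OF J])
    fix j assume "j \<in> J"
    then have [measurable]: "g j \<in> borel_measurable borel" using g adm_measurable by blast
    show "(\<lambda>y. ennreal (wt a t (z - y)) * ennreal \<bar>g j y\<bar>) \<in> borel_measurable lborel" by measurable
  qed
  finally show ?thesis .
qed

lemma Phi_measurable:
  assumes "\<And>j. j < m \<Longrightarrow> g j \<in> borel_measurable borel"
  shows "Phi g t z \<in> borel_measurable (PiM {..<m} (\<lambda>_. lborel))"
proof -
  have [measurable]: "(\<lambda>y. \<Prod>j<m. g j (y j)) \<in> borel_measurable (PiM {..<m} (\<lambda>_. lborel))"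
  proof (rule borel_measurable_prod)
    fix j assume j: "j \<in> {..<m}"
    then have [measurable]: "g j \<in> borel_measurable borel" using assms by simp
    show "(\<lambda>y. g j (y j)) \<in> borel_measurable (PiM {..<m} (\<lambda>_. lborel))" using j by measurable
  qed
  show ?thesis unfolding Phi_def[abs_def] by measurable
qed

lemma Phi_integrable:
  assumes t: "0 < t" and g: "\<And>j. j < m \<Longrightarrow> adm t z (g j)"
  shows "integrable (PiM {..<m} (\<lambda>_. lborel)) (Phi g t z)"
proof (rule integrableI_bounded)
  show "Phi g t z \<in> borel_measurable (PiM {..<m} (\<lambda>_. lborel))"
    using g adm_measurable by (intro Phi_measurable) blast
  have gm: "j \<in> {..<m} \<Longrightarrow> (\<lambda>y. wt a t (z - y j) * \<bar>g j (y j)\<bar>) \<in> borel_measurable (PiM {..<m} (\<lambda>_. lborel))" for j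
  proof -
    assume j: "j \<in> {..<m}"
    then have [measurable]: "g j \<in> borel_measurable borel" using g adm_measurable by blast
    show ?thesis using j by measurable
  qed
  have "(\<integral>\<^sup>+y. ennreal (norm (Phi g t z y)) \<partial>PiM {..<m} (\<lambda>_. lborel))
    \<le> (\<integral>\<^sup>+y. ennreal C * ennreal (\<Prod>j<m. wt a t (z - y j) * \<bar>g j (y j)\<bar>) \<partial>PiM {..<m} (\<lambda>_. lborel))"
  proof (rule nn_integral_mono)
    fix y
    have "\<bar>Phi g t z y\<bar> \<le> C * (\<Prod>j<m. wt a t (z - y j)) * \<bar>\<Prod>j<m. g j (y j)\<bar>"
      unfolding Phi_def abs_mult by (intro mult_right_mono Ks_size t) auto
    then have "norm (Phi g t z y) \<le> C * (\<Prod>j<m. wt a t (z - y j) * \<bar>g j (y j)\<bar>)"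
      by (simp add: prod.distrib abs_prod mult.assoc)
    then show "ennreal (norm (Phi g t z y)) \<le> ennreal C * ennreal (\<Prod>j<m. wt a t (z - y j) * \<bar>g j (y j)\<bar>)"
      using C t by (subst ennreal_mult[symmetric]) (auto intro!: ennreal_leI prod_nonneg)
  qed
  also have "\<dots> = ennreal C * (\<integral>\<^sup>+y. ennreal (\<Prod>j<m. wt a t (z - y j) * \<bar>g j (y j)\<bar>) \<partial>PiM {..<m} (\<lambda>_. lborel))"
    using gm by (intro nn_integral_cmult measurable_compose[OF _ measurable_ennreal] borel_measurable_prod) auto
  also have "\<dots> = ennreal C * (\<Prod>j<m. \<integral>\<^sup>+y. ennreal (wt a t (z - y)) * ennreal \<bar>g j y\<bar> \<partial>lborel)"
    using prod_nn_bound[OF t finite_lessThan g] by simp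
  also have "\<dots> < \<infinity>"
  proof -
    have "(\<integral>\<^sup>+y. ennreal (wt a t (z - y)) * ennreal \<bar>g j y\<bar> \<partial>lborel) \<noteq> top" if "j < m" for j
      using g[OF that] by (simp add: adm_def less_top)
    then show ?thesis by (auto simp: ennreal_mult_eq_top_iff ennreal_prod_eq_top less_top[symmetric])
  qed
  finally show "(\<integral>\<^sup>+y. ennreal (norm (Phi g t z y)) \<partial>PiM {..<m} (\<lambda>_. lborel)) < \<infinity>" .
qed

text \<open>Fubini with slot \<open>i\<close> innermost: up to factors not depending on that
  variable, the inner integral is the one of \<open>K\<close> in its \<open>i\<close>-th argument
  after reflection and scaling.\<close>

lemma Phi_const_slot:
  assumes t: "0 < t" and g: "\<And>j. j < m \<Longrightarrow> adm t z (g j)" and i: "i < m" and gi: "g i = (\<lambda>_. c)"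
  shows "(LINT y|PiM {..<m} (\<lambda>_. lborel). Phi g t z y) = 0"
proof -
  let ?J = "{..<m} - {i}"
  have ins: "insert i ?J = {..<m}" using i by auto
  have inner: "(LINT y|lborel. Phi g t z (x(i := y))) = 0" for x
  proof -
    define \<xi> where "\<xi> = (\<lambda>j\<in>{..<m}. (1 / t) *\<^sub>R (z - x j))"
    have K1: "(\<lambda>j\<in>{..<m}. (1 / t) *\<^sub>R (z - (x(i := y)) j)) = \<xi>(i := (1 / t) *\<^sub>R (z - y))" for y
      using i by (auto simp: \<xi>_def fun_eq_iff)
    have P1: "(\<Prod>j<m. g j ((x(i := y)) j)) = c * (\<Prod>j\<in>?J. g j (x j))" for y
      using i by (subst prod.remove[of _ i]) (auto simp: gi intro!: arg_cong2[where f="(*)"] prod.cong)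
    have m1: "(\<lambda>w. K (\<xi>(i := w))) \<in> borel_measurable borel"
    proof -
      have "(\<lambda>w. \<lambda>j\<in>{..<m}. (\<xi>(i := w)) j) \<in> measurable borel (PiM {..<m} (\<lambda>_. lborel))"
        by (rule measurable_restrict) (auto split: if_splits)
      moreover have "(\<lambda>j\<in>{..<m}. (\<xi>(i := w)) j) = \<xi>(i := w)" for w
        using i by (auto simp: \<xi>_def fun_eq_iff)
      ultimately have "(\<lambda>w. \<xi>(i := w)) \<in> measurable borel (PiM {..<m} (\<lambda>_. lborel))" by (simp only:)
      then show ?thesis by (rule measurable_compose[OF _ K_meas])
    qed
    have "(LINT y|lborel. K (\<xi>(i := (1 / t) *\<^sub>R (z - y)))) = 0"
      by (rule lborel_integral_reflect_scale_eq_0[OF m1 t K_canc[OF i]])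
    then show ?thesis unfolding Phi_def Ks_def K1 P1 by simp
  qed
  have "(LINT y|PiM {..<m} (\<lambda>_. lborel). Phi g t z y) = (LINT x|PiM ?J (\<lambda>_. lborel). LINT y|lborel. Phi g t z (x(i := y)))"
    by (rule lborel_PiM.product_integral_insert[of ?J i "Phi g t z", unfolded ins])
      (auto intro: Phi_integrable[OF t g])
  also have "\<dots> = 0" by (simp only: inner) simp
  finally show ?thesis .
qed

text \<open>By linearity in slot \<open>i\<close> the integral splits into one with
  \<open>g i - c i\<close> and one with the constant \<open>c i\<close>, and the latter vanishes.
  All shifts are assumed admissible because treated slots carry \<open>g j - c j\<close> and the
  others still carry \<open>g j\<close>.\<close>

lemma Phi_shift:
  assumes t: "0 < t" and g: "\<And>j d. j < m \<Longrightarrow> adm t z (\<lambda>y. g j y - d)" and I: "I \<subseteq> {..<m}"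
  shows "(LINT y|PiM {..<m} (\<lambda>_. lborel). Phi g t z y)
    = (LINT y|PiM {..<m} (\<lambda>_. lborel). Phi (\<lambda>j. if j \<in> I then (\<lambda>y. g j y - c j) else g j) t z y)"
proof -
  have "finite I" using I finite_subset by blast
  then show ?thesis using I
  proof (induction I)
    case (insert i I)
    then have i: "i < m" by simp
    let ?g1 = "\<lambda>j. if j \<in> I then (\<lambda>y. g j y - c j) else g j"
    let ?g2 = "\<lambda>j. if j \<in> insert i I then (\<lambda>y. g j y - c j) else g j"
    let ?g3 = "?g1(i := (\<lambda>_. c i))"
    have g0: "adm t z (g j)" if "j < m" for j using g[OF that, of 0] by simp
    have adm2: "adm t z (?g2 j)" if "j < m" for j using g[OF that] g0[OF that] by simp
    have adm3: "adm t z (?g3 j)" if "j < m" for j using g[OF that] g0[OF that] adm_const[OF t] by simp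
    have split: "(\<Prod>j<m. u j (y j)) = u i (y i) * (\<Prod>j\<in>{..<m} - {i}. u j (y j))" for u :: "nat \<Rightarrow> 'a \<Rightarrow> real" and y
      using i by (intro prod.remove) auto
    have "Phi ?g1 t z y = Phi ?g2 t z y + Phi ?g3 t z y" for y
    proof -
      have "(\<Prod>j\<in>{..<m} - {i}. ?g2 j (y j)) = (\<Prod>j\<in>{..<m} - {i}. ?g1 j (y j))"
        "(\<Prod>j\<in>{..<m} - {i}. ?g3 j (y j)) = (\<Prod>j\<in>{..<m} - {i}. ?g1 j (y j))"
        by (auto intro!: prod.cong)
      then show ?thesis
        unfolding Phi_def split[of ?g1] split[of ?g2] split[of ?g3]
        using insert.hyps by (simp add: algebra_simps)
    qed
    moreover have "integrable (PiM {..<m} (\<lambda>_. lborel)) (Phi ?g2 t z)" "integrable (PiM {..<m} (\<lambda>_. lborel)) (Phi ?g3 t z)"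
      by (rule Phi_integrable[OF t], rule adm2, assumption) (rule Phi_integrable[OF t], rule adm3, assumption)
    ultimately have "(LINT y|PiM {..<m} (\<lambda>_. lborel). Phi ?g1 t z y) = (LINT y|PiM {..<m} (\<lambda>_. lborel). Phi ?g2 t z y) + (LINT y|PiM {..<m} (\<lambda>_. lborel). Phi ?g3 t z y)"
      by (simp only: Bochner_Integration.integral_add)
    also have "(LINT y|PiM {..<m} (\<lambda>_. lborel). Phi ?g3 t z y) = 0"
      by (rule Phi_const_slot[OF t _ i]) (rule adm3, assumption, simp)
    finally show ?case using insert by simp
  qed simp
qed

lemma Phi_fold:
  assumes t: "0 < t" and g: "\<And>j. j < m \<Longrightarrow> adm t z (g j)"
  shows "(LINT y|PiM {..<m} (\<lambda>_. lborel). Phi g t z y)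
    = (LINT y|lborel. (LINT v|PiM {1..<m} (\<lambda>_. lborel). Ks t z (v(0 := y)) * (\<Prod>j\<in>{1..<m}. g j (v j))) * g 0 y)"
proof -
  let ?J = "{1..<m}"
  have un: "{0} \<union> ?J = {..<m}" using m by auto
  have [measurable]: "g 0 \<in> borel_measurable borel" using g[OF m] by (rule adm_measurable)
  define F where "F y = (LINT v|PiM ?J (\<lambda>_. lborel). Ks t z (v(0 := y)) * (\<Prod>j\<in>?J. g j (v j)))" for y
  have [measurable]: "F \<in> borel_measurable lborel"
  proof -
    interpret finite_product_sigma_finite "\<lambda>_ :: nat. lborel :: 'a measure" ?J by standard simp
    have [measurable]: "(\<lambda>x. \<Prod>j\<in>?J. g j (snd x j)) \<in> borel_measurable (lborel \<Otimes>\<^sub>M PiM ?J (\<lambda>_. lborel))"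
    proof (rule borel_measurable_prod)
      fix j assume j: "j \<in> ?J"
      then have "j < m" by simp
      from adm_measurable[OF g[OF this]] have [measurable]: "g j \<in> borel_measurable borel" .
      show "(\<lambda>x. g j (snd x j)) \<in> borel_measurable (lborel \<Otimes>\<^sub>M PiM ?J (\<lambda>_. lborel))" using j by measurable
    qed
    have [measurable]: "(\<lambda>x. Ks t z ((snd x)(0 := fst x))) \<in> borel_measurable (lborel \<Otimes>\<^sub>M PiM ?J (\<lambda>_. lborel))"
    proof (rule Ks_measurable)
      fix j assume "j < m"
      then show "(\<lambda>x. ((snd x)(0 := fst x)) j) \<in> borel_measurable (lborel \<Otimes>\<^sub>M PiM ?J (\<lambda>_. lborel))"
        by (cases "j = 0") auto
    qed auto
    have "(\<lambda>p. Ks t z ((snd p)(0 := fst p)) * (\<Prod>j\<in>?J. g j (snd p j))) \<in> borel_measurable (lborel \<Otimes>\<^sub>M PiM ?J (\<lambda>_. lborel))"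
      by measurable
    then show ?thesis unfolding F_def by (intro borel_measurable_lebesgue_integral) (simp only: case_prod_unfold)
  qed
  have "(LINT y|PiM {..<m} (\<lambda>_. lborel). Phi g t z y)
    = (LINT x|PiM {0} (\<lambda>_. lborel). LINT v|PiM ?J (\<lambda>_. lborel). Phi g t z (merge {0} ?J (x, v)))"
    by (rule lborel_PiM.product_integral_fold[of "{0}" ?J "Phi g t z", unfolded un])
      (auto intro: Phi_integrable[OF t g])
  also have "\<dots> = (LINT x|PiM {0::nat} (\<lambda>_. lborel). F (x 0) * g 0 (x 0))"
  proof (intro Bochner_Integration.integral_cong refl)
    fix x :: "nat \<Rightarrow> 'a"
    have "Phi g t z (merge {0} ?J (x, v)) = Ks t z (v(0 := x 0)) * (\<Prod>j\<in>?J. g j (v j)) * g 0 (x 0)" for v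
    proof -
      have "{..<m} = insert 0 ?J" using m by auto
      then have "(\<Prod>j<m. g j (merge {0} ?J (x, v) j)) = g 0 (x 0) * (\<Prod>j\<in>?J. g j (v j))"
        by (auto simp: merge_def intro!: prod.cong)
      moreover have "Ks t z (merge {0} ?J (x, v)) = Ks t z (v(0 := x 0))"
        unfolding Ks_def by (intro arg_cong2[where f="(*)"] arg_cong[where f=K] refl) (auto simp: fun_eq_iff merge_def)
      ultimately show ?thesis by (simp add: Phi_def mult_ac)
    qed
    then show "(LINT v|PiM ?J (\<lambda>_. lborel). Phi g t z (merge {0} ?J (x, v))) = F (x 0) * g 0 (x 0)"
      by (simp add: F_def)
  qed
  also have "\<dots> = (LINT y|lborel. F y * g 0 y)"
    by (rule lborel_PiM.product_integral_singleton) measurable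
  finally show ?thesis by (simp add: F_def)
qed

end

subsection \<open>Freezing all slots but the first\<close>

context multilinear_kernel
begin

text \<open>The subtracted means depend on \<open>(z, t)\<close>, so this kernel need not be of
  convolution type; the linear theory asks only for size, regularity and cancellation in
  \<open>y\<close>.\<close>

definition lin_kernel :: "(nat \<Rightarrow> 'a \<Rightarrow> real) \<Rightarrow> 'a \<times> real \<Rightarrow> 'a \<Rightarrow> real" where
  "lin_kernel f p y = (LINT v|PiM {1..<m} (\<lambda>_. lborel). Ks (snd p) (fst p) (v(0 := y)) *
     (\<Prod>j\<in>{1..<m}. f j (v j) - avg_ball (f j) (fst p) (snd p)))"

definition cw :: real where "cw = wt_const DIM('a) a * (2 ^ DIM('a) * ubv DIM('a))"

definition A0 :: "(nat \<Rightarrow> real) \<Rightarrow> real" where "A0 b = C * (\<Prod>j\<in>{1..<m}. cw * b j)"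

lemma cw_pos: "0 < cw" using wt_const_pos[OF a] by (simp add: cw_def)

lemma prod_split: "(\<Prod>j<m. u j) = u 0 * (\<Prod>j\<in>{1..<m}. u j)" for u :: "nat \<Rightarrow> real"
proof -
  have "{..<m} = insert 0 {1..<m}" using m by auto
  then show ?thesis by simp
qed

context
  fixes f :: "nat \<Rightarrow> 'a \<Rightarrow> real" and b :: "nat \<Rightarrow> real"
  assumes bmo: "\<And>j. j < m \<Longrightarrow> bmo_le (f j) (b j)" and b_pos: "\<And>j. j < m \<Longrightarrow> 0 < b j"
begin

lemma f_meas: "j < m \<Longrightarrow> f j \<in> borel_measurable borel"
  using bmo by (simp add: bmo_le_def loc_int_measurable)

lemma prod_le_ennreal: "(\<And>i. i \<in> I \<Longrightarrow> u i \<le> v i) \<Longrightarrow> prod u I \<le> prod v I" for u v :: "'i \<Rightarrow> ennreal"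
  by (induction I rule: infinite_finite_induct) (auto intro!: mult_mono)

lemma LP_G_measurable: "(\<lambda>p. LP_G m K f (snd p) (fst p)) \<in> borel_measurable (lborel \<Otimes>\<^sub>M lborel)"
proof -
  interpret finite_product_sigma_finite "\<lambda>_ :: nat. lborel :: 'a measure" "{..<m}" by standard simp
  let ?M = "(lborel \<Otimes>\<^sub>M lborel) \<Otimes>\<^sub>M PiM {..<m} (\<lambda>_. lborel) :: (('a \<times> real) \<times> (nat \<Rightarrow> 'a)) measure"
  have [measurable]: "(\<lambda>x. \<Prod>j<m. f j (snd x j)) \<in> borel_measurable ?M"
  proof (rule borel_measurable_prod)
    fix j assume j: "j \<in> {..<m}"
    then have [measurable]: "f j \<in> borel_measurable borel" using f_meas by simp
    show "(\<lambda>x. f j (snd x j)) \<in> borel_measurable ?M" using j by measurable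
  qed
  have [measurable]: "(\<lambda>x. Ks (snd (fst x)) (fst (fst x)) (snd x)) \<in> borel_measurable ?M"
  proof (rule Ks_measurable)
    fix j assume "j < m"
    then have "j \<in> {..<m}" by simp
    then show "(\<lambda>x. snd x j) \<in> borel_measurable ?M" by measurable
  qed measurable
  have "(\<lambda>x. Phi f (snd (fst x)) (fst (fst x)) (snd x)) \<in> borel_measurable ?M"
    unfolding Phi_def by measurable
  then show ?thesis unfolding LP_G_eq by (intro borel_measurable_lebesgue_integral) (simp only: case_prod_unfold)
qed

lemma lin_integrand_measurable:
  assumes [measurable]: "T \<in> borel_measurable M" "Z \<in> borel_measurable M" "Y \<in> borel_measurable M"
    and V: "V \<in> measurable M (PiM {1..<m} (\<lambda>_. lborel))"
  shows "(\<lambda>x. Ks (T x) (Z x) ((V x)(0 := Y x)) * (\<Prod>j\<in>{1..<m}. f j (V x j) - avg_ball (f j) (Z x) (T x))) \<in> borel_measurable M"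
proof -
  have Vj: "(\<lambda>x. V x j) \<in> borel_measurable M" if "j \<in> {1..<m}" for j
    using measurable_compose[OF V measurable_component_singleton[OF that]] by simp
  have [measurable]: "(\<lambda>x. \<Prod>j\<in>{1..<m}. f j (V x j) - avg_ball (f j) (Z x) (T x)) \<in> borel_measurable M"
  proof (rule borel_measurable_prod)
    fix j assume j: "j \<in> {1..<m}"
    have [measurable]: "f j \<in> borel_measurable borel" using f_meas j by simp
    have [measurable]: "(\<lambda>x. V x j) \<in> borel_measurable M" by (rule Vj[OF j])
    show "(\<lambda>x. f j (V x j) - avg_ball (f j) (Z x) (T x)) \<in> borel_measurable M" by measurable
  qed
  have [measurable]: "(\<lambda>x. Ks (T x) (Z x) ((V x)(0 := Y x))) \<in> borel_measurable M"
  proof (rule Ks_measurable)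
    fix j assume j: "j < m"
    show "(\<lambda>x. ((V x)(0 := Y x)) j) \<in> borel_measurable M"
    proof (cases "j = 0")
      case False
      then have "j \<in> {1..<m}" using j by simp
      then show ?thesis using Vj False by simp
    qed simp
  qed measurable
  show ?thesis by measurable
qed

lemma lin_kernel_measurable: "case_prod (lin_kernel f) \<in> borel_measurable ((lborel \<Otimes>\<^sub>M lborel) \<Otimes>\<^sub>M lborel)"
proof -
  interpret finite_product_sigma_finite "\<lambda>_ :: nat. lborel :: 'a measure" "{1..<m}" by standard simp
  have "(\<lambda>x. Ks (snd (fst (fst x))) (fst (fst (fst x))) ((snd x)(0 := snd (fst x))) *
    (\<Prod>j\<in>{1..<m}. f j (snd x j) - avg_ball (f j) (fst (fst (fst x))) (snd (fst (fst x)))))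
    \<in> borel_measurable (((lborel \<Otimes>\<^sub>M lborel) \<Otimes>\<^sub>M lborel) \<Otimes>\<^sub>M PiM {1..<m} (\<lambda>_. lborel))"
    by (rule lin_integrand_measurable) measurable
  then show ?thesis
    unfolding lin_kernel_def[abs_def] case_prod_unfold
    by (intro borel_measurable_lebesgue_integral) (simp only: case_prod_unfold)
qed

lemma A0_pos: "0 < A0 b" unfolding A0_def using C cw_pos b_pos by (intro mult_pos_pos prod_pos) auto

lemma weighted_prod_le:
  assumes t: "0 < t"
  shows "(\<integral>\<^sup>+v. ennreal (\<Prod>j\<in>{1..<m}. wt a t (z - v j) * \<bar>f j (v j) - avg_ball (f j) z t\<bar>) \<partial>PiM {1..<m} (\<lambda>_. lborel))
    \<le> ennreal (\<Prod>j\<in>{1..<m}. cw * b j)"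
proof -
  have "(\<integral>\<^sup>+v. ennreal (\<Prod>j\<in>{1..<m}. wt a t (z - v j) * \<bar>f j (v j) - avg_ball (f j) z t\<bar>) \<partial>PiM {1..<m} (\<lambda>_. lborel))
    = (\<Prod>j\<in>{1..<m}. \<integral>\<^sup>+y. ennreal (wt a t (z - y)) * ennreal \<bar>f j y - avg_ball (f j) z t\<bar> \<partial>lborel)"
    by (rule prod_nn_bound[OF t, of _ z "\<lambda>j y. f j y - avg_ball (f j) z t"]) (auto intro: adm_bmo[OF bmo t])
  also have "\<dots> \<le> (\<Prod>j\<in>{1..<m}. ennreal (cw * b j))"
  proof (rule prod_le_ennreal)
    fix j assume "j \<in> {1..<m}"
    then show "(\<integral>\<^sup>+y. ennreal (wt a t (z - y)) * ennreal \<bar>f j y - avg_ball (f j) z t\<bar> \<partial>lborel) \<le> ennreal (cw * b j)"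
      using bmo_wt_integral[OF bmo t a, of j z] by (simp add: cw_def mult_ac)
  qed
  also have "\<dots> = ennreal (\<Prod>j\<in>{1..<m}. cw * b j)"
    using cw_pos b_pos by (intro prod_ennreal) (auto intro!: mult_nonneg_nonneg less_imp_le)
  finally show ?thesis .
qed

text \<open>\<open>H\<close> will be the kernel itself for the size estimate, and a difference of
  two of its values for the regularity estimate.\<close>

lemma weighted_integral_le:
  assumes t: "0 < t" and c: "0 \<le> c"
    and H: "\<And>v. \<bar>H v\<bar> \<le> c * (\<Prod>j\<in>{1..<m}. wt a t (z - v j))"
  shows "(\<integral>\<^sup>+v. ennreal \<bar>H v * (\<Prod>j\<in>{1..<m}. f j (v j) - avg_ball (f j) z t)\<bar> \<partial>PiM {1..<m} (\<lambda>_. lborel))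
    \<le> ennreal (c * (\<Prod>j\<in>{1..<m}. cw * b j))"
proof -
  let ?P = "\<lambda>v. \<Prod>j\<in>{1..<m}. wt a t (z - v j) * \<bar>f j (v j) - avg_ball (f j) z t\<bar>"
  have Pm: "?P \<in> borel_measurable (PiM {1..<m} (\<lambda>_. lborel))"
  proof (rule borel_measurable_prod)
    fix j assume j: "j \<in> {1..<m}"
    then have [measurable]: "f j \<in> borel_measurable borel" using f_meas by simp
    show "(\<lambda>v. wt a t (z - v j) * \<bar>f j (v j) - avg_ball (f j) z t\<bar>) \<in> borel_measurable (PiM {1..<m} (\<lambda>_. lborel))"
      using j by measurable
  qed
  have "(\<integral>\<^sup>+v. ennreal \<bar>H v * (\<Prod>j\<in>{1..<m}. f j (v j) - avg_ball (f j) z t)\<bar> \<partial>PiM {1..<m} (\<lambda>_. lborel))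
    \<le> (\<integral>\<^sup>+v. ennreal c * ennreal (?P v) \<partial>PiM {1..<m} (\<lambda>_. lborel))"
  proof (rule nn_integral_mono)
    fix v
    have "\<bar>H v * (\<Prod>j\<in>{1..<m}. f j (v j) - avg_ball (f j) z t)\<bar> \<le> c * (\<Prod>j\<in>{1..<m}. wt a t (z - v j)) * \<bar>\<Prod>j\<in>{1..<m}. f j (v j) - avg_ball (f j) z t\<bar>"
      unfolding abs_mult by (intro mult_right_mono H) auto
    also have "\<dots> = c * ?P v" by (simp add: prod.distrib abs_prod mult.assoc)
    finally show "ennreal \<bar>H v * (\<Prod>j\<in>{1..<m}. f j (v j) - avg_ball (f j) z t)\<bar> \<le> ennreal c * ennreal (?P v)"
      using c t by (subst ennreal_mult[symmetric]) (auto intro!: ennreal_leI prod_nonneg)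
  qed
  also have "\<dots> = ennreal c * (\<integral>\<^sup>+v. ennreal (?P v) \<partial>PiM {1..<m} (\<lambda>_. lborel))"
    by (intro nn_integral_cmult measurable_compose[OF Pm measurable_ennreal])
  also have "\<dots> \<le> ennreal c * ennreal (\<Prod>j\<in>{1..<m}. cw * b j)"
    by (intro mult_left_mono weighted_prod_le t) auto
  also have "\<dots> = ennreal (c * (\<Prod>j\<in>{1..<m}. cw * b j))"
    using c cw_pos b_pos by (intro ennreal_mult[symmetric] prod_nonneg) (auto intro!: mult_nonneg_nonneg less_imp_le)
  finally show ?thesis .
qed

lemma Ks_update_le:
  assumes t: "0 < t"
  shows "\<bar>Ks t z (v(0 := y))\<bar> \<le> C * wt a t (z - y) * (\<Prod>j\<in>{1..<m}. wt a t (z - v j))"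
proof -
  have "(\<Prod>j<m. wt a t (z - (v(0 := y)) j)) = wt a t (z - y) * (\<Prod>j\<in>{1..<m}. wt a t (z - v j))"
    unfolding prod_split by simp
  then show ?thesis using Ks_size[OF t, of z "v(0 := y)"] by (simp add: mult.assoc)
qed

lemma lin_integrand_integrable:
  assumes t: "0 < t"
  shows "integrable (PiM {1..<m} (\<lambda>_. lborel)) (\<lambda>v. Ks t z (v(0 := y)) * (\<Prod>j\<in>{1..<m}. f j (v j) - avg_ball (f j) z t))"
proof (rule integrableI_bounded)
  show "(\<lambda>v. Ks t z (v(0 := y)) * (\<Prod>j\<in>{1..<m}. f j (v j) - avg_ball (f j) z t)) \<in> borel_measurable (PiM {1..<m} (\<lambda>_. lborel))"
    by (rule lin_integrand_measurable) measurable
  have "0 \<le> C * wt a t (z - y)" using C t by simp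
  from weighted_integral_le[OF t this Ks_update_le[OF t]]
  show "(\<integral>\<^sup>+v. ennreal (norm (Ks t z (v(0 := y)) * (\<Prod>j\<in>{1..<m}. f j (v j) - avg_ball (f j) z t))) \<partial>PiM {1..<m} (\<lambda>_. lborel)) < \<infinity>"
    by (auto intro: order.strict_trans1)
qed

lemma lin_kernel_size:
  assumes t: "0 < t"
  shows "\<bar>lin_kernel f (z, t) y\<bar> \<le> A0 b * wt a t (z - y)"
proof -
  have c: "0 \<le> C * wt a t (z - y)" using C t by simp
  have "ennreal \<bar>lin_kernel f (z, t) y\<bar> \<le> (\<integral>\<^sup>+v. ennreal (norm (Ks t z (v(0 := y)) * (\<Prod>j\<in>{1..<m}. f j (v j) - avg_ball (f j) z t))) \<partial>PiM {1..<m} (\<lambda>_. lborel))"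
    unfolding lin_kernel_def real_norm_def[symmetric] using integral_norm_bound_ennreal[OF lin_integrand_integrable[OF t]] by simp
  also have "\<dots> \<le> ennreal (C * wt a t (z - y) * (\<Prod>j\<in>{1..<m}. cw * b j))"
    using weighted_integral_le[OF t c Ks_update_le[OF t]] by simp
  also have "C * wt a t (z - y) * (\<Prod>j\<in>{1..<m}. cw * b j) = A0 b * wt a t (z - y)" by (simp add: A0_def mult_ac)
  finally show ?thesis using A0_pos t by (simp add: ennreal_le_iff)
qed

lemma lin_kernel_reg:
  assumes t: "0 < t" and y: "y \<noteq> z" "y' \<noteq> z"
  shows "\<bar>lin_kernel f (z, t) y - lin_kernel f (z, t) y'\<bar>
    \<le> A0 b * (norm (y - y') / t) powr e * (sing_wt e a t (z - y) + sing_wt e a t (z - y'))"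
proof -
  define c where "c = C * (norm (y - y') / t) powr e * (sing_wt e a t (z - y) + sing_wt e a t (z - y'))"
  have c: "0 \<le> c" unfolding c_def using C t by (intro mult_nonneg_nonneg add_nonneg_nonneg) auto
  let ?P = "\<lambda>v. \<Prod>j\<in>{1..<m}. f j (v j) - avg_ball (f j) z t"
  let ?H = "\<lambda>v. Ks t z (v(0 := y)) - Ks t z (v(0 := y'))"
  have H: "\<bar>?H v\<bar> \<le> c * (\<Prod>j\<in>{1..<m}. wt a t (z - v j))" for v
    using Ks_reg[OF t, of "v(0 := y)" z y'] y by (simp add: c_def)
  have int: "integrable (PiM {1..<m} (\<lambda>_. lborel)) (\<lambda>v. ?H v * ?P v)"
    unfolding left_diff_distrib by (intro Bochner_Integration.integrable_diff lin_integrand_integrable t)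
  have "lin_kernel f (z, t) y - lin_kernel f (z, t) y' = (LINT v|PiM {1..<m} (\<lambda>_. lborel). ?H v * ?P v)"
    unfolding lin_kernel_def fst_conv snd_conv left_diff_distrib
    by (intro Bochner_Integration.integral_diff[symmetric] lin_integrand_integrable t)
  then have "ennreal \<bar>lin_kernel f (z, t) y - lin_kernel f (z, t) y'\<bar> \<le> (\<integral>\<^sup>+v. ennreal (norm (?H v * ?P v)) \<partial>PiM {1..<m} (\<lambda>_. lborel))"
    using integral_norm_bound_ennreal[OF int] by simp
  also have "\<dots> \<le> ennreal (c * (\<Prod>j\<in>{1..<m}. cw * b j))"
    using weighted_integral_le[OF t c H] by simp
  also have "c * (\<Prod>j\<in>{1..<m}. cw * b j) = A0 b * (norm (y - y') / t) powr e * (sing_wt e a t (z - y) + sing_wt e a t (z - y'))"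
    by (simp add: A0_def c_def mult_ac)
  finally show ?thesis using A0_pos t by (subst (asm) ennreal_le_iff) auto
qed

text \<open>With the constant 1 in slot 0, folding back produces a multilinear integral with a
  constant slot.\<close>

lemma lin_kernel_canc:
  assumes t: "0 < t"
  shows "(LINT y|lborel. lin_kernel f (z, t) y) = 0"
proof -
  let ?g = "\<lambda>j. if j = 0 then (\<lambda>_. 1) else (\<lambda>y. f j y - avg_ball (f j) z t)"
  have adm: "adm t z (?g j)" if "j < m" for j
    using adm_const[OF t] adm_bmo[OF bmo[OF that] t] by simp
  have pr: "(\<Prod>j\<in>{1..<m}. ?g j (v j)) = (\<Prod>j\<in>{1..<m}. f j (v j) - avg_ball (f j) z t)" for v
    by (intro prod.cong) auto
  have "(LINT y|lborel. lin_kernel f (z, t) y)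
    = (LINT y|lborel. (LINT v|PiM {1..<m} (\<lambda>_. lborel). Ks t z (v(0 := y)) * (\<Prod>j\<in>{1..<m}. ?g j (v j))) * ?g 0 y)"
    unfolding lin_kernel_def pr fst_conv snd_conv by simp
  also have "\<dots> = (LINT y|PiM {..<m} (\<lambda>_. lborel). Phi ?g t z y)"
    by (rule Phi_fold[OF t, symmetric]) (rule adm)
  also have "\<dots> = 0"
    by (rule Phi_const_slot[OF t _ m]) (rule adm, assumption, simp)
  finally show ?thesis .
qed

text \<open>Only the slots from 1 on are shifted; slot 0 keeps \<open>f 0\<close>, since the linear
  estimates choose their own constants to subtract.\<close>

lemma LP_G_eq_lin:
  assumes t: "0 < t"
  shows "LP_G m K f t z = (LINT y|lborel. lin_kernel f (z, t) y * f 0 y)"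
proof -
  let ?g = "\<lambda>j. if j \<in> {1..<m} then (\<lambda>y. f j y - avg_ball (f j) z t) else f j"
  have adm: "adm t z (?g j)" if "j < m" for j
    using adm_bmo[OF bmo[OF that] t] adm_bmo[OF bmo[OF that] t, of z 0] by simp
  have "LP_G m K f t z = (LINT y|PiM {..<m} (\<lambda>_. lborel). Phi ?g t z y)"
    unfolding LP_G_eq by (rule Phi_shift[OF t adm_bmo[OF bmo t]]) auto
  also have "\<dots> = (LINT y|lborel. (LINT v|PiM {1..<m} (\<lambda>_. lborel). Ks t z (v(0 := y)) * (\<Prod>j\<in>{1..<m}. ?g j (v j))) * ?g 0 y)"
    by (rule Phi_fold[OF t]) (rule adm)
  also have "\<dots> = (LINT y|lborel. lin_kernel f (z, t) y * f 0 y)"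
  proof -
    have pr: "(\<Prod>j\<in>{1..<m}. ?g j (v j)) = (\<Prod>j\<in>{1..<m}. f j (v j) - avg_ball (f j) z t)" for v
      by (intro prod.cong) auto
    show ?thesis unfolding lin_kernel_def pr fst_conv snd_conv by simp
  qed
  finally show ?thesis .
qed

lemma lin_square_kernel:
  assumes S: "0 < S" and sing: "\<And>t z. 0 < t \<Longrightarrow> (\<integral>\<^sup>+y. ennreal (sing_wt e a t (z - y :: 'a)) \<partial>lborel) \<le> ennreal S"
  shows "square_kernel a e S (A0 b) (lin_kernel f)"
  by standard (use e A0_pos S sing lin_kernel_measurable lin_kernel_size lin_kernel_reg lin_kernel_canc in auto)

end

end

text \<open>These three facts are all that the comparison of cones asks of \<open>LP_G\<close>. One
  constant serves every \<open>f\<close>, and the bounds \<open>b\<close> enter through their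
  product.\<close>

lemma LP_G_estimates:
  fixes K :: "(nat \<Rightarrow> 'a::euclidean_space) \<Rightarrow> real"
  assumes "LP_kernel m K" and m: "0 < m"
  shows "\<exists>C>0. \<forall>f b. (\<forall>j<m. bmo_le (f j) (b j) \<and> 0 < b j) \<longrightarrow>
    (\<lambda>p. LP_G m K f (snd p) (fst p)) \<in> borel_measurable (lborel \<Otimes>\<^sub>M lborel) \<and>
    (\<forall>t>0. \<forall>z. \<bar>LP_G m K f t z\<bar> \<le> C * (\<Prod>j<m. b j)) \<and>
    (\<forall>x0. \<forall>r>0. (\<integral>\<^sup>+p. indicator (ball x0 (2 * r) \<times> {0<..r}) p * ennreal ((LP_G m K f (snd p) (fst p))\<^sup>2 / snd p) \<partial>(lborel \<Otimes>\<^sub>M lborel))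
      \<le> ennreal (C * (\<Prod>j<m. b j)\<^sup>2 * r ^ DIM('a)))"
proof -
  obtain C0 a e where "multilinear_kernel m K C0 a e"
    using LP_kernel_multilinear_kernel[OF assms] by blast
  then interpret multilinear_kernel m K C0 a e .
  obtain S where S: "0 < S" "\<And>t z. 0 < t \<Longrightarrow> (\<integral>\<^sup>+y. ennreal (sing_wt e a t (z - y :: 'a)) \<partial>lborel) \<le> ennreal S"
    using nn_integral_sing_wt_le[OF a e(1,2), where 'a='a] by blast
  obtain Cc where Cc: "0 < Cc" and carl: "\<And>A (k :: 'a \<times> real \<Rightarrow> 'a \<Rightarrow> real) f b x0 r.
    square_kernel a e S A k \<Longrightarrow> bmo_le f b \<Longrightarrow> 0 < b \<Longrightarrow> 0 < r \<Longrightarrow>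
    (\<integral>\<^sup>+p. indicator (ball x0 (2 * r) \<times> {0<..r}) p * ennreal ((LINT y|lborel. k p y * f y)\<^sup>2 / snd p) \<partial>(lborel \<Otimes>\<^sub>M lborel))
     \<le> ennreal (Cc * (A * b)\<^sup>2 * r ^ DIM('a))"
    using carleson_uniform[of a e S, where 'a='a] by blast
  \<comment> \<open>As \<open>A0 b\<close> contains \<open>m - 1\<close> factors \<open>cw\<close>,
    this makes \<open>A0 b * b 0\<close> equal to \<open>c\<close> times the product of all
    \<open>b j\<close>.\<close>
  define c where "c = C0 * cw ^ (m - 1)"
  define w where "w = wt_const DIM('a) a * ubv DIM('a)"
  have c: "0 < c" using C cw_pos by (simp add: c_def)
  have w: "0 < w" using wt_const_pos[OF a] by (simp add: w_def)
  define D where "D = max (c * (w * 2 ^ DIM('a))) (Cc * c\<^sup>2)"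
  have D: "0 < D" using c w by (simp add: D_def less_max_iff_disj)
  show ?thesis
  proof (intro exI[of _ D] conjI D allI impI)
    fix f :: "nat \<Rightarrow> 'a \<Rightarrow> real" and b
    assume "\<forall>j<m. bmo_le (f j) (b j) \<and> 0 < b j"
    then have f: "\<And>j. j < m \<Longrightarrow> bmo_le (f j) (b j)" and b: "\<And>j. j < m \<Longrightarrow> 0 < b j" by auto
    have Ab: "A0 b * b 0 = c * (\<Prod>j<m. b j)"
      using prod_split[of b] by (simp add: A0_def[of b] c_def prod.distrib)
    have B: "0 < (\<Prod>j<m. b j)" using b by (intro prod_pos) auto
    have A: "square_kernel a e S (A0 b) (lin_kernel f)" by (rule lin_square_kernel[OF f b S])
    show "(\<lambda>p. LP_G m K f (snd p) (fst p)) \<in> borel_measurable (lborel \<Otimes>\<^sub>M lborel)"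
      by (rule LP_G_measurable[OF f b])
    fix t :: real and z :: 'a assume t: "0 < t"
    have G: "LP_G m K f t z = (LINT y|lborel. lin_kernel f (z, t) y * f 0 y)"
      by (rule LP_G_eq_lin[of f b]) (use f b t in auto)
    have "\<bar>LP_G m K f t z\<bar> \<le> A0 b * (w * (2 ^ DIM('a) * b 0))"
      unfolding G w_def
      using square_kernel.transform_bound[OF A f[OF m] t] by (simp add: square_kernel.W0_def[OF A])
    also have "\<dots> = (w * 2 ^ DIM('a)) * (A0 b * b 0)" by simp
    also have "\<dots> = c * (w * 2 ^ DIM('a)) * (\<Prod>j<m. b j)" unfolding Ab by simp
    also have "\<dots> \<le> D * (\<Prod>j<m. b j)" using B by (intro mult_right_mono) (auto simp: D_def)
    finally show "\<bar>LP_G m K f t z\<bar> \<le> D * (\<Prod>j<m. b j)" .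
  next
    fix f :: "nat \<Rightarrow> 'a \<Rightarrow> real" and b and x0 :: 'a and r :: real
    assume "\<forall>j<m. bmo_le (f j) (b j) \<and> 0 < b j" and r: "0 < r"
    then have f: "\<And>j. j < m \<Longrightarrow> bmo_le (f j) (b j)" and b: "\<And>j. j < m \<Longrightarrow> 0 < b j" by auto
    have Ab: "A0 b * b 0 = c * (\<Prod>j<m. b j)"
      using prod_split[of b] by (simp add: A0_def[of b] c_def prod.distrib)
    have A: "square_kernel a e S (A0 b) (lin_kernel f)" by (rule lin_square_kernel[OF f b S])
    have "(\<integral>\<^sup>+p. indicator (ball x0 (2 * r) \<times> {0<..r}) p * ennreal ((LP_G m K f (snd p) (fst p))\<^sup>2 / snd p) \<partial>(lborel \<Otimes>\<^sub>M lborel))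
      = (\<integral>\<^sup>+p. indicator (ball x0 (2 * r) \<times> {0<..r}) p * ennreal ((LINT y|lborel. lin_kernel f p y * f 0 y)\<^sup>2 / snd p) \<partial>(lborel \<Otimes>\<^sub>M lborel))"
    proof (intro nn_integral_cong)
      fix p :: "'a \<times> real"
      show "indicator (ball x0 (2 * r) \<times> {0<..r}) p * ennreal ((LP_G m K f (snd p) (fst p))\<^sup>2 / snd p)
        = indicator (ball x0 (2 * r) \<times> {0<..r}) p * ennreal ((LINT y|lborel. lin_kernel f p y * f 0 y)\<^sup>2 / snd p)"
        using LP_G_eq_lin[of f b "snd p" "fst p"] f b by (cases "0 < snd p") (auto simp: indicator_def)
    qed
    also have "\<dots> \<le> ennreal (Cc * (A0 b * b 0)\<^sup>2 * r ^ DIM('a))"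
      by (rule carl[OF A f[OF m] b[OF m] r])
    also have "\<dots> \<le> ennreal (D * (\<Prod>j<m. b j)\<^sup>2 * r ^ DIM('a))"
    proof (rule ennreal_leI)
      have "Cc * (A0 b * b 0)\<^sup>2 * r ^ DIM('a) = (Cc * c\<^sup>2) * (\<Prod>j<m. b j)\<^sup>2 * r ^ DIM('a)"
        unfolding Ab by (simp add: power_mult_distrib)
      also have "\<dots> \<le> D * (\<Prod>j<m. b j)\<^sup>2 * r ^ DIM('a)"
        using r by (intro mult_right_mono) (auto simp: D_def)
      finally show "Cc * (A0 b * b 0)\<^sup>2 * r ^ DIM('a) \<le> D * (\<Prod>j<m. b j)\<^sup>2 * r ^ DIM('a)" .
    qed
    finally show "(\<integral>\<^sup>+p. indicator (ball x0 (2 * r) \<times> {0<..r}) p * ennreal ((LP_G m K f (snd p) (fst p))\<^sup>2 / snd p) \<partial>(lborel \<Otimes>\<^sub>M lborel))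
      \<le> ennreal (D * (\<Prod>j<m. b j)\<^sup>2 * r ^ DIM('a))" .
  qed
qed

subsection \<open>Square of the area integral\<close>

text \<open>For \<open>dist x x' \<le> t\<close> the difference lies in a shell of
  \<open>ball x t\<close> of that thickness, whose volume Bernoulli's inequality bounds to first
  order. For larger distances the volume of the whole ball already obeys the bound.\<close>

lemma emeasure_ball_diff_le:
  fixes x x' :: "'a::euclidean_space"
  assumes t: "0 < t"
  shows "emeasure lborel (ball x t - ball x' t) \<le> ennreal (real DIM('a) * ubv DIM('a) * t ^ (DIM('a) - 1) * dist x x')"
proof -
  define d where "d = dist x x'"
  have d: "0 \<le> d" by (simp add: d_def)
  obtain n where n: "DIM('a) = Suc n" using DIM_positive[where 'a='a] by (metis gr0_implies_Suc)
  show ?thesis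
  proof (cases "d \<le> t")
    case True
    have sub: "ball x (t - d) \<subseteq> ball x t" by (rule subset_ball) (use d in simp)
    have "ball x t - ball x' t \<subseteq> ball x t - ball x (t - d)"
    proof
      fix z assume z: "z \<in> ball x t - ball x' t"
      have "dist x' z \<le> d + dist x z" using dist_triangle[of x' z x] by (simp add: d_def dist_commute)
      then show "z \<in> ball x t - ball x (t - d)" using z by auto
    qed
    then have "emeasure lborel (ball x t - ball x' t) \<le> emeasure lborel (ball x t - ball x (t - d))"
      by (intro emeasure_mono) auto
    also have "\<dots> = emeasure lborel (ball x t) - emeasure lborel (ball x (t - d))"
      using sub emeasure_lborel_ball_finite[of x "t - d"] by (intro emeasure_Diff) auto
    also have "\<dots> = ennreal (ubv DIM('a) * t ^ DIM('a) - ubv DIM('a) * (t - d) ^ DIM('a))"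
      using True t by (simp add: emeasure_ball ennreal_minus)
    also have "\<dots> \<le> ennreal (ubv DIM('a) * (real DIM('a) * t ^ (DIM('a) - 1) * d))"
    proof (rule ennreal_leI)
      have "1 + real DIM('a) * (- (d / t)) \<le> (1 + - (d / t)) ^ DIM('a)"
        using True t by (intro Bernoulli_inequality) (simp add: divide_le_eq)
      then have "t ^ DIM('a) * (1 + real DIM('a) * (- (d / t))) \<le> t ^ DIM('a) * (1 + - (d / t)) ^ DIM('a)"
        using t by (intro mult_left_mono) auto
      also have "\<dots> = (t * (1 + - (d / t))) ^ DIM('a)" by (simp add: power_mult_distrib)
      also have "t * (1 + - (d / t)) = t - d" using t by (simp add: field_simps)
      also have "t ^ DIM('a) * (1 + real DIM('a) * (- (d / t))) = t ^ DIM('a) - real DIM('a) * t ^ (DIM('a) - 1) * d"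
        using t by (simp add: n field_simps)
      finally have "ubv DIM('a) * (t ^ DIM('a) - real DIM('a) * t ^ (DIM('a) - 1) * d) \<le> ubv DIM('a) * (t - d) ^ DIM('a)"
        by (intro mult_left_mono) auto
      then show "ubv DIM('a) * t ^ DIM('a) - ubv DIM('a) * (t - d) ^ DIM('a) \<le> ubv DIM('a) * (real DIM('a) * t ^ (DIM('a) - 1) * d)"
        by (simp add: right_diff_distrib)
    qed
    finally show ?thesis by (simp add: d_def mult_ac)
  next
    case False
    have "emeasure lborel (ball x t - ball x' t) \<le> emeasure lborel (ball x t)"
      by (intro emeasure_mono) auto
    also have "\<dots> = ennreal (ubv DIM('a) * t ^ (DIM('a) - 1) * t)" using t by (simp add: emeasure_ball n mult_ac)
    also have "\<dots> \<le> ennreal (ubv DIM('a) * t ^ (DIM('a) - 1) * (real DIM('a) * d))"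
    proof (intro ennreal_leI mult_left_mono)
      have "1 * d \<le> real DIM('a) * d" using d by (intro mult_right_mono) (auto simp: n)
      then show "t \<le> real DIM('a) * d" using False by simp
    qed (use t in auto)
    finally show ?thesis by (simp add: d_def mult_ac)
  qed
qed

section \<open>Area integrals of bounded functions satisfying a Carleson estimate\<close>

locale area_function =
  fixes G :: "'a::euclidean_space \<times> real \<Rightarrow> real" and \<Gamma> \<Lambda> :: real
  assumes G_meas [measurable]: "G \<in> borel_measurable (lborel \<Otimes>\<^sub>M lborel)"
    and G_bound: "\<And>z t. 0 < t \<Longrightarrow> \<bar>G (z, t)\<bar> \<le> \<Gamma>" and \<Lambda>: "0 \<le> \<Lambda>"
    and G_carleson: "\<And>x0 r. 0 < r \<Longrightarrow>
      (\<integral>\<^sup>+p. indicator (ball x0 (2 * r) \<times> {0<..r}) p * ennreal ((G p)\<^sup>2 / snd p) \<partial>(lborel \<Otimes>\<^sub>M lborel)) \<le> ennreal (\<Lambda> * r ^ DIM('a))"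
begin

definition w :: "'a \<times> real \<Rightarrow> ennreal" where "w p = ennreal ((G p)\<^sup>2 / snd p ^ (DIM('a) + 1))"

definition cone_sq :: "'a \<Rightarrow> ennreal" where
  "cone_sq x = (\<integral>\<^sup>+p. indicator {(z, t). 0 < t \<and> dist z x < t} p * w p \<partial>(lborel \<Otimes>\<^sub>M lborel))"

definition near :: "real \<Rightarrow> 'a \<Rightarrow> ennreal" where
  "near r x = (\<integral>\<^sup>+p. (if 0 < snd p \<and> snd p \<le> r \<and> dist (fst p) x < snd p then w p else 0) \<partial>(lborel \<Otimes>\<^sub>M lborel))"

definition far :: "real \<Rightarrow> 'a \<Rightarrow> ennreal" where
  "far r x = (\<integral>\<^sup>+p. (if r < snd p \<and> dist (fst p) x < snd p then w p else 0) \<partial>(lborel \<Otimes>\<^sub>M lborel))"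

text \<open>For points at distance below \<open>2 * r\<close>, the level \<open>t\<close>
  contributes at most \<open>far_const * r / t\<^sup>2\<close>; integrating over
  \<open>t > r\<close> gives this number for every \<open>r\<close>.\<close>

definition far_const :: real where "far_const = 2 * real DIM('a) * ubv DIM('a) * \<Gamma>\<^sup>2"

lemma far_const_nonneg: "0 \<le> far_const" by (simp add: far_const_def)

lemma w_measurable [measurable]: "w \<in> borel_measurable (lborel \<Otimes>\<^sub>M lborel)"
  unfolding w_def by measurable

lemma sigma_finite_half_space: "sigma_finite_measure (lborel \<Otimes>\<^sub>M lborel :: ('a \<times> real) measure)"
  by (simp add: lborel_prod sigma_finite_lborel)

lemma near_measurable [measurable]: "near r \<in> borel_measurable lborel"
proof -
  have "(\<lambda>q. if 0 < snd (snd q) \<and> snd (snd q) \<le> r \<and> dist (fst (snd q)) (fst q) < snd (snd q) then w (snd q) else 0)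
    \<in> borel_measurable (lborel \<Otimes>\<^sub>M (lborel \<Otimes>\<^sub>M lborel))" by measurable
  then show ?thesis unfolding near_def[abs_def]
    by (intro sigma_finite_measure.borel_measurable_nn_integral[OF sigma_finite_half_space]) (simp only: case_prod_unfold)
qed

lemma cone_sq_measurable [measurable]: "cone_sq \<in> borel_measurable lborel"
proof -
  have "(\<lambda>q. if 0 < snd (snd q) \<and> dist (fst (snd q)) (fst q) < snd (snd q) then w (snd q) else 0)
    \<in> borel_measurable (lborel \<Otimes>\<^sub>M (lborel \<Otimes>\<^sub>M lborel))" by measurable
  moreover have eq: "cone_sq = (\<lambda>x. \<integral>\<^sup>+p. (if 0 < snd p \<and> dist (fst p) x < snd p then w p else 0) \<partial>(lborel \<Otimes>\<^sub>M lborel))"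
    unfolding cone_sq_def by (intro ext nn_integral_cong) (auto simp: indicator_def)
  ultimately show ?thesis unfolding eq
    by (intro sigma_finite_measure.borel_measurable_nn_integral[OF sigma_finite_half_space]) (simp only: case_prod_unfold)
qed

lemma cone_sq_split:
  assumes "0 < r"
  shows "cone_sq x = near r x + far r x"
proof -
  have "near r x + far r x = (\<integral>\<^sup>+p. (if 0 < snd p \<and> snd p \<le> r \<and> dist (fst p) x < snd p then w p else 0)
     + (if r < snd p \<and> dist (fst p) x < snd p then w p else 0) \<partial>(lborel \<Otimes>\<^sub>M lborel))"
    unfolding near_def far_def by (rule nn_integral_add[symmetric]) measurable
  also have "\<dots> = cone_sq x"
    unfolding cone_sq_def using assms by (intro nn_integral_cong) (auto simp: indicator_def)
  finally show ?thesis by simp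
qed

text \<open>By Fubini each \<open>(z, t)\<close> is counted with at most the volume of
  \<open>ball z t\<close>, which turns the denominator \<open>t ^ (DIM('a) + 1)\<close> into
  \<open>t\<close>, the Carleson normalisation. As \<open>t \<le> r\<close> and \<open>x\<close>
  lies in \<open>ball x0 r\<close>, the point \<open>z\<close> stays in
  \<open>ball x0 (2 * r)\<close>.\<close>

lemma near_integral_le:
  assumes r: "0 < r"
  shows "(\<integral>\<^sup>+x. near r x * indicator (ball x0 r) x \<partial>lborel) \<le> ennreal (ubv DIM('a) * \<Lambda> * r ^ DIM('a))"
proof -
  interpret pair_sigma_finite "lborel :: 'a measure" "lborel \<Otimes>\<^sub>M lborel :: ('a \<times> real) measure"
    unfolding pair_sigma_finite_def using sigma_finite_half_space sigma_finite_lborel by blast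
  let ?B = "lborel \<Otimes>\<^sub>M lborel :: ('a \<times> real) measure"
  let ?g = "\<lambda>x p. (if 0 < snd p \<and> snd p \<le> r \<and> dist (fst p) x < snd p then w p else 0) * indicator (ball x0 r) x"
  have "(\<integral>\<^sup>+x. near r x * indicator (ball x0 r) x \<partial>lborel) = (\<integral>\<^sup>+x. \<integral>\<^sup>+p. ?g x p \<partial>?B \<partial>lborel)"
    unfolding near_def by (intro nn_integral_cong nn_integral_multc[symmetric]) measurable
  also have "\<dots> = (\<integral>\<^sup>+p. \<integral>\<^sup>+x. ?g x p \<partial>lborel \<partial>?B)"
    by (rule Fubini'[symmetric]) measurable
  also have "\<dots> \<le> (\<integral>\<^sup>+p. ennreal (ubv DIM('a)) * (indicator (ball x0 (2 * r) \<times> {0<..r}) p * ennreal ((G p)\<^sup>2 / snd p)) \<partial>?B)"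
  proof (rule nn_integral_mono)
    fix p :: "'a \<times> real"
    obtain z t where p: "p = (z, t)" by (cases p)
    show "(\<integral>\<^sup>+x. ?g x p \<partial>lborel) \<le> ennreal (ubv DIM('a)) * (indicator (ball x0 (2 * r) \<times> {0<..r}) p * ennreal ((G p)\<^sup>2 / snd p))"
    proof (cases "0 < t \<and> t \<le> r")
      case True
      then have t: "0 < t" "t \<le> r" by auto
      have "(\<integral>\<^sup>+x. ?g x p \<partial>lborel) \<le> (\<integral>\<^sup>+x. (w p * indicator (ball x0 (2 * r)) z) * indicator (ball z t) x \<partial>lborel)"
      proof (rule nn_integral_mono)
        fix x
        show "?g x p \<le> (w p * indicator (ball x0 (2 * r)) z) * indicator (ball z t) x"
        proof (cases "dist z x < t \<and> x \<in> ball x0 r")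
          case True
          then have "dist x0 z < 2 * r" using dist_triangle[of x0 z x] t by (simp add: dist_commute)
          then show ?thesis using True by (auto simp: p indicator_def)
        qed (auto simp: p)
      qed
      also have "\<dots> = (w p * indicator (ball x0 (2 * r)) z) * emeasure lborel (ball z t)"
        by (subst nn_integral_cmult_indicator) auto
      also have "\<dots> = (w p * ennreal (ubv DIM('a) * t ^ DIM('a))) * indicator (ball x0 (2 * r)) z"
        using t by (simp add: emeasure_ball mult_ac)
      also have "w p * ennreal (ubv DIM('a) * t ^ DIM('a)) = ennreal (ubv DIM('a)) * ennreal ((G p)\<^sup>2 / snd p)"
        using t by (simp add: w_def p ennreal_mult[symmetric])
      finally show ?thesis using t by (simp add: p indicator_times mult_ac)
    qed (auto simp: p)
  qed
  also have "\<dots> = ennreal (ubv DIM('a)) * (\<integral>\<^sup>+p. (indicator (ball x0 (2 * r) \<times> {0<..r}) p * ennreal ((G p)\<^sup>2 / snd p)) \<partial>?B)"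
    by (rule nn_integral_cmult) measurable
  also have "\<dots> \<le> ennreal (ubv DIM('a)) * ennreal (\<Lambda> * r ^ DIM('a))"
    by (intro mult_left_mono G_carleson r) auto
  also have "\<dots> = ennreal (ubv DIM('a) * \<Lambda> * r ^ DIM('a))"
    using \<Lambda> r by (simp add: ennreal_mult[symmetric] mult.assoc)
  finally show ?thesis .
qed

text \<open>With \<open>n = DIM('a)\<close>, the levels of the two cones at height \<open>t\<close>
  differ in a set of measure of order \<open>t ^ (n - 1) * r\<close>. The bound \<Gamma> on
  \<open>G\<close> and the denominator \<open>t ^ (n + 1)\<close> leave
  \<open>r / t\<^sup>2\<close>, which is integrable above \<open>r\<close>.\<close>

lemma far_le:
  assumes r: "0 < r" and x: "dist x x' < 2 * r"
  shows "far r x \<le> far r x' + ennreal far_const"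
proof -
  let ?B = "lborel \<Otimes>\<^sub>M lborel :: ('a \<times> real) measure"
  let ?h = "\<lambda>p. if r < snd p \<and> dist (fst p) x < snd p \<and> \<not> dist (fst p) x' < snd p then w p else 0"
  have "far r x \<le> (\<integral>\<^sup>+p. (if r < snd p \<and> dist (fst p) x' < snd p then w p else 0) + ?h p \<partial>?B)"
    unfolding far_def by (intro nn_integral_mono) auto
  also have "\<dots> = far r x' + (\<integral>\<^sup>+p. ?h p \<partial>?B)"
    unfolding far_def by (rule nn_integral_add) measurable
  also have "(\<integral>\<^sup>+p. ?h p \<partial>?B) \<le> ennreal far_const"
  proof -
    have "(\<integral>\<^sup>+p. ?h p \<partial>?B) = (\<integral>\<^sup>+t. \<integral>\<^sup>+z. ?h (z, t) \<partial>lborel \<partial>lborel)"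
      by (rule lborel_pair.nn_integral_snd[symmetric]) measurable
    also have "\<dots> \<le> (\<integral>\<^sup>+t. ennreal (far_const * r) * (ennreal (t powr (- 2)) * indicator {r..} t) \<partial>lborel)"
    proof (rule nn_integral_mono)
      fix t :: real
      show "(\<integral>\<^sup>+z. ?h (z, t) \<partial>lborel) \<le> ennreal (far_const * r) * (ennreal (t powr (- 2)) * indicator {r..} t)"
      proof (cases "r < t")
        case True
        then have t: "0 < t" using r by simp
        obtain n where n: "DIM('a) = Suc n" using DIM_positive[where 'a='a] by (metis gr0_implies_Suc)
        have "(\<integral>\<^sup>+z. ?h (z, t) \<partial>lborel) \<le> (\<integral>\<^sup>+z. ennreal (\<Gamma>\<^sup>2 / t ^ (DIM('a) + 1)) * indicator (ball x t - ball x' t) z \<partial>lborel)"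
        proof (rule nn_integral_mono)
          fix z
          have "(G (z, t))\<^sup>2 \<le> \<Gamma>\<^sup>2" using power_mono[OF G_bound[OF t, of z], of 2] by simp
          then have "w (z, t) \<le> ennreal (\<Gamma>\<^sup>2 / t ^ (DIM('a) + 1))"
            unfolding w_def using t by (intro ennreal_leI) (simp add: divide_right_mono)
          then show "?h (z, t) \<le> ennreal (\<Gamma>\<^sup>2 / t ^ (DIM('a) + 1)) * indicator (ball x t - ball x' t) z"
            by (auto simp: indicator_def dist_commute)
        qed
        also have "\<dots> = ennreal (\<Gamma>\<^sup>2 / t ^ (DIM('a) + 1)) * emeasure lborel (ball x t - ball x' t)"
          by (subst nn_integral_cmult_indicator) auto
        also have "\<dots> \<le> ennreal (\<Gamma>\<^sup>2 / t ^ (DIM('a) + 1)) * ennreal (real DIM('a) * ubv DIM('a) * t ^ (DIM('a) - 1) * dist x x')"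
          by (intro mult_left_mono emeasure_ball_diff_le t) auto
        also have "\<dots> \<le> ennreal (\<Gamma>\<^sup>2 / t ^ (DIM('a) + 1)) * ennreal (real DIM('a) * ubv DIM('a) * t ^ (DIM('a) - 1) * (2 * r))"
          using x t by (intro mult_left_mono ennreal_leI) auto
        also have "\<dots> = ennreal (\<Gamma>\<^sup>2 / t ^ (DIM('a) + 1) * (real DIM('a) * ubv DIM('a) * t ^ (DIM('a) - 1) * (2 * r)))"
          using t r by (intro ennreal_mult[symmetric]) auto
        also have "\<Gamma>\<^sup>2 / t ^ (DIM('a) + 1) * (real DIM('a) * ubv DIM('a) * t ^ (DIM('a) - 1) * (2 * r)) = far_const * r * t powr (- 2)"
          using t by (simp add: n far_const_def powr_minus powr_numeral power2_eq_square field_simps)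
        also have "ennreal (far_const * r * t powr (- 2)) = ennreal (far_const * r) * (ennreal (t powr (- 2)) * indicator {r..} t)"
          using True far_const_nonneg r by (simp add: ennreal_mult)
        finally show ?thesis .
      qed simp
    qed
    also have "\<dots> = ennreal (far_const * r) * (\<integral>\<^sup>+t. ennreal (t powr (- 2)) * indicator {r..} t \<partial>lborel)"
      by (rule nn_integral_cmult) measurable
    also have "\<dots> = ennreal far_const"
      using r far_const_nonneg by (subst nn_integral_powr_atLeast) (auto simp: ennreal_mult[symmetric] powr_minus)
    finally show ?thesis .
  qed
  finally show ?thesis by (simp add: add_left_mono)
qed

text \<open>\<open>enn2real\<close> sends \<infinity> to 0, so \<open>F\<close> vanishes where
  \<open>cone_sq\<close> is infinite. Whenever a point with a small value of \<open>F\<close> is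
  picked, finiteness of \<open>cone_sq\<close> there has to be ensured as well.\<close>

definition F :: "'a \<Rightarrow> real" where "F x = enn2real (cone_sq x)"

lemma F_nonneg: "0 \<le> F x" by (simp add: F_def)

lemma F_measurable [measurable]: "F \<in> borel_measurable borel"
proof -
  have "F \<in> borel_measurable lborel" unfolding F_def[abs_def] by measurable
  then show ?thesis by simp
qed

lemma cone_sq_le:
  assumes r: "0 < r" and x: "x \<in> ball x0 r" "x' \<in> ball x0 r"
  shows "cone_sq x \<le> near r x + (cone_sq x' + ennreal far_const)"
proof -
  have "dist x x' < 2 * r" using x dist_triangle2[of x x' x0] by (simp add: dist_commute)
  then have "far r x \<le> far r x' + ennreal far_const" by (rule far_le[OF r])
  also have "far r x' \<le> cone_sq x'" unfolding cone_sq_split[OF r] by simp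
  finally show ?thesis unfolding cone_sq_split[OF r, of x] by (simp add: add_left_mono add_right_mono)
qed

text \<open>One comparison point serves twice: a point of finiteness gives integrability on balls,
  and a point close to the essential infimum gives the BLO estimate. That \<open>c\<close> appears
  with coefficient exactly 1 times the volume is what allows the infimum to be subtracted.\<close>

lemma cone_sq_integral_le:
  assumes r: "0 < r" and x': "x' \<in> ball x0 r" and c: "cone_sq x' \<le> ennreal c" and c0: "0 \<le> c"
  shows "(\<integral>\<^sup>+x. cone_sq x * indicator (ball x0 r) x \<partial>lborel)
    \<le> ennreal ((\<Lambda> + c + far_const) * (ubv DIM('a) * r ^ DIM('a)))"
proof -
  have "(\<integral>\<^sup>+x. cone_sq x * indicator (ball x0 r) x \<partial>lborel)
    \<le> (\<integral>\<^sup>+x. near r x * indicator (ball x0 r) x + ennreal (c + far_const) * indicator (ball x0 r) x \<partial>lborel)"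
  proof (rule nn_integral_mono)
    fix x
    show "cone_sq x * indicator (ball x0 r) x \<le> near r x * indicator (ball x0 r) x + ennreal (c + far_const) * indicator (ball x0 r) x"
    proof (cases "x \<in> ball x0 r")
      case True
      have "cone_sq x \<le> near r x + (cone_sq x' + ennreal far_const)" by (rule cone_sq_le[OF r True x'])
      also have "\<dots> \<le> near r x + (ennreal c + ennreal far_const)" by (intro add_left_mono add_right_mono c)
      also have "ennreal c + ennreal far_const = ennreal (c + far_const)" using c0 far_const_nonneg by simp
      finally show ?thesis using True by simp
    qed simp
  qed
  also have "\<dots> = (\<integral>\<^sup>+x. near r x * indicator (ball x0 r) x \<partial>lborel) + ennreal (c + far_const) * emeasure lborel (ball x0 r)"
    by (subst nn_integral_add) (auto simp: nn_integral_cmult_indicator)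
  also have "\<dots> \<le> ennreal (ubv DIM('a) * \<Lambda> * r ^ DIM('a)) + ennreal (c + far_const) * emeasure lborel (ball x0 r)"
    by (intro add_right_mono near_integral_le r)
  also have "\<dots> = ennreal ((\<Lambda> + c + far_const) * (ubv DIM('a) * r ^ DIM('a)))"
    using r c0 far_const_nonneg \<Lambda>
    by (simp add: emeasure_ball ennreal_mult[symmetric] ennreal_plus[symmetric] algebra_simps del: ennreal_plus)
  finally show ?thesis .
qed

context
  fixes x1 :: 'a
  assumes fin: "cone_sq x1 \<noteq> \<infinity>"
begin

lemma cone_sq_ball_finite:
  assumes r: "0 < r"
  shows "(\<integral>\<^sup>+x. cone_sq x * indicator (ball x0 r) x \<partial>lborel) < \<infinity>"
proof -
  \<comment> \<open>The ball is enlarged to one centred at the known point of finiteness.\<close>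
  define R where "R = r + dist x0 x1"
  have R: "0 < R" using r by (simp add: R_def add_pos_nonneg)
  have sub: "ball x0 r \<subseteq> ball x1 R"
  proof
    fix z assume "z \<in> ball x0 r"
    then show "z \<in> ball x1 R" using dist_triangle[of x1 z x0] by (simp add: R_def dist_commute)
  qed
  have "cone_sq x1 \<le> ennreal (F x1)" using fin by (simp add: F_def less_top)
  then have "(\<integral>\<^sup>+x. cone_sq x * indicator (ball x1 R) x \<partial>lborel) < \<infinity>"
    using cone_sq_integral_le[OF R, of x1 x1 "F x1"] R by (auto intro: order.strict_trans1 simp: F_nonneg)
  moreover have "(\<integral>\<^sup>+x. cone_sq x * indicator (ball x0 r) x \<partial>lborel) \<le> (\<integral>\<^sup>+x. cone_sq x * indicator (ball x1 R) x \<partial>lborel)"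
    using sub by (intro nn_integral_mono mult_left_mono) (auto simp: indicator_def)
  ultimately show ?thesis by (rule order.strict_trans1[rotated])
qed

lemma cone_sq_AE_finite: "AE x in lborel. cone_sq x < \<infinity>"
proof -
  have "AE x in lborel. \<forall>N. cone_sq x * indicator (ball 0 (real (Suc N))) x \<noteq> \<infinity>"
    unfolding AE_all_countable
  proof
    fix N
    show "AE x in lborel. cone_sq x * indicator (ball 0 (real (Suc N))) x \<noteq> \<infinity>"
      using cone_sq_ball_finite[of "real (Suc N)" 0] by (intro nn_integral_PInf_AE) auto
  qed
  then show ?thesis
  proof eventually_elim
    case (elim x)
    obtain N where "norm x < real N" using reals_Archimedean2 by blast
    then have "x \<in> ball 0 (real (Suc N))" by simp
    then show ?case using elim[rule_format, of N] by (simp add: less_top)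
  qed
qed

lemma F_ball_nn_integral:
  "(\<integral>\<^sup>+x. ennreal (F x) * indicator (ball x0 r) x \<partial>lborel) \<le> (\<integral>\<^sup>+x. cone_sq x * indicator (ball x0 r) x \<partial>lborel)"
  by (intro nn_integral_mono mult_right_mono) (auto simp: F_def ennreal_enn2real_if)

lemma F_set_integrable: "set_integrable lborel (ball x0 r) F"
proof (cases "0 < r")
  case True
  have "(\<integral>\<^sup>+x. ennreal (F x) * indicator (ball x0 r) x \<partial>lborel) < \<infinity>"
    using F_ball_nn_integral cone_sq_ball_finite[OF True] by (rule order.strict_trans1)
  then show ?thesis
    unfolding set_integrable_def
    by (intro integrableI_bounded) (auto simp: F_nonneg ennreal_mult ennreal_indicator mult.commute)
qed (simp add: set_integrable_def ball_empty)

lemma F_set_integral_nn: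
  assumes "0 < r"
  shows "ennreal (LINT y:ball x0 r|lborel. F y) = (\<integral>\<^sup>+x. ennreal (F x) * indicator (ball x0 r) x \<partial>lborel)"
  using nn_set_integral_abs[OF F_set_integrable, of x0 r] by (simp add: F_nonneg)

text \<open>The essential infimum lies between 0 and the mean of \<open>F\<close>. Being a real
  number, it passes unchanged through \<open>real_of_ereal\<close> in
  \<open>blo_osc\<close>.\<close>

lemma F_ess_inf:
  assumes r: "0 < r"
  shows "\<exists>i\<ge>0. ess_inf_ball F x0 r = ereal i"
proof -
  let ?A = "{ereal c | c. AE y in lborel. y \<in> ball x0 r \<longrightarrow> c \<le> F y}"
  define v where "v = ubv DIM('a) * r ^ DIM('a)"
  have v: "0 < v" using r by (simp add: v_def)
  have low: "0 \<le> ess_inf_ball F x0 r"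
    unfolding ess_inf_ball_def by (rule Sup_upper) (auto simp: F_nonneg zero_ereal_def)
  have "ess_inf_ball F x0 r \<le> ereal ((LINT y:ball x0 r|lborel. F y) / v)"
    unfolding ess_inf_ball_def
  proof (rule Sup_least)
    fix s assume "s \<in> ?A"
    then obtain c where c: "s = ereal c" "AE y in lborel. y \<in> ball x0 r \<longrightarrow> c \<le> F y" by blast
    have "(LINT y:ball x0 r|lborel. c) \<le> (LINT y:ball x0 r|lborel. F y)"
      by (rule set_integral_mono_AE[OF set_integrable_ball_const F_set_integrable]) (use c(2) in simp)
    then show "s \<le> ereal ((LINT y:ball x0 r|lborel. F y) / v)"
      using r v by (simp add: set_integral_ball_const v_def[symmetric] c(1) pos_le_divide_eq)
  qed
  with low show ?thesis
    by (cases "ess_inf_ball F x0 r") auto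
qed

text \<open>A point where \<open>F\<close> exceeds the essential infimum by less than \<epsilon>
  serves as comparison point, and \<epsilon> is arbitrary.\<close>

lemma F_blo_osc:
  assumes r: "0 < r"
  shows "blo_osc F x0 r \<le> \<Lambda> + far_const"
proof -
  define v where "v = ubv DIM('a) * r ^ DIM('a)"
  have v: "0 < v" using r by (simp add: v_def)
  obtain i where i: "0 \<le> i" "ess_inf_ball F x0 r = ereal i" using F_ess_inf[OF r] by blast
  define I where "I = (LINT y:ball x0 r|lborel. F y)"
  have "I \<le> (\<Lambda> + i + far_const) * v + \<epsilon> * v" if \<epsilon>: "0 < \<epsilon>" for \<epsilon>
  proof -
    have "\<not> (AE y in lborel. y \<in> ball x0 r \<longrightarrow> i + \<epsilon> \<le> F y)"
    proof
      assume "AE y in lborel. y \<in> ball x0 r \<longrightarrow> i + \<epsilon> \<le> F y"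
      then have "ereal (i + \<epsilon>) \<le> ess_inf_ball F x0 r"
        unfolding ess_inf_ball_def by (intro Sup_upper) auto
      then show False using i \<epsilon> by simp
    qed
    moreover have "AE y in lborel. y \<in> ball x0 r \<longrightarrow> i + \<epsilon> \<le> F y"
      if none: "\<And>x'. x' \<in> ball x0 r \<Longrightarrow> cone_sq x' < \<infinity> \<Longrightarrow> \<not> F x' < i + \<epsilon>"
      using cone_sq_AE_finite
    proof eventually_elim
      case (elim y)
      then show ?case using none[of y] by (auto simp: not_less)
    qed
    \<comment> \<open>\<open>i + \<epsilon>\<close> is not an essential lower bound and
      \<open>cone_sq\<close> is infinite only on a null set, so both properties hold at some point.
      Without finiteness, a small \<open>F x'\<close> would say nothing about
      \<open>cone_sq x'\<close>.\<close>
    ultimately obtain x' where x': "x' \<in> ball x0 r" "F x' < i + \<epsilon>" "cone_sq x' < \<infinity>"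
      by blast
    have "cone_sq x' = ennreal (F x')" using x'(3) by (simp add: F_def less_top)
    also have "\<dots> \<le> ennreal (i + \<epsilon>)" using x'(2) by (intro ennreal_leI) simp
    finally have "(\<integral>\<^sup>+x. cone_sq x * indicator (ball x0 r) x \<partial>lborel) \<le> ennreal ((\<Lambda> + (i + \<epsilon>) + far_const) * v)"
      unfolding v_def using i \<epsilon> by (intro cone_sq_integral_le[OF r x'(1)]) auto
    then have "ennreal I \<le> ennreal ((\<Lambda> + (i + \<epsilon>) + far_const) * v)"
      unfolding I_def F_set_integral_nn[OF r] using F_ball_nn_integral order_trans by blast
    then have "I \<le> (\<Lambda> + (i + \<epsilon>) + far_const) * v"
      using i \<epsilon> \<Lambda> far_const_nonneg v by (subst (asm) ennreal_le_iff) auto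
    then show ?thesis by (simp add: algebra_simps)
  qed
  then have "I \<le> (\<Lambda> + i + far_const) * v + e" if "0 < e" for e
    using that v by (metis divide_pos_pos nonzero_eq_divide_eq less_irrefl)
  then have I: "I \<le> (\<Lambda> + i + far_const) * v" by (rule field_le_epsilon)
  have "(LINT y:ball x0 r|lborel. F y - i) = I - i * v"
    unfolding I_def v_def using r
    by (subst set_integral_diff) (auto simp: F_set_integrable set_integrable_ball_const set_integral_ball_const)
  then have "blo_osc F x0 r = (I - i * v) / v"
    using r by (simp add: blo_osc_def avg_ball_def i measure_lborel_ball v_def)
  also have "\<dots> \<le> \<Lambda> + far_const"
    using I v by (simp add: pos_divide_le_eq algebra_simps)
  finally show ?thesis .
qed

lemma F_BLO: "BLO F"
  unfolding BLO_def loc_int_def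
proof (intro conjI allI exI impI)
  show "blo_osc F x r \<le> \<Lambda> + far_const" if "0 < r" for x r by (rule F_blo_osc[OF that])
  show "ess_inf_ball F x r \<noteq> - \<infinity>" if "0 < r" for x r using F_ess_inf[OF that, of x] by auto
qed (auto simp: F_set_integrable)

end

end

section \<open>The multilinear area integral as an instance\<close>

lemma lusin_enn2real: "(enn2real (lusin m K f x))\<^sup>2 = enn2real (lusin_sq m K f x)"
  by (simp add: lusin_def)

lemma lusin_infinite_iff: "lusin m K f x = \<infinity> \<longleftrightarrow> lusin_sq m K f x = \<infinity>"
  by (simp add: lusin_def)

lemma lusin_finite_iff: "lusin m K f x < \<infinity> \<longleftrightarrow> lusin_sq m K f x < \<infinity>"
  by (simp add: lusin_def less_top[symmetric])

theorem theorem3p5: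
  fixes m :: nat and K :: "(nat \<Rightarrow> 'a::euclidean_space) \<Rightarrow> real"
  assumes "2 \<le> m"
    and "LP_kernel m K"
    and "lusin_bounded m K"
  shows "\<exists>C>0. \<forall>f :: nat \<Rightarrow> 'a \<Rightarrow> real. (\<forall>i<m. BMO (f i)) \<longrightarrow>
           (\<forall>x. lusin m K f x = \<infinity>) \<or>
           ((AE x in lborel. lusin m K f x < \<infinity>) \<and>
            BLO (\<lambda>x. (enn2real (lusin m K f x))\<^sup>2) \<and>
            blo_norm (\<lambda>x. (enn2real (lusin m K f x))\<^sup>2) \<le> C * (\<Prod>i<m. (bmo_norm (f i))\<^sup>2))"
proof -
  have m: "0 < m" using assms(1) by simp
  obtain C where C: "0 < C" and est: "\<And>f b. (\<forall>j<m. bmo_le (f j) (b j) \<and> 0 < b j) \<Longrightarrow>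
    (\<lambda>p. LP_G m K f (snd p) (fst p)) \<in> borel_measurable (lborel \<Otimes>\<^sub>M lborel) \<and>
    (\<forall>t>0. \<forall>z. \<bar>LP_G m K f t z\<bar> \<le> C * (\<Prod>j<m. b j)) \<and>
    (\<forall>x0. \<forall>r>0. (\<integral>\<^sup>+p. indicator (ball x0 (2 * r) \<times> {0<..r}) p * ennreal ((LP_G m K f (snd p) (fst p))\<^sup>2 / snd p) \<partial>(lborel \<Otimes>\<^sub>M lborel))
      \<le> ennreal (C * (\<Prod>j<m. b j)\<^sup>2 * r ^ DIM('a)))"
    using LP_G_estimates[OF assms(2) m] by blast
  \<comment> \<open>With \<open>B\<close> the product of the bounds, \<Lambda> is
    \<open>C * B\<^sup>2\<close> and \<Gamma> is \<open>C * B\<close>, so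
    \<open>\<Lambda> + far_const\<close> equals \<open>D * B\<^sup>2\<close>.\<close>
  define D where "D = C + 2 * real DIM('a) * ubv DIM('a) * C\<^sup>2"
  have D: "0 < D" using C by (simp add: D_def add_pos_nonneg)
  show ?thesis
  proof (intro exI[of _ D] conjI D allI impI)
    fix f :: "nat \<Rightarrow> 'a \<Rightarrow> real" assume f: "\<forall>i<m. BMO (f i)"
    define G where "G p = LP_G m K f (snd p) (fst p)" for p
    define F where "F x = enn2real (lusin_sq m K f x)" for x
    \<comment> \<open>Some \<open>bmo_norm (f j)\<close> may vanish, while the estimates ask for
      positive bounds; hence the added \<epsilon>, which is sent to 0 later.\<close>
    have area: "area_function G (C * (\<Prod>j<m. bmo_norm (f j) + \<epsilon>)) (C * (\<Prod>j<m. bmo_norm (f j) + \<epsilon>)\<^sup>2)"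
      if \<epsilon>: "0 < \<epsilon>" for \<epsilon>
    proof -
      have "bmo_le (f j) (bmo_norm (f j) + \<epsilon>) \<and> 0 < bmo_norm (f j) + \<epsilon>" if "j < m" for j
      proof -
        have "BMO (f j)" using f that by simp
        then have "bmo_le (f j) (bmo_norm (f j))" "bmo_le (f j) (bmo_norm (f j) + \<epsilon>)"
          using \<epsilon> by (auto intro: BMO_imp_bmo_le)
        then show ?thesis using bmo_le_nonneg \<epsilon> by (auto intro: add_nonneg_pos)
      qed
      then have *: "\<forall>j<m. bmo_le (f j) (bmo_norm (f j) + \<epsilon>) \<and> 0 < bmo_norm (f j) + \<epsilon>" by blast
      from est[OF this] show ?thesis
        using C unfolding area_function_def G_def by auto
    qed
    have cone: "area_function.cone_sq G = lusin_sq m K f"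
      using area[of 1] by (intro ext) (simp add: area_function.cone_sq_def area_function.w_def lusin_sq_def G_def)
    have F: "area_function.F G = F"
      using area[of 1] by (intro ext) (simp add: area_function.F_def cone F_def)
    show "(\<forall>x. lusin m K f x = \<infinity>) \<or>
           ((AE x in lborel. lusin m K f x < \<infinity>) \<and>
            BLO (\<lambda>x. (enn2real (lusin m K f x))\<^sup>2) \<and>
            blo_norm (\<lambda>x. (enn2real (lusin m K f x))\<^sup>2) \<le> D * (\<Prod>i<m. (bmo_norm (f i))\<^sup>2))"
    proof (cases "\<forall>x. lusin m K f x = \<infinity>")
      case False
      then obtain x1 where "lusin m K f x1 \<noteq> \<infinity>" by blast
      then have x1: "area_function.cone_sq G x1 \<noteq> \<infinity>" by (simp only: lusin_infinite_iff cone not_False_eq_True)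
      \<comment> \<open>The parameters \<Gamma> and \<Lambda> depend on \<epsilon> but the function
        \<open>F\<close> does not, so the limit can be taken ball by ball.\<close>
      have osc: "blo_osc F x r \<le> D * (\<Prod>j<m. (bmo_norm (f j))\<^sup>2)" if r: "0 < r" for x r
      proof (rule tendsto_lowerbound)
        show "((\<lambda>\<epsilon>. D * (\<Prod>j<m. bmo_norm (f j) + \<epsilon>)\<^sup>2) \<longlongrightarrow> D * (\<Prod>j<m. (bmo_norm (f j))\<^sup>2)) (at_right 0)"
        proof -
          have "((\<lambda>\<epsilon>. D * (\<Prod>j<m. bmo_norm (f j) + \<epsilon>)\<^sup>2) \<longlongrightarrow> D * (\<Prod>j<m. bmo_norm (f j) + 0)\<^sup>2) (at_right 0)"
            by (intro tendsto_intros)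
          then show ?thesis by (simp add: prod_power_distrib)
        qed
        show "\<forall>\<^sub>F \<epsilon> in at_right 0. blo_osc F x r \<le> D * (\<Prod>j<m. bmo_norm (f j) + \<epsilon>)\<^sup>2"
        proof (rule eventually_at_right_less[THEN eventually_mono])
          fix \<epsilon> :: real assume \<epsilon>: "0 < \<epsilon>"
          show "blo_osc F x r \<le> D * (\<Prod>j<m. bmo_norm (f j) + \<epsilon>)\<^sup>2"
            using area_function.F_blo_osc[OF area[OF \<epsilon>] x1 r, of x]
            unfolding F area_function.far_const_def[OF area[OF \<epsilon>]] D_def power_mult_distrib distrib_right
            by (simp only: mult.assoc)
        qed
      qed simp
      have "AE x in lborel. lusin m K f x < \<infinity>"
        using area_function.cone_sq_AE_finite[OF area[of 1] x1] by (simp only: cone lusin_finite_iff zero_less_one)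
      moreover have "BLO F" using area_function.F_BLO[OF area[of 1] x1] by (simp add: F)
      moreover have "blo_norm F \<le> D * (\<Prod>j<m. (bmo_norm (f j))\<^sup>2)"
        unfolding blo_norm_def using osc by (intro cSup_least) (auto intro: exI[of _ "1::real"])
      ultimately show ?thesis by (simp add: lusin_enn2real F_def[abs_def])
    qed simp
  qed
qed

end
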